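(* The $(k_1,k_2)$-Partial Vertex Cover problem is W[1]-hard when parameterized by $k_1$ and $k_2$ (i.e. by the combined parameter $k_1+k_2$).
   Context: $(k_1,k_2)$-Partial Vertex Cover (decision version): given a bipartite graph $G=(X,Y,E)$ with vertex bipartition $X,Y$, nonnegative integers $k_1,k_2$ and an integer $x$, decide whether there is a set $S\subseteq X\cup Y$ with $|S\cap X|=k_1$ and $|S\cap Y|=k_2$ such that at least $x$ edges of $G$ have at least one endpoint in $S$. (The paper phrases the problem as maximizing the number of such edges.) *)

theory Defs
  imports Main
begin

section \<open>Random access machines\<close>

text \<open>
  Structured programs of a RAM with uniform cost. The memory consists of arrays of natural
  numbers, \<open>s a i\<close> being cell \<open>i\<close> of array \<open>a\<close>; a program mentions only finitely many arrays.
  As there is no multiplication, a program running for \<open>t\<close> steps produces only numbers with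
  \<open>O(t)\<close> more bits than its input, so the model is polynomially equivalent to Turing machines.
\<close>

type_synonym state = "nat \<Rightarrow> nat \<Rightarrow> nat"

datatype exp =
    Const nat
  | Cell nat exp
  | Plus exp exp
  | Minus exp exp

fun val :: "exp \<Rightarrow> state \<Rightarrow> nat" where
  "val (Const n) s = n"
| "val (Cell a e) s = s a (val e s)"
| "val (Plus e e') s = val e s + val e' s"
| "val (Minus e e') s = val e s - val e' s"

datatype com =
    Skip
  | Assign nat exp exp
  | Seq com com
  | Cond exp com com
  | While exp com

inductive exec :: "com \<Rightarrow> state \<Rightarrow> nat \<Rightarrow> state \<Rightarrow> bool" where
  Skip: "exec Skip s 1 s"
| Assign: "exec (Assign a e e') s 1 (s(a := (s a)(val e s := val e' s)))"
| Seq: "exec c s t s' \<Longrightarrow> exec c' s' t' s'' \<Longrightarrow> exec (Seq c c') s (t + t') s''"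
| CondTrue: "val e s \<noteq> 0 \<Longrightarrow> exec c s t s' \<Longrightarrow> exec (Cond e c c') s (1 + t) s'"
| CondFalse: "val e s = 0 \<Longrightarrow> exec c' s t s' \<Longrightarrow> exec (Cond e c c') s (1 + t) s'"
| WhileFalse: "val e s = 0 \<Longrightarrow> exec (While e c) s 1 s"
| WhileTrue: "val e s \<noteq> 0 \<Longrightarrow> exec c s t s' \<Longrightarrow> exec (While e c) s' t' s'' \<Longrightarrow>
    exec (While e c) s (1 + t + t') s''"

text \<open>
  Words occupy array 0, the letters being written as 1 and 2 and the first 0 marking the end;
  hence a word written by a program is no longer than its input plus its running time.
  The parameter is cell 0 of array 1.
\<close>

definition letter :: "bool \<Rightarrow> nat" where
  "letter b = (if b then 2 else 1)"

definition initial :: "bool list \<Rightarrow> nat \<Rightarrow> state" where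
  "initial w k = (\<lambda>a i.
     if a = 0 \<and> i < length w then letter (w ! i) else if a = 1 \<and> i = 0 then k else 0)"

definition final :: "state \<Rightarrow> bool list \<Rightarrow> nat \<Rightarrow> bool" where
  "final s w k \<longleftrightarrow>
     (\<forall>i < length w. s 0 i = letter (w ! i)) \<and> s 0 (length w) = 0 \<and> s 1 0 = k"

definition computable :: "(nat \<Rightarrow> nat) \<Rightarrow> bool" where
  "computable f \<longleftrightarrow> (\<exists>c. \<forall>k. \<exists>t s. exec c (initial [] k) t s \<and> s 1 0 = f k)"


section \<open>Parameterized problems and fpt-reductions\<close>

type_synonym problem = "(bool list \<times> nat) set"

definition fpt_reducible :: "problem \<Rightarrow> problem \<Rightarrow> bool" where
  "fpt_reducible P Q \<longleftrightarrow>
     (\<exists>c f g d. computable f \<and> computable g \<and>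
       (\<forall>w k. \<exists>t s w' k'.
          exec c (initial w k) t s \<and> t \<le> f k * (length w + 1) ^ d \<and>
          final s w' k' \<and> k' \<le> g k \<and> ((w, k) \<in> P \<longleftrightarrow> (w', k') \<in> Q)))"


section \<open>The class W[1]\<close>

text \<open>
  W[1] is the closure under fpt-reductions of the weighted Fagin definable problems given by
  first-order formulas \<open>\<forall>x\<^sub>0 \<dots> x\<^sub>l\<^sub>-\<^sub>1. \<psi>(X)\<close> with \<open>\<psi>\<close> quantifier-free and \<open>X\<close> a relation variable
  (Flum and Grohe, Parameterized Complexity Theory, Chapter 5).
  A finite relational vocabulary is the list \<open>ar\<close> of the arities of its symbols.
\<close>

datatype qf =
    Rel nat "nat list"
  | RelVar "nat list"
  | Eq nat nat
  | Neg qf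
  | Conj qf qf
  | Disj qf qf

fun wf_qf :: "nat list \<Rightarrow> nat \<Rightarrow> nat \<Rightarrow> qf \<Rightarrow> bool" where
  "wf_qf ar r l (Rel i xs) \<longleftrightarrow> i < length ar \<and> length xs = ar ! i \<and> (\<forall>x \<in> set xs. x < l)"
| "wf_qf ar r l (RelVar xs) \<longleftrightarrow> length xs = r \<and> (\<forall>x \<in> set xs. x < l)"
| "wf_qf ar r l (Eq x y) \<longleftrightarrow> x < l \<and> y < l"
| "wf_qf ar r l (Neg p) \<longleftrightarrow> wf_qf ar r l p"
| "wf_qf ar r l (Conj p q) \<longleftrightarrow> wf_qf ar r l p \<and> wf_qf ar r l q"
| "wf_qf ar r l (Disj p q) \<longleftrightarrow> wf_qf ar r l p \<and> wf_qf ar r l q"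

fun sat_qf :: "(nat \<Rightarrow> nat list set) \<Rightarrow> nat list set \<Rightarrow> (nat \<Rightarrow> nat) \<Rightarrow> qf \<Rightarrow> bool" where
  "sat_qf R S v (Rel i xs) \<longleftrightarrow> map v xs \<in> R i"
| "sat_qf R S v (RelVar xs) \<longleftrightarrow> map v xs \<in> S"
| "sat_qf R S v (Eq x y) \<longleftrightarrow> v x = v y"
| "sat_qf R S v (Neg p) \<longleftrightarrow> \<not> sat_qf R S v p"
| "sat_qf R S v (Conj p q) \<longleftrightarrow> sat_qf R S v p \<and> sat_qf R S v q"
| "sat_qf R S v (Disj p q) \<longleftrightarrow> sat_qf R S v p \<or> sat_qf R S v q"

definition tuples :: "nat \<Rightarrow> nat \<Rightarrow> nat list set" where
  "tuples n r = {xs. length xs = r \<and> set xs \<subseteq> {..<n}}"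

text \<open>Structures have universe \<open>{..<n}\<close>; symbol \<open>i\<close> is interpreted by \<open>R i\<close>.\<close>

definition is_structure :: "nat list \<Rightarrow> nat \<Rightarrow> (nat \<Rightarrow> nat list set) \<Rightarrow> bool" where
  "is_structure ar n R \<longleftrightarrow> n \<ge> 1 \<and> (\<forall>i < length ar. R i \<subseteq> tuples n (ar ! i))"

definition unary :: "nat \<Rightarrow> bool list" where
  "unary n = replicate n True @ [False]"

definition enc_structure :: "nat list \<Rightarrow> nat \<Rightarrow> (nat \<Rightarrow> nat list set) \<Rightarrow> bool list" where
  "enc_structure ar n R = unary n @
     concat (map (\<lambda>i. map (\<lambda>xs. xs \<in> R i) (List.n_lists (ar ! i) [0..<n])) [0..<length ar])"

definition weighted_definability :: "nat list \<Rightarrow> nat \<Rightarrow> nat \<Rightarrow> qf \<Rightarrow> problem" where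
  "weighted_definability ar r l p =
     {(enc_structure ar n R, k) | n R k. is_structure ar n R \<and>
        (\<exists>S \<subseteq> tuples n r. card S = k \<and> (\<forall>v. (\<forall>x < l. v x < n) \<longrightarrow> sat_qf R S v p))}"

definition W1 :: "problem set" where
  "W1 = {P. \<exists>ar r l p. (\<forall>a \<in> set ar. a \<ge> 1) \<and> r \<ge> 1 \<and> wf_qf ar r l p \<and>
            fpt_reducible P (weighted_definability ar r l p)}"

definition W1_hard :: "problem \<Rightarrow> bool" where
  "W1_hard Q \<longleftrightarrow> (\<forall>P \<in> W1. fpt_reducible P Q)"


section \<open>Partial vertex cover in bipartite graphs\<close>

definition bipartite_graph :: "'a set \<Rightarrow> 'a set \<Rightarrow> 'a set set \<Rightarrow> bool" where
  "bipartite_graph X Y E \<longleftrightarrow>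
     finite X \<and> finite Y \<and> X \<inter> Y = {} \<and> E \<subseteq> {{u, v} | u v. u \<in> X \<and> v \<in> Y}"

definition has_partial_vertex_cover ::
    "'a set \<Rightarrow> 'a set \<Rightarrow> 'a set set \<Rightarrow> nat \<Rightarrow> nat \<Rightarrow> int \<Rightarrow> bool" where
  "has_partial_vertex_cover X Y E k1 k2 x \<longleftrightarrow>
     (\<exists>S \<subseteq> X \<union> Y. card (S \<inter> X) = k1 \<and> card (S \<inter> Y) = k2 \<and>
        int (card {e \<in> E. e \<inter> S \<noteq> {}}) \<ge> x)"

text \<open>
  As instances, graphs have vertex classes \<open>{..<p}\<close> and \<open>{p..<p + q}\<close> and are given by their
  biadjacency matrix. The unary notation of the target \<open>x\<close> (after its sign) is no restriction, as
  only \<open>0 \<le> x \<le> p * q\<close> is of interest, and only makes hardness a stronger claim.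
\<close>

definition enc_pvc ::
    "nat \<Rightarrow> nat \<Rightarrow> nat set set \<Rightarrow> nat \<Rightarrow> nat \<Rightarrow> int \<Rightarrow> bool list" where
  "enc_pvc p q E k1 k2 x =
     unary p @ unary q @ unary k1 @ unary k2 @ (x < 0) # unary (nat \<bar>x\<bar>) @
     concat (map (\<lambda>i. map (\<lambda>j. {i, j} \<in> E) [p..<p + q]) [0..<p])"

definition partial_vertex_cover :: problem where
  "partial_vertex_cover =
     {(enc_pvc p q E k1 k2 x, k1 + k2) | p q E k1 k2 x.
        bipartite_graph {..<p} {p..<p + q} E \<and>
        has_partial_vertex_cover {..<p} {p..<p + q} E k1 k2 x}"

end

theory Submission
  imports Defs
begin

text \<open>
  Let \<open>\<forall>x\<^sub>0 \<dots> x\<^sub>l\<^sub>-\<^sub>1. \<psi>(X)\<close> define a problem in W[1]. The number of assignments violating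
  \<open>\<psi>\<close> is an integer polynomial of constant degree in the membership indicators of \<open>X\<close>, so a set
  \<open>S = {s\<^sub>1, \<dots>, s\<^sub>k}\<close> is a solution iff the coefficients of the monomials supported on \<open>S\<close> add up to 0.
  Guessing, for every tuple of indices from \<open>{0..k}\<close>, the corresponding tuple of elements together with
  a partial sum of coefficients turns this into the search for a clique whose size depends on \<open>k\<close> only.
  No bounded search tree is needed, and the reduction runs in time polynomial in \<open>n\<close> and \<open>k\<close>.

  A clique of size \<open>T\<close> in turn is a choice of \<open>T\<close> vertices and \<open>T\<^sup>2 - T\<close> ordered edges such that every
  chosen edge has its ends among the chosen vertices. In the bipartite graph joining an edge to all
  vertices that are \<^emph>\<open>not\<close> its ends, this minimizes the number of edges between chosen vertices,
  hence maximizes the number of covered edges once all vertices and all edges have equal degrees,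
  which is achieved by padding.

  To implement the reduction on the machine, words are described by their length and bit functions,
  taken from a class of functions that is closed under bounded sums and compiled once and for all.
\<close>

section \<open>Programs\<close>

text \<open>The obstacle is that \<psi> may use X with either sign: a violation can be caused by
  tuples absent from S, which a few members of S cannot witness. Counting removes the asymmetry.
  Non-membership is 1 minus membership, so only products of memberships survive, and if m bounds
  their degree there are just (k + 1)^m index tuples to inspect, index 0 serving as padding. The
  count is a sum of nonnegative terms, so its vanishing replaces the universal quantifier.
  Compatibility in a clique is pairwise whereas a sum is global; a partial sum in every node makes
  the condition local, and the number of nodes stays polynomial since a coefficient is at most a
  constant times n^l. Membership in W[1] is itself given by an fpt-reduction, so programs have to be
  composed: the second one starts in whatever memory the first one leaves, and the length of the
  intermediate word is controlled only through the first running time.\<close>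

lemma exec_changes:
  assumes "exec c s t s'"
  shows "finite {i. s' a i \<noteq> s a i} \<and> card {i. s' a i \<noteq> s a i} \<le> t"
  using assms
proof (induction rule: exec.induct)
  case (Assign b e e' s)
  have "{i. (s(b := (s b)(val e s := val e' s))) a i \<noteq> s a i} \<subseteq> {val e s}"
    by (auto split: if_splits)
  from finite_subset[OF this] card_mono[OF _ this] show ?case by simp
next
  case (Seq c s t s' c' t' s'')
  let ?A = "{i. s' a i \<noteq> s a i}" and ?B = "{i. s'' a i \<noteq> s' a i}"
  have "{i. s'' a i \<noteq> s a i} \<subseteq> ?A \<union> ?B" by auto
  moreover have "finite (?A \<union> ?B)" "card (?A \<union> ?B) \<le> t + t'"
    using Seq.IH card_Un_le[of ?A ?B] by auto
  ultimately show ?case by (meson card_mono finite_subset le_trans)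
next
  case (WhileTrue e s c t s' t' s'')
  let ?A = "{i. s' a i \<noteq> s a i}" and ?B = "{i. s'' a i \<noteq> s' a i}"
  have "{i. s'' a i \<noteq> s a i} \<subseteq> ?A \<union> ?B" by auto
  moreover have "finite (?A \<union> ?B)" "card (?A \<union> ?B) \<le> t + t'"
    using WhileTrue.IH card_Un_le[of ?A ?B] by auto
  ultimately have "finite {i. s'' a i \<noteq> s a i} \<and> card {i. s'' a i \<noteq> s a i} \<le> t + t'"
    by (meson card_mono finite_subset le_trans)
  then show ?case by simp
qed auto

text \<open>A nonzero cell of array 0 is either an input cell or one that the run has changed, and a
  step changes at most one cell. This bounds the intermediate word when reductions are
  composed.\<close>

lemma length_final:
  assumes "exec c (initial w k) t s" and "final s w' k'"
  shows "length w' \<le> length w + t"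
proof -
  let ?C = "{i. s 0 i \<noteq> initial w k 0 i}"
  have C: "finite ?C" "card ?C \<le> t" using exec_changes[OF assms(1)] by auto
  have "{..<length w'} \<subseteq> {..<length w} \<union> ?C"
  proof
    fix i assume "i \<in> {..<length w'}"
    then have "s 0 i \<noteq> 0" using assms(2) by (auto simp: final_def letter_def)
    then show "i \<in> {..<length w} \<union> ?C" by (auto simp: initial_def)
  qed
  then have "card {..<length w'} \<le> card ({..<length w} \<union> ?C)"
    using C by (intro card_mono) auto
  also have "\<dots> \<le> length w + card ?C" using card_Un_le[of "{..<length w}" ?C] by simp
  finally show ?thesis using C by simp
qed

section \<open>Relocating a program to other arrays\<close>

primrec rename_exp :: "(nat \<Rightarrow> nat) \<Rightarrow> exp \<Rightarrow> exp" where
  "rename_exp h (Const n) = Const n"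
| "rename_exp h (Cell a e) = Cell (h a) (rename_exp h e)"
| "rename_exp h (Plus e e') = Plus (rename_exp h e) (rename_exp h e')"
| "rename_exp h (Minus e e') = Minus (rename_exp h e) (rename_exp h e')"

primrec rename :: "(nat \<Rightarrow> nat) \<Rightarrow> com \<Rightarrow> com" where
  "rename h Skip = Skip"
| "rename h (Assign a e e') = Assign (h a) (rename_exp h e) (rename_exp h e')"
| "rename h (Seq c c') = Seq (rename h c) (rename h c')"
| "rename h (Cond e c c') = Cond (rename_exp h e) (rename h c) (rename h c')"
| "rename h (While e c) = While (rename_exp h e) (rename h c)"

lemma val_rename_exp: "(\<And>a. S (h a) = s a) \<Longrightarrow> val (rename_exp h e) S = val e s"
  by (induction e) auto

text \<open>Injectivity keeps distinct arrays distinct, so the renamed run simulates the original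
  one step by step at the same cost. Arrays outside the range of \<open>h\<close> are storage that
  survives the call.\<close>

lemma exec_rename:
  assumes "exec c s t s'" and "inj h" and "\<And>a. S (h a) = s a"
  shows "\<exists>S'. exec (rename h c) S t S' \<and> (\<forall>a. S' (h a) = s' a) \<and> (\<forall>b. b \<notin> range h \<longrightarrow> S' b = S b)"
  using assms
proof (induction arbitrary: S rule: exec.induct)
  case (Skip s)
  then show ?case unfolding rename.simps by (intro exI[of _ S] conjI exec.Skip) auto
next
  case (Assign b e e' s)
  show ?case
    unfolding rename.simps
    by (rule exI, rule conjI, rule exec.Assign)
      (use Assign in \<open>auto simp: val_rename_exp[of S h s] inj_eq\<close>)
next
  case (Seq c s t s' c' t' s'')
  obtain S' where S': "exec (rename h c) S t S'" "\<forall>a. S' (h a) = s' a"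
    "\<forall>b. b \<notin> range h \<longrightarrow> S' b = S b" using Seq.IH(1)[OF Seq.prems] by blast
  obtain S'' where S'': "exec (rename h c') S' t' S''" "\<forall>a. S'' (h a) = s'' a"
    "\<forall>b. b \<notin> range h \<longrightarrow> S'' b = S' b" using Seq.IH(2)[OF Seq.prems(1), of S'] S'(2) by auto
  show ?case
    unfolding rename.simps
    by (rule exI[of _ S''], rule conjI, rule exec.Seq[OF S'(1) S''(1)]) (use S' S'' in auto)
next
  case (CondTrue e s c t s' c')
  have v: "val (rename_exp h e) S = val e s" using CondTrue.prems by (intro val_rename_exp)
  obtain S' where S': "exec (rename h c) S t S'" "\<forall>a. S' (h a) = s' a"
    "\<forall>b. b \<notin> range h \<longrightarrow> S' b = S b" using CondTrue.IH[OF CondTrue.prems] by blast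
  show ?case
    unfolding rename.simps
    by (rule exI[of _ S'], rule conjI, rule exec.CondTrue) (use CondTrue.hyps v S' in auto)
next
  case (CondFalse e s c' t s' c)
  have v: "val (rename_exp h e) S = val e s" using CondFalse.prems by (intro val_rename_exp)
  obtain S' where S': "exec (rename h c') S t S'" "\<forall>a. S' (h a) = s' a"
    "\<forall>b. b \<notin> range h \<longrightarrow> S' b = S b" using CondFalse.IH[OF CondFalse.prems] by blast
  show ?case
    unfolding rename.simps
    by (rule exI[of _ S'], rule conjI, rule exec.CondFalse) (use CondFalse.hyps v S' in auto)
next
  case (WhileFalse e s c)
  have "val (rename_exp h e) S = val e s" using WhileFalse.prems by (intro val_rename_exp)
  then show ?case
    unfolding rename.simps
    by (intro exI[of _ S] conjI exec.WhileFalse) (use WhileFalse in auto)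
next
  case (WhileTrue e s c t s' t' s'')
  obtain S' where S': "exec (rename h c) S t S'" "\<forall>a. S' (h a) = s' a"
    "\<forall>b. b \<notin> range h \<longrightarrow> S' b = S b" using WhileTrue.IH(1)[OF WhileTrue.prems] by blast
  obtain S'' where S'': "exec (rename h (While e c)) S' t' S''"
    "\<forall>a. S'' (h a) = s'' a" "\<forall>b. b \<notin> range h \<longrightarrow> S'' b = S' b" using WhileTrue.IH(2)[OF WhileTrue.prems(1), of S'] S'(2) unfolding rename.simps by auto
  have "val (rename_exp h e) S \<noteq> 0" using WhileTrue.hyps WhileTrue.prems by (simp add: val_rename_exp[of S h s])
  from exec.WhileTrue[OF this S'(1) S''(1)[unfolded rename.simps]]
  show ?case
    unfolding rename.simps
    by (rule_tac exI[of _ S''], rule_tac conjI) (use S' S'' in auto)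
qed

section \<open>Counting loops and computable bounds\<close>

abbreviation var :: "nat \<Rightarrow> exp" where "var a \<equiv> Cell a (Const 0)"
abbreviation set_var :: "nat \<Rightarrow> exp \<Rightarrow> com" where "set_var a e \<equiv> Assign a (Const 0) e"

definition For :: "nat \<Rightarrow> exp \<Rightarrow> com \<Rightarrow> com" where
  "For j e c = Seq (set_var j (Const 0))
     (While (Minus e (var j)) (Seq c (set_var j (Plus (var j) (Const 1)))))"

lemma exec_AssignI:
  "s' = s(a := (s a)(val e s := val e' s)) \<Longrightarrow> exec (Assign a e e') s 1 s'"
  using exec.Assign by simp

lemma exec_set_var: "exec (set_var a e) s 1 (s(a := (s a)(0 := val e s)))"
  using exec.Assign[of a "Const 0" e s] by simp

lemma exec_set_varI: "s' = s(a := (s a)(0 := val e s)) \<Longrightarrow> exec (set_var a e) s 1 s'"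
  using exec_set_var by simp

text \<open>The bound \<open>e\<close> is evaluated anew in every round, so
  \<open>val e s = N\<close> is demanded at every loop head; by truncated subtraction the test is
  nonzero exactly while the counter is below \<open>N\<close>. A round costs a test, the body and an
  increment; initialisation and the last test account for the 2.\<close>

lemma exec_For:
  assumes step: "\<And>i s. i < N \<Longrightarrow> Inv i s \<Longrightarrow> s j 0 = i \<Longrightarrow>
      \<exists>t s'. exec c s t s' \<and> t \<le> B \<and> s' j 0 = i \<and> Inv (Suc i) (s'(j := (s' j)(0 := Suc i)))"
    and bound: "\<And>i s. i \<le> N \<Longrightarrow> Inv i s \<Longrightarrow> s j 0 = i \<Longrightarrow> val e s = N"
    and init: "Inv 0 (s(j := (s j)(0 := 0)))"
  shows "\<exists>t s'. exec (For j e c) s t s' \<and> t \<le> 2 + N * (B + 2) \<and> Inv N s'"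
proof -
  let ?W = "While (Minus e (var j)) (Seq c (set_var j (Plus (var j) (Const 1))))"
  have loop: "\<exists>t s'. exec ?W s t s' \<and> t \<le> 1 + (N - i) * (B + 2) \<and> Inv N s'"
    if "i \<le> N" "Inv i s" "s j 0 = i" for i s
    using that
  proof (induction "N - i" arbitrary: i s)
    case 0
    then have "i = N" by simp
    with 0 have "val (Minus e (var j)) s = 0" using bound[of i s] by simp
    with 0 \<open>i = N\<close> show ?case by (intro exI[of _ 1] exI[of _ s] conjI exec.WhileFalse) auto
  next
    case (Suc d)
    then have i: "i < N" and nz: "val (Minus e (var j)) s \<noteq> 0" using bound[of i s] by auto
    from step[OF i Suc.prems(2,3)] obtain t s' where
      1: "exec c s t s'" "t \<le> B" "s' j 0 = i" "Inv (Suc i) (s'(j := (s' j)(0 := Suc i)))" by blast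
    let ?s = "s'(j := (s' j)(0 := Suc i))"
    have "exec (set_var j (Plus (var j) (Const 1))) s' 1 ?s"
      using exec_set_var[of j "Plus (var j) (Const 1)" s'] 1(3) by simp
    with 1(1) have 2: "exec (Seq c (set_var j (Plus (var j) (Const 1)))) s (t + 1) ?s"
      by (rule exec.Seq)
    have "d = N - Suc i" "Suc i \<le> N" "?s j 0 = Suc i" using Suc.hyps(2) i by auto
    from Suc.hyps(1)[OF this(1,2) 1(4) this(3)]
    obtain t' s'' where 3: "exec ?W ?s t' s''" "t' \<le> 1 + (N - Suc i) * (B + 2)" "Inv N s''"
      by blast
    have "1 + (t + 1) + t' \<le> 1 + (N - i) * (B + 2)"
    proof -
      have "N - i = Suc (N - Suc i)" using i by simp
      then have "(N - i) * (B + 2) = B + 2 + (N - Suc i) * (B + 2)" by simp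
      with 1(2) 3(2) show ?thesis by linarith
    qed
    with exec.WhileTrue[OF nz 2 3(1)] 3(3) show ?case by blast
  qed
  obtain t s' where l: "exec ?W (s(j := (s j)(0 := 0))) t s'" "t \<le> 1 + N * (B + 2)" "Inv N s'"
    using loop[of 0, OF _ init] by auto
  have "exec (For j e c) s (1 + t) s'"
    unfolding For_def by (rule exec.Seq[OF exec_set_var]) (use l(1) in simp)
  with l show ?thesis by (intro exI[of _ "1 + t"] exI[of _ s']) auto
qed

text \<open>Composition of reductions calls for computable bounds dominating polynomials in
  \<open>f k\<close> and \<open>g k\<close>. An exponential in their sum covers all of them and is
  computed by repeated doubling.\<close>

lemma computable_exp:
  assumes "computable f" and "computable g"
  shows "computable (\<lambda>k. 2 ^ (a * (f k + g k) + b))"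
proof -
  from assms obtain cf cg where
    cf: "\<And>k. \<exists>t s. exec cf (initial [] k) t s \<and> s 1 0 = f k" and
    cg: "\<And>k. \<exists>t s. exec cg (initial [] k) t s \<and> s 1 0 = g k"
    unfolding computable_def by metis
  \<comment> \<open>Run on the even and the odd arrays, the two programs do not interfere.\<close>
  let ?h = "\<lambda>i::nat. 2 * i" and ?h' = "\<lambda>i::nat. 2 * i + 1"
  \<comment> \<open>Multiplication by the constant \<open>a\<close> is unrolled into the expression,
    as the machine only adds.\<close>
  define times where "times e = ((Plus e) ^^ a) (Const b)" for e
  have val_times: "val (times e) s = a * val e s + b" for e s
    unfolding times_def by (induction a) auto
  \<comment> \<open>Each copy of the initial state has \<open>k\<close> in its array 1, which is
    array 2 or 3 after renaming; array 1 is array 0 of the odd copy and must be empty.\<close>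
  let ?init = "Seq (set_var 2 (var 1)) (Seq (set_var 3 (var 1)) (set_var 1 (Const 0)))"
  let ?loop = "For 3 (times (Plus (var 0) (var 2))) (set_var 1 (Plus (var 1) (var 1)))"
  let ?c = "Seq ?init (Seq (rename ?h cf) (Seq (rename ?h' cg)
    (Seq (set_var 0 (var 3)) (Seq (set_var 1 (Const 1)) ?loop))))"
  have "\<exists>t s. exec ?c (initial [] k) t s \<and> s 1 0 = 2 ^ (a * (f k + g k) + b)" for k
  proof -
    let ?s = "initial [] k"
    define s1 where "s1 = ?s(2 := (?s 2)(0 := k), 3 := (?s 3)(0 := k), 1 := (?s 1)(0 := 0))"
    have "exec ?init ?s (1 + (1 + 1)) s1"
      unfolding s1_def
      by (rule exec.Seq[OF exec_set_var], rule exec.Seq[OF exec_set_var], rule exec_set_varI)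
        (simp add: initial_def)
    note init = this
    obtain tf sf where f: "exec cf ?s tf sf" "sf 1 0 = f k" using cf by blast
    have "inj ?h" "\<And>i. s1 (?h i) = ?s i"
      by (auto simp: inj_def s1_def initial_def fun_eq_iff split: if_splits)
    from exec_rename[OF f(1) this] obtain s2 where
      s2: "exec (rename ?h cf) s1 tf s2" "\<And>i. s2 (?h i) = sf i" "\<And>i. i \<notin> range ?h \<Longrightarrow> s2 i = s1 i"
      by blast
    obtain tg sg where g: "exec cg ?s tg sg" "sg 1 0 = g k" using cg by blast
    have odd: "?h' i \<notin> range ?h" for i by (auto; presburger)
    have "inj ?h'" by (auto simp: inj_def)
    moreover have "\<And>i. s2 (?h' i) = ?s i"
      unfolding s2(3)[OF odd] by (auto simp: s1_def initial_def fun_eq_iff; presburger)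
    ultimately obtain s3 where
      s3: "exec (rename ?h' cg) s2 tg s3" "\<And>i. s3 (?h' i) = sg i" "\<And>i. i \<notin> range ?h' \<Longrightarrow> s3 i = s2 i"
      using exec_rename[OF g(1), of ?h' s2] by blast
    have "(2::nat) \<notin> range ?h'" by (auto; presburger)
    then have v: "s3 3 0 = g k" "s3 2 0 = f k"
      using s3(2)[of 1] s3(3)[of 2] s2(2)[of 1] f g by auto
    \<comment> \<open>The loop counter is going to overwrite array 3, so \<open>g k\<close> moves to
      array 0.\<close>
    define s4 where "s4 = s3(0 := (s3 0)(0 := g k))"
    have s4: "exec (set_var 0 (var 3)) s3 1 s4" unfolding s4_def using exec_set_var[of 0 "var 3" s3] v by simp
    define s5 where "s5 = s4(1 := (s4 1)(0 := 1))"
    have s5: "exec (set_var 1 (Const 1)) s4 1 s5" unfolding s5_def using exec_set_var[of 1 "Const 1" s4] by simp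
    let ?N = "a * (f k + g k) + b"
    have "\<exists>t s'. exec ?loop s5 t s' \<and> t \<le> 2 + ?N * (1 + 2) \<and> s' 0 0 = g k \<and> s' 2 0 = f k \<and> s' 1 0 = 2 ^ ?N"
    proof (rule exec_For[where Inv = "\<lambda>i s. s 0 0 = g k \<and> s 2 0 = f k \<and> s 1 0 = 2 ^ i"], goal_cases)
      case (1 i s)
      then show ?case
        by (intro exI[of _ 1] exI[of _ "s(1 := (s 1)(0 := 2 ^ i + 2 ^ i))"] conjI exec_set_varI) auto
    next
      case (2 i s)
      then show ?case by (simp add: val_times add.commute)
    next
      case 3
      then show ?case using v by (simp add: s5_def s4_def)
    qed
    then obtain t s' where "exec ?loop s5 t s'" "s' 1 0 = 2 ^ ?N" by blast
    from exec.Seq[OF init exec.Seq[OF s2(1) exec.Seq[OF s3(1) exec.Seq[OF s4 exec.Seq[OF s5 this(1)]]]]] this(2)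
    show ?thesis by blast
  qed
  then show ?thesis unfolding computable_def by blast
qed

section \<open>Compiling polynomially bounded functions\<close>

text \<open>
  The second argument is an environment with de Bruijn indices: \<open>case_nat j \<rho>\<close> binds the
  summation variable to \<open>j\<close>.
\<close>

inductive polyfun :: "(bool list \<Rightarrow> (nat \<Rightarrow> nat) \<Rightarrow> nat) \<Rightarrow> bool" where
  num: "polyfun (\<lambda>w \<rho>. c)"
| var: "polyfun (\<lambda>w \<rho>. \<rho> i)"
| len: "polyfun (\<lambda>w \<rho>. length w)"
| bit: "polyfun f \<Longrightarrow> polyfun (\<lambda>w \<rho>. of_bool (f w \<rho> < length w \<and> w ! f w \<rho>))"
| add: "polyfun f \<Longrightarrow> polyfun g \<Longrightarrow> polyfun (\<lambda>w \<rho>. f w \<rho> + g w \<rho>)"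
| sub: "polyfun f \<Longrightarrow> polyfun g \<Longrightarrow> polyfun (\<lambda>w \<rho>. f w \<rho> - g w \<rho>)"
| sum: "polyfun f \<Longrightarrow> polyfun g \<Longrightarrow> polyfun (\<lambda>w \<rho>. \<Sum>j<f w \<rho>. g w (case_nat j \<rho>))"

text \<open>All bounds are powers of one base. Since \<open>2 \<le> Z\<close> absorbs constants and
  sums, exponents never depend on the input, and the parameter can be hidden in the choice of
  \<open>Z\<close>.\<close>

definition small :: "nat \<Rightarrow> nat \<Rightarrow> bool list \<Rightarrow> (nat \<Rightarrow> nat) \<Rightarrow> bool" where
  "small Z d w \<rho> \<longleftrightarrow> Z \<ge> 2 \<and> length w \<le> Z ^ d \<and> (\<forall>i. \<rho> i \<le> Z ^ d)"

lemma small_mono: "small Z d w \<rho> \<Longrightarrow> d \<le> d' \<Longrightarrow> small Z d' w \<rho>"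
  unfolding small_def by (meson le_trans one_le_numeral power_increasing)

lemma small_case_nat: "small Z d w \<rho> \<Longrightarrow> j \<le> Z ^ d \<Longrightarrow> small Z d w (case_nat j \<rho>)"
  unfolding small_def by (auto split: nat.split)

lemma le_power_mono:
  fixes Z :: nat
  assumes "x \<le> Z ^ d" and "2 \<le> Z" and "d \<le> e"
  shows "x \<le> Z ^ e"
  using assms by (meson le_trans one_le_numeral power_increasing)

lemma le_power_self: "2 \<le> (Z::nat) \<Longrightarrow> c \<le> Z ^ c"
  by (meson le_trans less_exp order_less_imp_le power_mono zero_le)

lemma add_le_power:
  fixes Z :: nat
  assumes "x \<le> Z ^ d" and "y \<le> Z ^ e" and "2 \<le> Z"
  shows "x + y \<le> Z ^ (d + e + 1)"
proof -
  have "x \<le> Z ^ (d + e)" "y \<le> Z ^ (d + e)"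
    using assms le_power_mono[of x Z d "d + e"] le_power_mono[of y Z e "d + e"] by auto
  then have "x + y \<le> 2 * Z ^ (d + e)" by simp
  also have "\<dots> \<le> Z * Z ^ (d + e)" using assms(3) by (intro mult_right_mono) auto
  finally show ?thesis by simp
qed

text \<open>The exponent \<open>d\<close> stays arbitrary in the induction because under a sum the
  bound variable can be as large as the value of \<open>f\<close>. For the same reason
  \<open>computes\<close> quantifies over \<open>d\<close>.\<close>

lemma polyfun_le:
  assumes "polyfun f"
  shows "\<exists>D. \<forall>w \<rho> Z. small Z d w \<rho> \<longrightarrow> f w \<rho> \<le> Z ^ D"
  using assms
proof (induction arbitrary: d)
  case (num c)
  then show ?case unfolding small_def by (meson le_power_self)
next
  case (var i)
  then show ?case unfolding small_def by blast
next
  case len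
  then show ?case unfolding small_def by blast
next
  case (bit f)
  then show ?case unfolding small_def by (intro exI[of _ 1]) auto
next
  case (add f g)
  then obtain D E where "\<forall>w \<rho> Z. small Z d w \<rho> \<longrightarrow> f w \<rho> \<le> Z ^ D"
    "\<forall>w \<rho> Z. small Z d w \<rho> \<longrightarrow> g w \<rho> \<le> Z ^ E" by meson
  then show ?case by (intro exI[of _ "D + E + 1"]) (meson add_le_power small_def)
next
  case (sub f g)
  then obtain D where "\<forall>w \<rho> Z. small Z d w \<rho> \<longrightarrow> f w \<rho> \<le> Z ^ D" by meson
  then show ?case by (meson diff_le_self le_trans)
next
  case (sum f g)
  obtain D where D: "\<And>w \<rho> Z. small Z d w \<rho> \<Longrightarrow> f w \<rho> \<le> Z ^ D" using sum.IH(1) by meson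
  obtain E where E: "\<And>w \<rho> Z. small Z (d + D) w \<rho> \<Longrightarrow> g w \<rho> \<le> Z ^ E" using sum.IH(2) by meson
  have "(\<Sum>j<f w \<rho>. g w (case_nat j \<rho>)) \<le> Z ^ (D + E)" if s: "small Z d w \<rho>" for w \<rho> Z
  proof -
    have "g w (case_nat j \<rho>) \<le> Z ^ E" if "j < f w \<rho>" for j
    proof (intro E small_case_nat small_mono[OF s])
      have "j \<le> Z ^ D" using that D[OF s] by simp
      then show "j \<le> Z ^ (d + D)" using s by (elim le_power_mono) (auto simp: small_def)
    qed simp
    then have "(\<Sum>j<f w \<rho>. g w (case_nat j \<rho>)) \<le> f w \<rho> * Z ^ E"
      using sum_bounded_above[of "{..<f w \<rho>}" "\<lambda>j. g w (case_nat j \<rho>)" "Z ^ E"] by auto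
    also have "\<dots> \<le> Z ^ D * Z ^ E" using D[OF s] by simp
    finally show ?thesis by (simp add: power_add)
  qed
  then show ?case by blast
qed

section \<open>Compilation into programs\<close>

text \<open>
  Arrays 0 and 2 hold the input word and its length. A program for \<open>f\<close> reads the environment variable
  \<open>i\<close> from array \<open>\<sigma> i\<close>, writes to array \<open>a\<close>, and uses the arrays above \<open>a\<close> as scratch space. It does not
  rely on them being clean, so it can run after an arbitrary program.
\<close>

definition holds_word :: "state \<Rightarrow> bool list \<Rightarrow> bool" where
  "holds_word s w \<longleftrightarrow> (\<forall>i < length w. s 0 i = letter (w ! i)) \<and> s 2 0 = length w"

definition computes_within ::
    "com \<Rightarrow> (nat \<Rightarrow> nat) \<Rightarrow> nat \<Rightarrow> (bool list \<Rightarrow> (nat \<Rightarrow> nat) \<Rightarrow> nat) \<Rightarrow> nat \<Rightarrow> nat \<Rightarrow> bool" where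
  "computes_within c \<sigma> a f d D \<longleftrightarrow>
     (\<forall>s w \<rho> Z. holds_word s w \<longrightarrow> (\<forall>i. s (\<sigma> i) 0 = \<rho> i) \<longrightarrow> small Z d w \<rho> \<longrightarrow>
        (\<exists>t s'. exec c s t s' \<and> t \<le> Z ^ D \<and> s' a 0 = f w \<rho> \<and> (\<forall>b < a. s' b = s b)))"

definition computes ::
    "com \<Rightarrow> (nat \<Rightarrow> nat) \<Rightarrow> nat \<Rightarrow> (bool list \<Rightarrow> (nat \<Rightarrow> nat) \<Rightarrow> nat) \<Rightarrow> bool" where
  "computes c \<sigma> a f \<longleftrightarrow> (\<forall>d. \<exists>D. computes_within c \<sigma> a f d D)"

lemma computes_withinD:
  assumes "computes_within c \<sigma> a f d D"
    and "holds_word s w" and "\<And>i. s (\<sigma> i) 0 = \<rho> i" and "small Z d w \<rho>"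
  obtains t s' where "exec c s t s'" and "t \<le> Z ^ D" and "s' a 0 = f w \<rho>" and "\<forall>b < a. s' b = s b"
proof -
  have "\<forall>i. s (\<sigma> i) 0 = \<rho> i" using assms(3) by simp
  with assms(1,2,4) have "\<exists>t s'. exec c s t s' \<and> t \<le> Z ^ D \<and> s' a 0 = f w \<rho> \<and> (\<forall>b < a. s' b = s b)"
    unfolding computes_within_def by simp
  then show ?thesis using that by blast
qed

lemma computes_set_var:
  assumes "\<And>s w. holds_word s w \<Longrightarrow> val e s = f w (\<lambda>i. s (\<sigma> i) 0)"
  shows "computes (set_var a e) \<sigma> a f"
  unfolding computes_def
proof (intro allI exI)
  fix d
  show "computes_within (set_var a e) \<sigma> a f d 0"
    unfolding computes_within_def
  proof (intro allI impI)
    fix s w \<rho> Z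
    assume h: "holds_word s w" and "\<forall>i. s (\<sigma> i) 0 = \<rho> i"
    then have "(\<lambda>i. s (\<sigma> i) 0) = \<rho>" by auto
    with assms[OF h] have "val e s = f w \<rho>" by simp
    then show "\<exists>t s'. exec (set_var a e) s t s' \<and> t \<le> Z ^ 0 \<and> s' a 0 = f w \<rho> \<and> (\<forall>b < a. s' b = s b)"
      by (intro exI[of _ 1] exI[of _ "s(a := (s a)(0 := f w \<rho>))"] conjI exec_set_varI) auto
  qed
qed

lemma computes_binop:
  assumes "computes c \<sigma> a f" and "computes c' \<sigma> (Suc a) g" 
    and "3 \<le> a" and "\<And>i. \<sigma> i < a"
    and "\<And>s. val e s = h (s a 0) (s (Suc a) 0)"
  shows "computes (Seq c (Seq c' (set_var a e))) \<sigma> a (\<lambda>w \<rho>. h (f w \<rho>) (g w \<rho>))"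
  unfolding computes_def
proof
  fix d
  obtain D where D: "computes_within c \<sigma> a f d D" using assms(1) unfolding computes_def by blast
  obtain E where E: "computes_within c' \<sigma> (Suc a) g d E" using assms(2) unfolding computes_def by blast
  have "\<exists>t s'. exec (Seq c (Seq c' (set_var a e))) s t s' \<and> t \<le> Z ^ (D + (E + 0 + 1) + 1)
      \<and> s' a 0 = h (f w \<rho>) (g w \<rho>) \<and> (\<forall>b < a. s' b = s b)"
    if s: "holds_word s w" "\<forall>i. s (\<sigma> i) 0 = \<rho> i" "small Z d w \<rho>" for s w \<rho> Z
  proof -
    obtain t s1 where 1: "exec c s t s1" "t \<le> Z ^ D" "s1 a 0 = f w \<rho>" "\<forall>b < a. s1 b = s b"
      using computes_withinD[OF D s(1) _ s(3)] s(2) by blast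
    have "holds_word s1 w" "\<And>i. s1 (\<sigma> i) 0 = \<rho> i" using 1 s assms(3,4) by (auto simp: holds_word_def)
    then obtain t' s2 where 2: "exec c' s1 t' s2" "t' \<le> Z ^ E" "s2 (Suc a) 0 = g w \<rho>"
      "\<forall>b < Suc a. s2 b = s1 b"
      using computes_withinD[OF E _ _ s(3)] by blast
    let ?s = "s2(a := (s2 a)(0 := h (f w \<rho>) (g w \<rho>)))"
    have "exec (set_var a e) s2 1 ?s" using 1 2 assms(5) by (intro exec_set_varI) simp
    then have "exec (Seq c (Seq c' (set_var a e))) s (t + (t' + 1)) ?s"
      using 1 2 by (auto intro: exec.Seq simp del: One_nat_def)
    moreover have "t + (t' + 1) \<le> Z ^ (D + (E + 0 + 1) + 1)"
      using 1 2 s(3) by (intro add_le_power) (auto simp: small_def)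
    moreover have "\<forall>b < a. ?s b = s b" using 1 2 by auto
    ultimately show ?thesis by (intro exI[of _ "t + (t' + 1)"] exI[of _ ?s]) auto
  qed
  then show "\<exists>D. computes_within (Seq c (Seq c' (set_var a e))) \<sigma> a (\<lambda>w \<rho>. h (f w \<rho>) (g w \<rho>)) d D"
    unfolding computes_within_def by blast
qed

lemma computes_bit:
  assumes "computes c \<sigma> a f" and "3 \<le> a"
  shows "computes (Seq c (Cond (Minus (var 2) (var a)) (set_var a (Minus (Cell 0 (var a)) (Const 1)))
      (set_var a (Const 0)))) \<sigma> a (\<lambda>w \<rho>. of_bool (f w \<rho> < length w \<and> w ! f w \<rho>))"
    (is "computes (Seq c ?c) \<sigma> a ?f")
  unfolding computes_def
proof
  fix d
  obtain D where D: "computes_within c \<sigma> a f d D" using assms(1) unfolding computes_def by blast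
  have "\<exists>t s'. exec (Seq c ?c) s t s' \<and> t \<le> Z ^ (D + 1 + 1)
      \<and> s' a 0 = ?f w \<rho> \<and> (\<forall>b < a. s' b = s b)"
    if s: "holds_word s w" "\<forall>i. s (\<sigma> i) 0 = \<rho> i" "small Z d w \<rho>" for s w \<rho> Z
  proof -
    obtain t s1 where 1: "exec c s t s1" "t \<le> Z ^ D" "s1 a 0 = f w \<rho>" "\<forall>b < a. s1 b = s b"
      using computes_withinD[OF D s(1) _ s(3)] s(2) by blast
    have h: "holds_word s1 w" using 1 s assms(2) by (auto simp: holds_word_def)
    let ?s = "s1(a := (s1 a)(0 := ?f w \<rho>))"
    have "exec ?c s1 (1 + 1) ?s"
    proof (cases "f w \<rho> < length w")
      case True
      then show ?thesis using h 1
        by (intro exec.CondTrue exec_set_varI) (auto simp: holds_word_def letter_def)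
    next
      case False
      then show ?thesis using h 1
        by (intro exec.CondFalse exec_set_varI) (auto simp: holds_word_def)
    qed
    then have "exec (Seq c ?c) s (t + (1 + 1)) ?s" using 1 exec.Seq by blast
    moreover have "t + (1 + 1) \<le> Z ^ (D + 1 + 1)"
      using 1 s(3) by (intro add_le_power) (auto simp: small_def)
    moreover have "\<forall>b < a. ?s b = s b" using 1 by auto
    ultimately show ?thesis by (intro exI[of _ "t + (1 + 1)"] exI[of _ ?s]) auto
  qed
  then show "\<exists>D. computes_within (Seq c ?c) \<sigma> a ?f d D"
    unfolding computes_within_def by blast
qed

text \<open>Layout: \<open>a\<close> accumulates, \<open>a + 1\<close> holds the number of terms,
  \<open>a + 2\<close> is the loop counter, and the body writes to \<open>a + 3\<close>. The
  environment map \<open>case_nat (a + 2) \<sigma>\<close> makes the counter variable 0 of the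
  body.\<close>

lemma computes_sum:
  assumes f: "polyfun f" and cf: "computes c \<sigma> (Suc a) f"
    and cg: "computes c' (case_nat (a + 2) \<sigma>) (a + 3) g"
    and a: "3 \<le> a" "\<And>i. \<sigma> i < a"
  shows "computes (Seq c (Seq (set_var a (Const 0))
      (For (a + 2) (var (a + 1)) (Seq c' (set_var a (Plus (var a) (var (a + 3))))))))
    \<sigma> a (\<lambda>w \<rho>. \<Sum>j<f w \<rho>. g w (case_nat j \<rho>))"
    (is "computes (Seq c (Seq _ ?c)) \<sigma> a ?f")
  unfolding computes_def
proof
  fix d
  obtain D where D: "computes_within c \<sigma> (Suc a) f d D" using cf unfolding computes_def by blast
  obtain F where F: "\<And>w \<rho> Z. small Z d w \<rho> \<Longrightarrow> f w \<rho> \<le> Z ^ F" using polyfun_le[OF f] by meson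
  obtain E where E: "computes_within c' (case_nat (a + 2) \<sigma>) (a + 3) g (d + F) E" using cg unfolding computes_def by blast
  let ?D = "D + (2 + (F + (E + 2 + 1)) + 1) + 1"
  have "\<exists>t s'. exec (Seq c (Seq (set_var a (Const 0)) ?c)) s t s' \<and> t \<le> Z ^ ?D
      \<and> s' a 0 = ?f w \<rho> \<and> (\<forall>b < a. s' b = s b)"
    if s: "holds_word s w" "\<forall>i. s (\<sigma> i) 0 = \<rho> i" "small Z d w \<rho>" for s w \<rho> Z
  proof -
    have Z: "2 \<le> Z" using s by (simp add: small_def)
    obtain t s1 where 1: "exec c s t s1" "t \<le> Z ^ D" "s1 (Suc a) 0 = f w \<rho>" "\<forall>b < Suc a. s1 b = s b"
      using computes_withinD[OF D s(1) _ s(3)] s(2) by blast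
    let ?s = "s1(a := (s1 a)(0 := 0))"
    define Inv where "Inv i s' \<longleftrightarrow> (\<forall>b<a. s' b = s b) \<and> s' (Suc a) 0 = f w \<rho> \<and>
      s' a 0 = (\<Sum>j<i. g w (case_nat j \<rho>))" for i s'
    have "\<exists>t s'. exec ?c ?s t s' \<and> t \<le> 2 + f w \<rho> * ((Z ^ E + 1) + 2) \<and> Inv (f w \<rho>) s'"
    proof (rule exec_For)
      fix i s'
      assume i: "i < f w \<rho>" "Inv i s'" "s' (a + 2) 0 = i"
      have "i \<le> Z ^ F" using F[OF s(3)] i(1) by simp
      then have "i \<le> Z ^ (d + F)" using Z le_power_mono[of i Z F "d + F"] by simp
      then have 3: "small Z (d + F) w (case_nat i \<rho>)"
        by (intro small_case_nat[OF small_mono[OF s(3)]]) simp_all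
      have 2: "holds_word s' w" using i(2) s(1) a by (auto simp: Inv_def holds_word_def)
      have "s' (case_nat (a + 2) \<sigma> n) 0 = case_nat i \<rho> n" for n
        using i s(2) a by (cases n) (auto simp: Inv_def)
      from computes_withinD[OF E 2 this 3] obtain t s2 where 4: "exec c' s' t s2" "t \<le> Z ^ E"
        "s2 (a + 3) 0 = g w (case_nat i \<rho>)" "\<forall>b < a + 3. s2 b = s' b" by blast
      let ?s2 = "s2(a := (s2 a)(0 := \<Sum>j<Suc i. g w (case_nat j \<rho>)))"
      have s2a: "s2 a 0 = (\<Sum>j<i. g w (case_nat j \<rho>))" using 4 i by (auto simp: Inv_def)
      have "exec (set_var a (Plus (var a) (var (a + 3)))) s2 1 ?s2"
        using 4 s2a by (intro exec_set_varI) auto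
      with 4 have "exec (Seq c' (set_var a (Plus (var a) (var (a + 3))))) s' (t + 1) ?s2"
        by (intro exec.Seq)
      moreover have "Inv (Suc i) (?s2(a + 2 := (?s2 (a + 2))(0 := Suc i)))"
        using 4 i by (auto simp: Inv_def)
      moreover have "?s2 (a + 2) 0 = i" using 4 i by auto
      ultimately show "\<exists>t s''. exec (Seq c' (set_var a (Plus (var a) (var (a + 3))))) s' t s'' \<and>
          t \<le> Z ^ E + 1 \<and> s'' (a + 2) 0 = i \<and> Inv (Suc i) (s''(a + 2 := (s'' (a + 2))(0 := Suc i)))"
        using 4(2) by (intro exI[of _ "t + 1"] exI[of _ ?s2]) auto
    next
      show "val (var (a + 1)) s' = f w \<rho>" if "Inv i s'" for i s' using that by (simp add: Inv_def)
    next
      show "Inv 0 (?s(a + 2 := (?s (a + 2))(0 := 0)))" using 1 by (auto simp: Inv_def)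
    qed
    then obtain t' s' where 2: "exec ?c ?s t' s'" "t' \<le> 2 + f w \<rho> * ((Z ^ E + 1) + 2)"
      "Inv (f w \<rho>) s'" by blast
    have "exec (Seq c (Seq (set_var a (Const 0)) ?c)) s (t + (1 + t')) s'"
      by (rule exec.Seq[OF 1(1)], rule exec.Seq[OF _ 2(1)], rule exec_set_varI) simp
    moreover have "t + (1 + t') \<le> Z ^ ?D"
    proof (rule add_le_power[OF 1(2) _ Z])
      have "Z ^ E + 3 \<le> Z ^ (E + 2 + 1)" 
      proof (rule add_le_power[OF _ _ Z])
        have "2 ^ 2 \<le> Z ^ 2" using Z by (rule power_mono) simp
        then show "3 \<le> Z ^ 2" by simp
      qed simp
      then have "f w \<rho> * (Z ^ E + 3) \<le> Z ^ (F + (E + 2 + 1))"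
        unfolding power_add[of Z F] using F[OF s(3)] by (intro mult_le_mono) auto
      moreover have "2 ^ 2 \<le> Z ^ 2" using Z by (rule power_mono) simp
      ultimately have "3 + f w \<rho> * (Z ^ E + 3) \<le> Z ^ (2 + (F + (E + 2 + 1)) + 1)"
        by (intro add_le_power[OF _ _ Z]) auto
      then show "1 + t' \<le> Z ^ (2 + (F + (E + 2 + 1)) + 1)" using 2(2) by (simp add: numeral_3_eq_3)
    qed
    ultimately show ?thesis using 2(3) unfolding Inv_def by blast
  qed
  then show "\<exists>D. computes_within (Seq c (Seq (set_var a (Const 0)) ?c)) \<sigma> a ?f d D"
    unfolding computes_within_def by blast
qed

lemma polyfun_computes:
  assumes "polyfun f" and "3 \<le> a" and "\<And>i. \<sigma> i < a"
  shows "\<exists>c. computes c \<sigma> a f"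
  using assms
proof (induction arbitrary: \<sigma> a)
  case (num c)
  show ?case by (rule exI, rule computes_set_var[of "Const c"]) simp
next
  case (var i)
  show ?case by (rule exI, rule computes_set_var[of "var (\<sigma> i)"]) simp
next
  case len
  show ?case by (rule exI, rule computes_set_var[of "var 2"]) (simp add: holds_word_def)
next
  case (bit f)
  then show ?case using computes_bit by meson
next
  case (add f g)
  obtain c c' where c: "computes c \<sigma> a f" "computes c' \<sigma> (Suc a) g"
    using add.IH(1)[of a \<sigma>] add.IH(2)[of "Suc a" \<sigma>] add.prems less_SucI le_SucI by meson
  show ?case
    by (rule exI, rule computes_binop[OF c add.prems, where h = "(+)" and e = "Plus (var a) (var (Suc a))"]) auto
next
  case (sub f g)
  obtain c c' where c: "computes c \<sigma> a f" "computes c' \<sigma> (Suc a) g"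
    using sub.IH(1)[of a \<sigma>] sub.IH(2)[of "Suc a" \<sigma>] sub.prems less_SucI le_SucI by meson
  show ?case
    by (rule exI, rule computes_binop[OF c sub.prems, where h = "(-)" and e = "Minus (var a) (var (Suc a))"]) auto
next
  case (sum f g)
  obtain c where c: "computes c \<sigma> (Suc a) f"
    using sum.IH(1)[of "Suc a" \<sigma>] sum.prems less_SucI le_SucI by meson
  have lt: "case_nat (a + 2) \<sigma> i < a + 3" for i
    using sum.prems(2)[of "i - 1"] by (cases i) auto
  obtain c' where c': "computes c' (case_nat (a + 2) \<sigma>) (a + 3) g"
    using sum.IH(2)[of "a + 3" "case_nat (a + 2) \<sigma>", OF le_add2 lt] by blast
  show ?case by (rule exI, rule computes_sum[OF sum.hyps(1) c c' sum.prems])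
qed

section \<open>Closure properties of compiled functions\<close>

lemma polyfun_rename:
  assumes "polyfun f"
  shows "polyfun (\<lambda>w \<rho>. f w (\<lambda>i. \<rho> (h i)))"
  using assms
proof (induction arbitrary: h)
  case (sum f g)
  have *: "(\<lambda>i. case_nat j \<rho> (case_nat 0 (\<lambda>i. Suc (h i)) i)) = case_nat j (\<lambda>i. \<rho> (h i))"
    for j :: nat and \<rho> :: "nat \<Rightarrow> nat"
    by (auto simp: fun_eq_iff split: nat.split)
  show ?case
    using polyfun.sum[OF sum.IH(1)[of h] sum.IH(2)[of "case_nat 0 (\<lambda>i. Suc (h i))"]] by (simp only: *)
qed (assumption | rule polyfun.num polyfun.var polyfun.len polyfun.bit polyfun.add polyfun.sub)+

lemmas polyfun_weaken = polyfun_rename[where h = Suc]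

text \<open>The constructor \<open>sum\<close> with the summation variable as an argument, a form
  that matches sums as they are usually written. The premise shifts the outer variables; for
  functions of the outer environment \<open>polyfun_weaken\<close> supplies the shifted
  version.\<close>

lemma polyfun_sum:
  assumes "polyfun f" and "polyfun (\<lambda>w \<rho>. g w (\<lambda>i. \<rho> (Suc i)) (\<rho> 0))"
  shows "polyfun (\<lambda>w \<rho>. \<Sum>j<f w \<rho>. g w \<rho> j)"
  using polyfun.sum[OF assms] by simp

text \<open>A product is a sum of equal terms, so a loop makes up for the missing machine
  instruction.\<close>

lemma polyfun_mult:
  assumes "polyfun f" and "polyfun g"
  shows "polyfun (\<lambda>w \<rho>. f w \<rho> * g w \<rho>)"
  using polyfun_sum[OF assms(1), of "\<lambda>w \<rho> j. g w \<rho>"] polyfun_weaken[OF assms(2)] by simp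

lemma polyfun_power: "polyfun f \<Longrightarrow> polyfun (\<lambda>w \<rho>. f w \<rho> ^ n)"
  by (induction n) (simp_all add: polyfun.num polyfun_mult)

definition polypred :: "(bool list \<Rightarrow> (nat \<Rightarrow> nat) \<Rightarrow> bool) \<Rightarrow> bool" where
  "polypred P \<longleftrightarrow> polyfun (\<lambda>w \<rho>. of_bool (P w \<rho>))"

lemma polyfun_of_bool: "polypred P \<Longrightarrow> polyfun (\<lambda>w \<rho>. of_bool (P w \<rho>))"
  by (simp add: polypred_def)

lemma polypred_bit: "polyfun f \<Longrightarrow> polypred (\<lambda>w \<rho>. f w \<rho> < length w \<and> w ! f w \<rho>)"
  unfolding polypred_def by (rule polyfun.bit)

lemma polypred_not:
  assumes "polypred P"
  shows "polypred (\<lambda>w \<rho>. \<not> P w \<rho>)"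
proof -
  have "(\<lambda>w \<rho>. of_bool (\<not> P w \<rho>)) = (\<lambda>w \<rho>. (1::nat) - of_bool (P w \<rho>))" by (auto simp: fun_eq_iff)
  then show ?thesis using polyfun.sub[OF polyfun.num assms[unfolded polypred_def]] by (simp add: polypred_def)
qed

lemma polypred_conj:
  assumes "polypred P" and "polypred Q"
  shows "polypred (\<lambda>w \<rho>. P w \<rho> \<and> Q w \<rho>)"
  using polyfun_mult[OF assms[unfolded polypred_def]] by (simp add: polypred_def of_bool_conj)

lemma polypred_disj: "polypred P \<Longrightarrow> polypred Q \<Longrightarrow> polypred (\<lambda>w \<rho>. P w \<rho> \<or> Q w \<rho>)"
  using polypred_not[OF polypred_conj[OF polypred_not[of P] polypred_not[of Q]]] by simp

lemma polypred_imp: "polypred P \<Longrightarrow> polypred Q \<Longrightarrow> polypred (\<lambda>w \<rho>. P w \<rho> \<longrightarrow> Q w \<rho>)"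
  using polypred_disj[OF polypred_not[of P], of Q] by simp

lemma polypred_iff: "polypred P \<Longrightarrow> polypred Q \<Longrightarrow> polypred (\<lambda>w \<rho>. P w \<rho> \<longleftrightarrow> Q w \<rho>)"
  using polypred_conj[OF polypred_imp[of P Q] polypred_imp[of Q P]] by (simp add: iff_conv_conj_imp)

lemma polypred_le:
  assumes "polyfun f" and "polyfun g"
  shows "polypred (\<lambda>w \<rho>. f w \<rho> \<le> g w \<rho>)"
proof -
  have "(\<lambda>w \<rho>. of_bool (f w \<rho> \<le> g w \<rho>)) = (\<lambda>w \<rho>. 1 - (f w \<rho> - g w \<rho>))" by (auto simp: fun_eq_iff)
  then show ?thesis using polyfun.sub[OF polyfun.num polyfun.sub[OF assms]] by (simp add: polypred_def)
qed

lemma polypred_less: "polyfun f \<Longrightarrow> polyfun g \<Longrightarrow> polypred (\<lambda>w \<rho>. f w \<rho> < g w \<rho>)"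
  using polypred_not[OF polypred_le[of g f]] by (simp add: not_le)

lemma polypred_eq: "polyfun f \<Longrightarrow> polyfun g \<Longrightarrow> polypred (\<lambda>w \<rho>. f w \<rho> = g w \<rho>)"
  using polypred_conj[OF polypred_le[of f g] polypred_le[of g f]] by (simp add: eq_iff)

lemma polypred_const: "polypred (\<lambda>w \<rho>. b)"
  unfolding polypred_def by (rule polyfun.num)

lemma polypred_ball:
  assumes "polyfun f" and "polypred (\<lambda>w \<rho>. P w (\<lambda>i. \<rho> (Suc i)) (\<rho> 0))"
  shows "polypred (\<lambda>w \<rho>. \<forall>j<f w \<rho>. P w \<rho> j)"
proof -
  have *: "polyfun (\<lambda>w \<rho>. \<Sum>j<f w \<rho>. of_bool (\<not> P w \<rho> j))"
    by (rule polyfun_sum[OF assms(1) polypred_not[OF assms(2), unfolded polypred_def]])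
  have "(\<Sum>j<f w \<rho>. of_bool (\<not> P w \<rho> j)) = (0::nat) \<longleftrightarrow> (\<forall>j<f w \<rho>. P w \<rho> j)" for w \<rho>
    by auto
  with polypred_eq[OF * polyfun.num[of 0]] show ?thesis by (simp only:)
qed

lemma polyfun_if:
  assumes "polypred P" and "polyfun f" and "polyfun g"
  shows "polyfun (\<lambda>w \<rho>. if P w \<rho> then f w \<rho> else g w \<rho>)"
proof -
  have "(\<lambda>w \<rho>. if P w \<rho> then f w \<rho> else g w \<rho>) =
      (\<lambda>w \<rho>. of_bool (P w \<rho>) * f w \<rho> + of_bool (\<not> P w \<rho>) * g w \<rho>)"
    by (auto simp: fun_eq_iff)
  then show ?thesis
    using polyfun.add[OF polyfun_mult[OF _ assms(2)] polyfun_mult[OF _ assms(3)]] assms(1) polypred_not[OF assms(1)]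
    by (simp add: polypred_def)
qed

lemma polypred_if: "polypred P \<Longrightarrow> polypred Q \<Longrightarrow> polypred R \<Longrightarrow> polypred (\<lambda>w \<rho>. if P w \<rho> then Q w \<rho> else R w \<rho>)"
  using polypred_conj[OF polypred_imp[of P Q] polypred_imp[OF polypred_not[of P], of R]] by (simp add: if_bool_eq_conj)

text \<open>The quotient counts the positive multiples of \<open>y\<close> up to \<open>x\<close>,
  all of which occur among the first \<open>x\<close> multiples; the conjunct \<open>0 < y\<close>
  reproduces the convention \<open>x div 0 = 0\<close>.\<close>

lemma div_eq_sum: "x div y = (\<Sum>j<x. of_bool (0 < y \<and> (j + 1) * y \<le> x))" for x y :: nat
proof (cases "y = 0")
  case False
  then have eq: "(j + 1) * y \<le> x \<longleftrightarrow> j + 1 \<le> x div y" for j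
    by (intro less_eq_div_iff_mult_less_eq[symmetric]) simp
  have "{..<x} \<inter> {j. 0 < y \<and> (j + 1) * y \<le> x} = {..<x div y}"
    unfolding eq using False by (auto intro: order.strict_trans2[OF _ div_le_dividend])
  moreover have "(\<Sum>j<x. of_bool (0 < y \<and> (j + 1) * y \<le> x)) = card ({..<x} \<inter> {j. 0 < y \<and> (j + 1) * y \<le> x})"
    by (rule sum_of_bool_eq[THEN trans]) simp_all
  ultimately show ?thesis by simp
qed simp

lemma polyfun_div:
  assumes "polyfun f" and "polyfun g"
  shows "polyfun (\<lambda>w \<rho>. f w \<rho> div g w \<rho>)"
  unfolding div_eq_sum
  by (intro polyfun_sum polyfun_of_bool polypred_conj polypred_less polypred_le polyfun_mult polyfun.add polyfun.num polyfun.var assms polyfun_weaken[OF assms(1)] polyfun_weaken[OF assms(2)])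

lemma polyfun_mod:
  assumes "polyfun f" and "polyfun g"
  shows "polyfun (\<lambda>w \<rho>. f w \<rho> mod g w \<rho>)"
  unfolding modulo_nat_def by (intro polyfun.sub polyfun_mult polyfun_div assms)

lemma polyfun_sum_const: "(\<And>j. j < n \<Longrightarrow> polyfun (f j)) \<Longrightarrow> polyfun (\<lambda>w \<rho>. \<Sum>j<n. f j w \<rho>)" for n :: nat
  by (induction n) (simp_all add: polyfun.num polyfun.add)

lemma polypred_all_const: "(\<And>j. j < n \<Longrightarrow> polypred (P j)) \<Longrightarrow> polypred (\<lambda>w \<rho>. \<forall>j<n. P j w \<rho>)" for n :: nat
  by (induction n) (simp_all add: All_less_Suc polypred_const polypred_conj)

lemma polyfun_sum_list: "(\<And>x. x \<in> set xs \<Longrightarrow> polyfun (f x)) \<Longrightarrow> polyfun (\<lambda>w \<rho>. \<Sum>x\<leftarrow>xs. f x w \<rho>)"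
  by (induction xs) (simp_all add: polyfun.num polyfun.add)

lemma polypred_list_all: "(\<And>x. x \<in> set xs \<Longrightarrow> polypred (P x)) \<Longrightarrow> polypred (\<lambda>w \<rho>. \<forall>x\<in>set xs. P x w \<rho>)"
  by (induction xs) (simp_all add: polypred_const polypred_conj)

section \<open>Words given by their length and bits\<close>

text \<open>Bits are requested at every position \<open>e\<close> that is itself a compiled
  function, not at a fresh variable; concatenation then merely substitutes
  \<open>e - length (F w \<rho>)\<close> for \<open>e\<close>.\<close>

definition polyword :: "(bool list \<Rightarrow> (nat \<Rightarrow> nat) \<Rightarrow> bool list) \<Rightarrow> bool" where
  "polyword F \<longleftrightarrow> polyfun (\<lambda>w \<rho>. length (F w \<rho>)) \<and>
     (\<forall>e. polyfun e \<longrightarrow> polypred (\<lambda>w \<rho>. e w \<rho> < length (F w \<rho>) \<and> F w \<rho> ! e w \<rho>))"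

lemma polyword_map:
  assumes "polyfun L" and "\<And>e. polyfun e \<Longrightarrow> polypred (\<lambda>w \<rho>. B w \<rho> (e w \<rho>))"
  shows "polyword (\<lambda>w \<rho>. map (B w \<rho>) [0..<L w \<rho>])"
proof -
  have "polypred (\<lambda>w \<rho>. e w \<rho> < L w \<rho> \<and> B w \<rho> (e w \<rho>))" if "polyfun e" for e
    by (intro polypred_conj polypred_less assms that)
  moreover have "(e w \<rho> < L w \<rho> \<and> B w \<rho> (e w \<rho>)) =
      (e w \<rho> < length (map (B w \<rho>) [0..<L w \<rho>]) \<and> map (B w \<rho>) [0..<L w \<rho>] ! e w \<rho>)" for e w \<rho>
    by auto
  ultimately show ?thesis using assms(1) by (auto simp: polyword_def)
qed

lemma polyword_const: "polyword (\<lambda>w \<rho>. xs)"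
proof -
  have "polypred (\<lambda>w \<rho>. e w \<rho> < length xs \<and> xs ! e w \<rho>)" if "polyfun e" for e
  proof -
    have "(e w \<rho> < length xs \<and> xs ! e w \<rho>) = (\<not> (\<forall>j<length xs. \<not> (e w \<rho> = j \<and> xs ! j)))" for w \<rho>
      by auto
    moreover have "polypred (\<lambda>w \<rho>. \<not> (\<forall>j<length xs. \<not> (e w \<rho> = j \<and> xs ! j)))"
      by (intro polypred_not polypred_all_const polypred_conj polypred_eq polypred_const that polyfun.num)
    ultimately show ?thesis by simp
  qed
  then show ?thesis by (auto simp: polyword_def intro: polyfun.num)
qed

lemma polyword_append:
  assumes F: "polyword F" and G: "polyword G"
  shows "polyword (\<lambda>w \<rho>. F w \<rho> @ G w \<rho>)"
proof -
  have "polypred (\<lambda>w \<rho>. e w \<rho> < length (F w \<rho> @ G w \<rho>) \<and> (F w \<rho> @ G w \<rho>) ! e w \<rho>)" if e: "polyfun e" for e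
  proof -
    have "polyfun (\<lambda>w \<rho>. e w \<rho> - length (F w \<rho>))" using e F by (auto simp: polyword_def intro: polyfun.sub)
    then have "polypred (\<lambda>w \<rho>. (e w \<rho> < length (F w \<rho>) \<and> F w \<rho> ! e w \<rho>) \<or> (length (F w \<rho>) \<le> e w \<rho> \<and>
      (e w \<rho> - length (F w \<rho>) < length (G w \<rho>) \<and> G w \<rho> ! (e w \<rho> - length (F w \<rho>)))))"
      (is "polypred ?P") using e F G by (intro polypred_disj polypred_conj[OF polypred_le]) (auto simp: polyword_def)
    also have "?P = (\<lambda>w \<rho>. e w \<rho> < length (F w \<rho> @ G w \<rho>) \<and> (F w \<rho> @ G w \<rho>) ! e w \<rho>)"
      by (auto simp: fun_eq_iff nth_append)
    finally show ?thesis .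
  qed
  then show ?thesis using F G by (auto simp: polyword_def intro: polyfun.add)
qed

lemma polyword_if:
  assumes P: "polypred P" and F: "polyword F" and G: "polyword G"
  shows "polyword (\<lambda>w \<rho>. if P w \<rho> then F w \<rho> else G w \<rho>)"
proof -
  have "polyfun (\<lambda>w \<rho>. if P w \<rho> then length (F w \<rho>) else length (G w \<rho>))"
    using F G by (intro polyfun_if P) (auto simp: polyword_def)
  moreover have "polypred (\<lambda>w \<rho>. if P w \<rho> then e w \<rho> < length (F w \<rho>) \<and> F w \<rho> ! e w \<rho>
      else e w \<rho> < length (G w \<rho>) \<and> G w \<rho> ! e w \<rho>)" if "polyfun e" for e
    using F G that by (intro polypred_if P) (auto simp: polyword_def)
  moreover have "(if P w \<rho> then e w \<rho> < length (F w \<rho>) \<and> F w \<rho> ! e w \<rho>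
      else e w \<rho> < length (G w \<rho>) \<and> G w \<rho> ! e w \<rho>) = 
      (e w \<rho> < length (if P w \<rho> then F w \<rho> else G w \<rho>) \<and> (if P w \<rho> then F w \<rho> else G w \<rho>) ! e w \<rho>)"
    for e w \<rho> by simp
  ultimately show ?thesis unfolding polyword_def by (simp add: if_distrib)
qed

lemma polyword_unary: "polyfun f \<Longrightarrow> polyword (\<lambda>w \<rho>. unary (f w \<rho>))"
  unfolding unary_def
  using polyword_append[OF polyword_map[of f "\<lambda>w \<rho> i. True"] polyword_const] polypred_const by (simp add: map_replicate_const)

section \<open>Reductions by polynomially bounded functions\<close>

text \<open>A word arrives delimited by its first 0 only, whereas compiled code expects the length
  in array 2.\<close>

lemma exec_length:
  assumes "\<And>i. i < n \<Longrightarrow> s 0 i \<noteq> 0" and "s 0 n = 0"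
  shows "exec (Seq (set_var 2 (Const 0)) (While (Cell 0 (var 2)) (set_var 2 (Plus (var 2) (Const 1)))))
    s (2 + 2 * n) (s(2 := (s 2)(0 := n)))"
proof -
  let ?W = "While (Cell 0 (var 2)) (set_var 2 (Plus (var 2) (Const 1)))"
  let ?s = "\<lambda>i. s(2 := (s 2)(0 := i))"
  have loop: "exec ?W (?s i) (1 + 2 * (n - i)) (?s n)" if "i \<le> n" for i
    using that
  proof (induction "n - i" arbitrary: i)
    case 0
    then have "i = n" by simp
    have "exec ?W (?s n) 1 (?s n)" by (rule exec.WhileFalse) (use assms(2) in simp)
    then show ?case by (simp only: \<open>i = n\<close> diff_self_eq_0 mult_0_right add_0_right)
  next
    case (Suc d)
    then have i: "i < n" by simp
    have "val (Cell 0 (var 2)) (?s i) \<noteq> 0" using assms(1)[OF i] by simp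
    moreover have "exec (set_var 2 (Plus (var 2) (Const 1))) (?s i) 1 (?s (Suc i))"
      by (rule exec_set_varI) simp
    moreover have "exec ?W (?s (Suc i)) (1 + 2 * (n - Suc i)) (?s n)"
      using Suc.hyps i by simp
    ultimately have "exec ?W (?s i) (1 + 1 + (1 + 2 * (n - Suc i))) (?s n)" by (rule exec.WhileTrue)
    moreover have "1 + 1 + (1 + 2 * (n - Suc i)) = 1 + 2 * (n - i)" using i by simp
    ultimately show ?case by (simp only:)
  qed
  have "exec (set_var 2 (Const 0)) s 1 (?s 0)" by (rule exec_set_varI) simp
  from exec.Seq[OF this loop[OF le0]] show ?thesis
    by (simp only: diff_zero add.assoc[symmetric] one_add_one)
qed

lemma loop_le_power:
  fixes Z :: nat
  assumes "N \<le> Z ^ F" and "B \<le> Z ^ E" and "2 \<le> Z"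
  shows "2 + N * (B + 2) \<le> Z ^ (1 + (F + (E + 1 + 1)) + 1)"
proof -
  have "N * (B + 2) \<le> Z ^ F * Z ^ (E + 1 + 1)"
    using assms by (intro mult_le_mono add_le_power) auto
  then have "N * (B + 2) \<le> Z ^ (F + (E + 1 + 1))" by (simp only: power_add)
  then show ?thesis using assms(3) by (intro add_le_power) simp_all
qed

text \<open>The start state is any state representing \<open>(w, k)\<close>, because another program
  has just run and left its scratch data. Array 1 holds the parameter, 3 the position of the current
  bit, 4 a 0 for all other variables, 5 and 6 the length and the parameter of the output.\<close>

lemma word_program:
  assumes F: "polyword (\<lambda>w \<rho>. F w (\<rho> 0))" and K: "polyfun (\<lambda>w \<rho>. K w (\<rho> 0))"
  shows "\<exists>c D. \<forall>s w k Z. final s w k \<longrightarrow> 2 \<le> Z \<longrightarrow> length w \<le> Z \<longrightarrow> k \<le> Z \<longrightarrow>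
    (\<exists>t s'. exec c s t s' \<and> t \<le> Z ^ D \<and> final s' (F w k) (K w k))"
proof -
  define \<sigma> :: "nat \<Rightarrow> nat" where "\<sigma> = case_nat 1 (case_nat 3 (\<lambda>_. 4))"
  define env where "env k i = case_nat k (case_nat i (\<lambda>_. 0))" for k i :: nat
  have \<sigma>: "\<sigma> i < a" if "5 \<le> a" for a i using that by (auto simp: \<sigma>_def split: nat.split)
  have env: "s (\<sigma> j) 0 = env k i j" if "s 1 0 = k" "s 3 0 = i" "s 4 0 = 0" for s k i j
    using that by (auto simp: \<sigma>_def env_def split: nat.split)
  have env0 [simp]: "env k i 0 = k" "env k i 1 = i" for k i by (auto simp: env_def)
  have pfL: "polyfun (\<lambda>w \<rho>. length (F w (\<rho> 0)))" using F by (simp add: polyword_def)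
  have pfB: "polyfun (\<lambda>w \<rho>. of_bool (\<rho> 1 < length (F w (\<rho> 0)) \<and> F w (\<rho> 0) ! \<rho> 1))"
    using F polyfun.var unfolding polyword_def polypred_def by blast
  obtain cL where cL: "computes cL \<sigma> 5 (\<lambda>w \<rho>. length (F w (\<rho> 0)))"
    using polyfun_computes[OF pfL, of 5 \<sigma>] \<sigma> by auto
  obtain cK where cK: "computes cK \<sigma> 6 (\<lambda>w \<rho>. K w (\<rho> 0))"
    using polyfun_computes[OF K, of 6 \<sigma>] \<sigma> by auto
  obtain cB where cB: "computes cB \<sigma> 8 (\<lambda>w \<rho>. of_bool (\<rho> 1 < length (F w (\<rho> 0)) \<and> F w (\<rho> 0) ! \<rho> 1))"
    using polyfun_computes[OF pfB, of 8 \<sigma>] \<sigma> by auto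
  obtain DL where DL: "computes_within cL \<sigma> 5 (\<lambda>w \<rho>. length (F w (\<rho> 0))) 1 DL"
    using cL unfolding computes_def by blast
  obtain DK where DK: "computes_within cK \<sigma> 6 (\<lambda>w \<rho>. K w (\<rho> 0)) 1 DK"
    using cK unfolding computes_def by blast
  obtain E where E: "\<And>w \<rho> Z. small Z 1 w \<rho> \<Longrightarrow> length (F w (\<rho> 0)) \<le> Z ^ E"
    using polyfun_le[OF pfL] by meson
  obtain DB where DB: "computes_within cB \<sigma> 8
      (\<lambda>w \<rho>. of_bool (\<rho> 1 < length (F w (\<rho> 0)) \<and> F w (\<rho> 0) ! \<rho> 1)) (1 + E) DB"
    using cB unfolding computes_def by blast
  define len where "len = Seq (set_var 2 (Const 0)) (While (Cell 0 (var 2)) (set_var 2 (Plus (var 2) (Const 1))))"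
  \<comment> \<open>Every bit may depend on the whole input in array 0, so the output is assembled
    in array 7 and copied only afterwards. A bit plus 1 is its letter.\<close>
  define emit where "emit = For 3 (var 5) (Seq cB (Assign 7 (var 3) (Plus (var 8) (Const 1))))"
  define copy where "copy = For 3 (var 5) (Assign 0 (var 3) (Cell 7 (var 3)))"
  define fin where "fin = Seq (Assign 0 (var 5) (Const 0)) (set_var 1 (var 6))"
  define c where "c = Seq len (Seq (Seq (set_var 3 (Const 0)) (set_var 4 (Const 0)))
    (Seq cL (Seq cK (Seq emit (Seq copy fin)))))"
  \<comment> \<open>The exponent mirrors the nesting of the sum of running times to which
    \<open>add_le_power\<close> is finally applied.\<close>
  define D where "D = 1 + (1 + 1 + 0) + 1 + (1 + (DL + (DK + ((1 + (E + (DB + 0 + 1 + 1 + 1)) + 1) +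
    ((1 + (E + (0 + 1 + 1)) + 1) + 1 + 1) + 1) + 1) + 1) + 1) + 1"
  have "\<exists>t s'. exec c s t s' \<and> t \<le> Z ^ D \<and> final s' (F w k) (K w k)"
    if s: "final s w k" "2 \<le> Z" "length w \<le> Z" "k \<le> Z" for s w k Z
  proof -
    let ?L = "length (F w k)"
    have small: "small Z d w (env k i)" if "1 \<le> d" "i \<le> Z ^ d" for d i
    proof -
      have "Z \<le> Z ^ d" using that(1) s(2) by (metis le_power_mono order_refl power_one_right)
      then show ?thesis using that s unfolding small_def env_def by (auto split: nat.split)
    qed
    have small0: "small Z 1 w (env k 0)" by (rule small) auto
    have L: "?L \<le> Z ^ E" using E[OF small0] by simp
    let ?s1 = "s(2 := (s 2)(0 := length w))"
    have 1: "exec len s (2 + 2 * length w) ?s1"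
      unfolding len_def using s(1) by (intro exec_length) (auto simp: final_def letter_def)
    let ?s2 = "?s1(3 := (s 3)(0 := 0), 4 := (s 4)(0 := 0))"
    have 2: "exec (Seq (set_var 3 (Const 0)) (set_var 4 (Const 0))) ?s1 (1 + 1) ?s2"
      by (rule exec.Seq[OF exec_set_var exec_set_varI]) simp
    have h2: "holds_word ?s2 w" using s(1) by (simp add: holds_word_def final_def)
    have e2: "?s2 (\<sigma> j) 0 = env k 0 j" for j using s(1) by (intro env) (auto simp: final_def)
    obtain t3 s3 where 3: "exec cL ?s2 t3 s3" "t3 \<le> Z ^ DL" "s3 5 0 = length (F w (env k 0 0))" "\<forall>b<5. s3 b = ?s2 b"
      by (rule computes_withinD[OF DL h2 e2 small0])
    note 3 = 3[unfolded env0]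
    have h3: "holds_word s3 w" using h2 3 by (simp add: holds_word_def)
    have e3: "s3 (\<sigma> j) 0 = env k 0 j" for j using e2 3(4) \<sigma>[of 5 j] by simp
    obtain t4 s4 where 4: "exec cK s3 t4 s4" "t4 \<le> Z ^ DK" "s4 6 0 = K w (env k 0 0)" "\<forall>b<6. s4 b = s3 b"
      by (rule computes_withinD[OF DK h3 e3 small0])
    note 4 = 4[unfolded env0]
    have h4: "holds_word s4 w" using h3 4 by (simp add: holds_word_def)
    have s4: "s4 5 0 = ?L" "s4 1 0 = k" "s4 4 0 = 0"
      using 4 3 s(1) by (auto simp: final_def)
    define Inv where "Inv i s' \<longleftrightarrow> (\<forall>b<7. b \<noteq> 3 \<longrightarrow> s' b = s4 b) \<and> (\<forall>j<i. s' 7 j = letter (F w k ! j))"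
      for i s'
    have "\<exists>t s'. exec emit s4 t s' \<and> t \<le> 2 + ?L * ((Z ^ DB + 1) + 2) \<and> Inv ?L s'"
      unfolding emit_def
    proof (rule exec_For)
      fix i s'
      assume i: "i < ?L" "Inv i s'" "s' 3 0 = i"
      have h: "holds_word s' w" using i(2) h4 by (simp add: Inv_def holds_word_def)
      have e: "s' (\<sigma> j) 0 = env k i j" for j using i(2,3) s4 by (intro env) (auto simp: Inv_def)
      have "i \<le> Z ^ (1 + E)" using i(1) L s(2) le_power_mono[of i Z E "1 + E"] by simp
      then have sm: "small Z (1 + E) w (env k i)" by (intro small) auto
      obtain t s'' where r: "exec cB s' t s''" "t \<le> Z ^ DB" 
        "s'' 8 0 = of_bool (env k i 1 < length (F w (env k i 0)) \<and> F w (env k i 0) ! env k i 1)"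
        "\<forall>b<8. s'' b = s' b"
        by (rule computes_withinD[OF DB h e sm])
      have r3: "s'' 8 0 = of_bool (F w k ! i)" using r(3)[unfolded env0] i(1) by simp
      let ?s = "s''(7 := (s'' 7)(i := letter (F w k ! i)))"
      have "exec (Assign 7 (var 3) (Plus (var 8) (Const 1))) s'' 1 ?s"
        using r(4) r3 i(3) by (intro exec_AssignI) (simp add: letter_def numeral_2_eq_2)
      with r(1) have "exec (Seq cB (Assign 7 (var 3) (Plus (var 8) (Const 1)))) s' (t + 1) ?s"
        by (rule exec.Seq)
      moreover have "Inv (Suc i) (?s(3 := (?s 3)(0 := Suc i)))"
        using i(2) r(4) by (auto simp: Inv_def less_Suc_eq)
      moreover have "?s 3 0 = i" using i r by simp
      ultimately show "\<exists>t s''. exec (Seq cB (Assign 7 (var 3) (Plus (var 8) (Const 1)))) s' t s'' \<and>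
          t \<le> Z ^ DB + 1 \<and> s'' 3 0 = i \<and> Inv (Suc i) (s''(3 := (s'' 3)(0 := Suc i)))"
        using r(2) by (intro exI[of _ "t + 1"] exI[of _ ?s]) simp
    next
      show "val (var 5) s' = ?L" if "Inv i s'" for i s' using that s4 by (simp add: Inv_def)
    next
      show "Inv 0 (s4(3 := (s4 3)(0 := 0)))" by (simp add: Inv_def)
    qed
    then obtain t5 s5 where 5: "exec emit s4 t5 s5" "t5 \<le> 2 + ?L * ((Z ^ DB + 1) + 2)" "Inv ?L s5"
      by blast
    define Inv' where "Inv' i s' \<longleftrightarrow> s' 5 0 = ?L \<and> s' 6 0 = K w k \<and> s' 7 = s5 7 \<and> (\<forall>j<i. s' 0 j = letter (F w k ! j))"
      for i and s' :: state
    have "\<exists>t s'. exec copy s5 t s' \<and> t \<le> 2 + ?L * (1 + 2) \<and> Inv' ?L s'"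
      unfolding copy_def
    proof (rule exec_For)
      fix i s'
      assume i: "i < ?L" "Inv' i s'" "s' 3 0 = i"
      let ?s = "s'(0 := (s' 0)(i := letter (F w k ! i)))"
      have "exec (Assign 0 (var 3) (Cell 7 (var 3))) s' 1 ?s"
        using i 5(3) by (intro exec_AssignI) (simp add: Inv_def Inv'_def)
      moreover have "Inv' (Suc i) (?s(3 := (?s 3)(0 := Suc i)))"
        using i(2) by (auto simp: Inv'_def less_Suc_eq)
      ultimately show "\<exists>t s''. exec (Assign 0 (var 3) (Cell 7 (var 3))) s' t s'' \<and>
          t \<le> 1 \<and> s'' 3 0 = i \<and> Inv' (Suc i) (s''(3 := (s'' 3)(0 := Suc i)))"
        using i(3) by (intro exI[of _ "1"] exI[of _ ?s]) simp
    next
      show "val (var 5) s' = ?L" if "Inv' i s'" for i s' using that by (simp add: Inv'_def)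
    next
      show "Inv' 0 (s5(3 := (s5 3)(0 := 0)))" using 5(3) s4(1) 4(3) by (simp add: Inv_def Inv'_def)
    qed
    then obtain t6 s6 where 6: "exec copy s5 t6 s6" "t6 \<le> 2 + ?L * (1 + 2)" "Inv' ?L s6"
      by blast
    let ?s7 = "s6(0 := (s6 0)(?L := 0))"
    let ?s8 = "?s7(1 := (s6 1)(0 := K w k))"
    have "exec (Assign 0 (var 5) (Const 0)) s6 1 ?s7"
      using 6(3) by (intro exec_AssignI) (simp add: Inv'_def)
    moreover have "exec (set_var 1 (var 6)) ?s7 1 ?s8"
      using 6(3) by (intro exec_set_varI) (simp add: Inv'_def)
    ultimately have 7: "exec fin s6 (1 + 1) ?s8" unfolding fin_def by (rule exec.Seq)
    have "final ?s8 (F w k) (K w k)" using 6(3) by (simp add: final_def Inv'_def)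
    moreover have "exec c s ((2 + 2 * length w) + ((1 + 1) + (t3 + (t4 + (t5 + (t6 + (1 + 1))))))) ?s8"
      unfolding c_def
      by (rule exec.Seq[OF 1 exec.Seq[OF 2 exec.Seq[OF 3(1) exec.Seq[OF 4(1) exec.Seq[OF 5(1) exec.Seq[OF 6(1) 7]]]]]])
    moreover have "(2 + 2 * length w) + ((1 + 1) + (t3 + (t4 + (t5 + (t6 + (1 + 1)))))) \<le> Z ^ D"
    proof -
      have a: "2 \<le> Z ^ 1" using s(2) by simp
      have b: "2 * length w \<le> Z ^ (1 + 1 + 0)" using mult_le_mono[OF s(2,3)] by simp
      have t5: "t5 \<le> Z ^ (1 + (E + (DB + 0 + 1 + 1 + 1)) + 1)"
        using 5(2) loop_le_power[OF L add_le_power[of "Z ^ DB" Z DB 1 0, OF _ _ s(2)] s(2)] by simp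
      have t6: "t6 \<le> Z ^ (1 + (E + (0 + 1 + 1)) + 1)"
        using 6(2) loop_le_power[OF L _ s(2), of 1 0] by simp
      show ?thesis
        unfolding D_def
        using a b 3(2) 4(2) t5 t6 s(2) by (intro add_le_power) simp_all
    qed
    ultimately show ?thesis by blast
  qed
  then show ?thesis by (intro exI[of _ c] exI[of _ D]) simp
qed

lemma le_two_power: "x \<le> (2::nat) ^ x"
  using less_exp[of x] by simp

text \<open>The second reduction is polynomial in word and parameter together, so what remains is to
  absorb the superpolynomial dependence on \<open>k\<close> of the first. The bound on
  \<open>K\<close> mentions \<open>k\<close> only, as a new parameter must not grow with the
  word.\<close>

lemma fpt_reducible_trans_polyword:
  assumes P: "fpt_reducible P Q"
    and F: "polyword (\<lambda>w \<rho>. F w (\<rho> 0))" and K: "polyfun (\<lambda>w \<rho>. K w (\<rho> 0))"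
    and le: "\<And>w k. K w k \<le> (k + 1) ^ b"
    and iff: "\<And>w k. (w, k) \<in> Q \<longleftrightarrow> (F w k, K w k) \<in> R"
  shows "fpt_reducible P R"
proof -
  from P obtain c1 f g d where fg: "computable f" "computable g" and
    red: "\<And>w k. \<exists>t s w' k'. exec c1 (initial w k) t s \<and> t \<le> f k * (length w + 1) ^ d \<and>
          final s w' k' \<and> k' \<le> g k \<and> ((w, k) \<in> P \<longleftrightarrow> (w', k') \<in> Q)"
    unfolding fpt_reducible_def by blast
  obtain c2 D where c2: "\<forall>s w k Z. final s w k \<longrightarrow> 2 \<le> Z \<longrightarrow> length w \<le> Z \<longrightarrow> k \<le> Z \<longrightarrow>
    (\<exists>t s'. exec c2 s t s' \<and> t \<le> Z ^ D \<and> final s' (F w k) (K w k))"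
    using word_program[OF F K] by (elim exE)
  define f' :: "nat \<Rightarrow> nat" where "f' k = 2 ^ ((D + 2) * (f k + g k) + (D + 2))" for k
  define g' :: "nat \<Rightarrow> nat" where "g' k = 2 ^ (b * (f k + g k) + 0)" for k
  have "computable f'" "computable g'"
    unfolding f'_def g'_def by (intro computable_exp fg)+
  moreover have "\<exists>t s w' k'. exec (Seq c1 c2) (initial w k) t s \<and> t \<le> f' k * (length w + 1) ^ ((d + 1) * (D + 2)) \<and>
          final s w' k' \<and> k' \<le> g' k \<and> ((w, k) \<in> P \<longleftrightarrow> (w', k') \<in> R)" for w k
  proof -
    obtain t s w' k' where 1: "exec c1 (initial w k) t s" "t \<le> f k * (length w + 1) ^ d"
      "final s w' k'" "k' \<le> g k" "(w, k) \<in> P \<longleftrightarrow> (w', k') \<in> Q"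
      using red by blast
    let ?n = "length w + 1"
    \<comment> \<open>One base that bounds the first running time, the intermediate word and the
      intermediate parameter. Its power \<open>D + 2\<close> splits into a function of
      \<open>k\<close> and a polynomial in the input length, as an fpt bound requires.\<close>
    define Z where "Z = 2 ^ (f k + g k + 1) * ?n ^ (d + 1)"
    have n: "1 \<le> ?n ^ (d + 1)" by (rule one_le_power) simp
    have "?n ^ d \<le> ?n ^ (d + 1)" by (rule power_increasing) auto
    have tZ: "t + length w \<le> Z"
    proof -
      have "t \<le> f k * ?n ^ (d + 1)" using 1(2) \<open>?n ^ d \<le> _\<close> 
        by (meson le_trans mult_le_mono2)
      moreover have "length w \<le> ?n ^ (d + 1)"
        using power_increasing[of 1 "d + 1" ?n] by (simp del: power_Suc)
      ultimately have "t + length w \<le> (f k + 1) * ?n ^ (d + 1)" by simp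
      also have "f k + 1 \<le> 2 ^ (f k + g k + 1)"
        using le_two_power[of "f k + g k + 1"] by linarith
      then have "(f k + 1) * ?n ^ (d + 1) \<le> Z" unfolding Z_def by (rule mult_le_mono1)
      finally show ?thesis .
    qed
    have "2 ^ (f k + g k + 1) \<le> Z" unfolding Z_def using n by simp
    moreover have "2 \<le> (2::nat) ^ (f k + g k + 1)" by simp
    moreover have "k' \<le> 2 ^ (f k + g k + 1)"
      using 1(4) le_two_power[of "f k + g k + 1"] by linarith
    ultimately have Z: "2 \<le> Z" "k' \<le> Z" by linarith+
    have w': "length w' \<le> Z" using length_final[OF 1(1,3)] tZ by simp
    obtain t' s' where 2: "exec c2 s t' s'" "t' \<le> Z ^ D" "final s' (F w' k') (K w' k')"
      using c2[rule_format, OF 1(3) Z(1) w' Z(2)] by blast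
    have "t + t' \<le> Z ^ (1 + D + 1)"
      using tZ 2(2) Z(1) by (intro add_le_power) auto
    also have "\<dots> = f' k * ?n ^ ((d + 1) * (D + 2))"
      unfolding Z_def f'_def power_mult_distrib power_mult[symmetric]
      by (simp add: algebra_simps)
    finally have "t + t' \<le> f' k * ?n ^ ((d + 1) * (D + 2))" .
    moreover have "K w' k' \<le> g' k"
    proof -
      have "k' + 1 \<le> 2 ^ (g k)"
        using 1(4) less_exp[of "g k"] by linarith
      also have "(2::nat) ^ g k \<le> 2 ^ (f k + g k)" by (rule power_increasing) auto
      finally have "(k' + 1) ^ b \<le> (2 ^ (f k + g k)) ^ b" by (rule power_mono) simp
      then show ?thesis using le[of w' k'] unfolding g'_def by (simp add: power_mult[symmetric] mult.commute)
    qed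
    moreover have "exec (Seq c1 c2) (initial w k) (t + t') s'" using 1(1) 2(1) by (rule exec.Seq)
    ultimately show ?thesis using 2(3) 1(5) iff by blast
  qed
  ultimately show ?thesis unfolding fpt_reducible_def by blast
qed

section \<open>From cliques to partial vertex covers\<close>

definition biadjacency :: "nat \<Rightarrow> nat \<Rightarrow> (nat \<Rightarrow> nat \<Rightarrow> bool) \<Rightarrow> nat set set" where
  "biadjacency p q M = {{i, p + j} | i j. i < p \<and> j < q \<and> M i j}"

lemma bipartite_biadjacency: "bipartite_graph {..<p} {p..<p + q} (biadjacency p q M)"
  by (auto simp: bipartite_graph_def biadjacency_def) (metis add_less_cancel_left le_add1)

lemma mem_biadjacency:
  assumes "i < p" and "j < q"
  shows "{i, p + j} \<in> biadjacency p q M \<longleftrightarrow> M i j"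
proof
  assume "{i, p + j} \<in> biadjacency p q M"
  then obtain i' j' where "{i, p + j} = {i', p + j'}" "i' < p" "M i' j'"
    by (auto simp: biadjacency_def)
  with assms show "M i j" by (auto simp: doubleton_eq_iff)
qed (use assms in \<open>auto simp: biadjacency_def\<close>)

text \<open>To count no edge twice, an edge whose row lies in \<open>A\<close> is charged to that
  row, and only rows outside \<open>A\<close> remain for the columns in \<open>B\<close>.\<close>

lemma card_covered_edges:
  assumes "A = S \<inter> {..<p}" and "B = {j. j < q \<and> p + j \<in> S}"
  shows "card {e \<in> biadjacency p q M. e \<inter> S \<noteq> {}} =
    (\<Sum>i\<in>A. card {j. j < q \<and> M i j}) + (\<Sum>j\<in>B. card {i. i < p \<and> i \<notin> A \<and> M i j})"
proof -
  let ?f = "\<lambda>(i, j). {i, p + j}"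
  let ?P = "Sigma A (\<lambda>i. {j. j < q \<and> M i j})"
  let ?Q = "(\<lambda>(j, i). (i, j)) ` Sigma B (\<lambda>j. {i. i < p \<and> i \<notin> A \<and> M i j})"
  have fin: "finite A" "finite B" using assms by auto
  have "{e \<in> biadjacency p q M. e \<inter> S \<noteq> {}} = ?f ` (?P \<union> ?Q)"
  proof (rule set_eqI, rule iffI)
    fix e assume "e \<in> {e \<in> biadjacency p q M. e \<inter> S \<noteq> {}}"
    then obtain i j where e: "e = {i, p + j}" "i < p" "j < q" "M i j" "i \<in> S \<or> p + j \<in> S"
      by (auto simp: biadjacency_def)
    have "(i, j) \<in> ?P \<union> ?Q"
    proof (cases "i \<in> S")
      case True
      then show ?thesis using e assms by auto
    next
      case False
      then have "(j, i) \<in> Sigma B (\<lambda>j. {i. i < p \<and> i \<notin> A \<and> M i j})" using e assms by auto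
      then show ?thesis by (force intro: image_eqI)
    qed
    then show "e \<in> ?f ` (?P \<union> ?Q)" using e(1) by (intro image_eqI[of _ _ "(i, j)"]) auto
  next
    fix e assume "e \<in> ?f ` (?P \<union> ?Q)"
    then show "e \<in> {e \<in> biadjacency p q M. e \<inter> S \<noteq> {}}"
      using assms by (auto simp: biadjacency_def)
  qed
  moreover have "inj_on ?f (?P \<union> ?Q)"
    using assms by (auto simp: inj_on_def doubleton_eq_iff)
  ultimately have "card {e \<in> biadjacency p q M. e \<inter> S \<noteq> {}} = card (?P \<union> ?Q)"
    by (simp add: card_image)
  also have "\<dots> = card ?P + card ?Q"
    using fin by (intro card_Un_disjoint) auto
  also have "card ?P = (\<Sum>i\<in>A. card {j. j < q \<and> M i j})"
    using fin by (intro card_SigmaI) auto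
  also have "card ?Q = card (Sigma B (\<lambda>j. {i. i < p \<and> i \<notin> A \<and> M i j}))"
    by (rule card_image) (auto simp: inj_on_def)
  also have "\<dots> = (\<Sum>j\<in>B. card {i. i < p \<and> i \<notin> A \<and> M i j})"
    using fin by (intro card_SigmaI) auto
  finally show ?thesis .
qed

lemma has_partial_vertex_cover_biadjacency:
  "has_partial_vertex_cover {..<p} {p..<p + q} (biadjacency p q M) k1 k2 (int x) \<longleftrightarrow>
    (\<exists>A B. A \<subseteq> {..<p} \<and> B \<subseteq> {..<q} \<and> card A = k1 \<and> card B = k2 \<and>
      x \<le> (\<Sum>i\<in>A. card {j. j < q \<and> M i j}) + (\<Sum>j\<in>B. card {i. i < p \<and> i \<notin> A \<and> M i j}))"
    (is "?L \<longleftrightarrow> ?R")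
proof
  assume ?L
  then obtain S where S: "card (S \<inter> {..<p}) = k1" "card (S \<inter> {p..<p + q}) = k2"
    "int x \<le> int (card {e \<in> biadjacency p q M. e \<inter> S \<noteq> {}})"
    unfolding has_partial_vertex_cover_def by blast
  define A where "A = S \<inter> {..<p}"
  define B where "B = {j. j < q \<and> p + j \<in> S}"
  have "S \<inter> {p..<p + q} = (\<lambda>j. p + j) ` B"
    unfolding B_def by (auto simp: image_iff) (metis add_less_cancel_left le_Suc_ex)
  then have "card B = k2" using S(2) by (simp add: card_image)
  moreover have "card A = k1" "A \<subseteq> {..<p}" "B \<subseteq> {..<q}" using S(1) by (auto simp: A_def B_def)
  moreover have "x \<le> (\<Sum>i\<in>A. card {j. j < q \<and> M i j}) + (\<Sum>j\<in>B. card {i. i < p \<and> i \<notin> A \<and> M i j})"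
    using S(3) unfolding card_covered_edges[OF A_def B_def] by linarith
  ultimately show ?R by blast
next
  assume ?R
  then obtain A B where AB: "A \<subseteq> {..<p}" "B \<subseteq> {..<q}" "card A = k1" "card B = k2"
      "x \<le> (\<Sum>i\<in>A. card {j. j < q \<and> M i j}) + (\<Sum>j\<in>B. card {i. i < p \<and> i \<notin> A \<and> M i j})"
    by blast
  let ?S = "A \<union> (\<lambda>j. p + j) ` B"
  have A: "A = ?S \<inter> {..<p}" using AB(1) by auto
  have B: "B = {j. j < q \<and> p + j \<in> ?S}" using AB(1,2) by auto
  have "?S \<inter> {p..<p + q} = (\<lambda>j. p + j) ` B" using AB(1,2) by auto
  then have "card (?S \<inter> {p..<p + q}) = k2" using AB(4) by (simp add: card_image)
  moreover have "x \<le> card {e \<in> biadjacency p q M. e \<inter> ?S \<noteq> {}}"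
    using AB(5) unfolding card_covered_edges[OF A B] .
  moreover have "card (?S \<inter> {..<p}) = k1" using A AB(3) by argo
  moreover have "?S \<subseteq> {..<p} \<union> {p..<p + q}" using AB(1,2) by auto
  ultimately show ?L
    unfolding has_partial_vertex_cover_def of_nat_le_iff by blast
qed

lemma sum_le_and_eq_bound_iff:
  fixes f :: "'a \<Rightarrow> nat"
  assumes "finite A" and "\<And>a. a \<in> A \<Longrightarrow> f a \<le> c"
  shows "(\<Sum>a\<in>A. f a) \<le> card A * c" and "(\<Sum>a\<in>A. f a) = card A * c \<longleftrightarrow> (\<forall>a\<in>A. f a = c)"
proof -
  show "(\<Sum>a\<in>A. f a) \<le> card A * c"
    using sum_bounded_above[of A f c] assms(2) by simp
  have "(\<Sum>a\<in>A. c - f a) + (\<Sum>a\<in>A. f a) = (\<Sum>a\<in>A. c)"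
    unfolding sum.distrib[symmetric] by (rule sum.cong) (use assms(2) in auto)
  then have "(\<Sum>a\<in>A. f a) = card A * c \<longleftrightarrow> (\<Sum>a\<in>A. c - f a) = 0" by auto
  also have "\<dots> \<longleftrightarrow> (\<forall>a\<in>A. f a = c)"
    using assms by (auto simp: le_antisym)
  finally show "(\<Sum>a\<in>A. f a) = card A * c \<longleftrightarrow> (\<forall>a\<in>A. f a = c)" .
qed

text \<open>A target equal to the sum of all individual maxima is met only if every summand is
  maximal. This turns one inequality on the number of covered edges into a condition on each chosen
  vertex.\<close>

lemma sum_bounds_iff:
  fixes f :: "'a \<Rightarrow> nat" and g :: "'b \<Rightarrow> nat"
  assumes "finite A" and "\<And>a. a \<in> A \<Longrightarrow> f a \<le> c"
    and "finite B" and "\<And>b. b \<in> B \<Longrightarrow> g b \<le> d"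
  shows "card A * c + card B * d \<le> (\<Sum>a\<in>A. f a) + (\<Sum>b\<in>B. g b) \<longleftrightarrow>
    (\<forall>a\<in>A. f a = c) \<and> (\<forall>b\<in>B. g b = d)"
proof -
  have "(\<Sum>a\<in>A. f a) \<le> card A * c" "(\<Sum>a\<in>A. f a) = card A * c \<longleftrightarrow> (\<forall>a\<in>A. f a = c)"
    using assms by (intro sum_le_and_eq_bound_iff; blast)+
  moreover have "(\<Sum>b\<in>B. g b) \<le> card B * d" "(\<Sum>b\<in>B. g b) = card B * d \<longleftrightarrow> (\<forall>b\<in>B. g b = d)"
    using assms by (intro sum_le_and_eq_bound_iff; blast)+
  ultimately show ?thesis by linarith
qed

section \<open>The padded incidence matrix of a clique instance\<close>

text \<open>
  Rows \<open>i < V\<close> are the vertices, the other rows are padding. Column \<open>2 * (u * V + v)\<close> is the ordered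
  edge \<open>(u, v)\<close>, column \<open>2 * (u * V + v) + 1\<close> is its complement on the vertex rows, which makes the number
  of entries in a vertex row independent of the graph; the remaining columns penalize vertices that
  are not compatible with themselves.
\<close>

definition cover_matrix :: "nat \<Rightarrow> (nat \<Rightarrow> nat \<Rightarrow> bool) \<Rightarrow> nat \<Rightarrow> nat \<Rightarrow> bool" where
  "cover_matrix V C i j =
     (if j < 2 * (V * V) then
        (if C (j div 2 div V) (j div 2 mod V) \<and> j div 2 div V \<noteq> j div 2 mod V \<and>
            i \<noteq> j div 2 div V \<and> i \<noteq> j div 2 mod V
         then j mod 2 = 0 else i < V \<and> j mod 2 = 1)
      else i < V \<and> C i i)"

lemma pair_code_less:
  fixes u v :: nat
  assumes "u < a" and "v < b"
  shows "u * b + v < a * b"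
proof -
  have "u * b + v < Suc u * b" using assms(2) by simp
  also have "\<dots> \<le> a * b" using assms(1) by (intro mult_le_mono1) simp
  finally show ?thesis .
qed

text \<open>For each pair code \<open>e\<close>, a vertex row has an entry in exactly one of the
  columns \<open>2 * e\<close> and \<open>2 * e + 1\<close>, whatever \<open>C\<close> is.\<close>

lemma card_row:
  assumes "i < V"
  shows "card {j. j < 2 * (V * V) \<and> cover_matrix V C i j} = V * V"
proof -
  let ?P = "\<lambda>e. C (e div V) (e mod V) \<and> e div V \<noteq> e mod V \<and> i \<noteq> e div V \<and> i \<noteq> e mod V"
  let ?h = "\<lambda>e. if ?P e then 2 * e else 2 * e + 1"
  have "{j. j < 2 * (V * V) \<and> cover_matrix V C i j} = ?h ` {..<V * V}"
  proof (intro set_eqI iffI)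
    fix j assume "j \<in> {j. j < 2 * (V * V) \<and> cover_matrix V C i j}"
    then have j: "j < 2 * (V * V)" "j mod 2 = (if ?P (j div 2) then 0 else 1)"
      by (auto simp: cover_matrix_def split: if_splits)
    have "j = 2 * (j div 2) + j mod 2" by simp
    with j(2) have "j = ?h (j div 2)" by (cases "?P (j div 2)") (simp_all only: if_True if_False simp_thms add_0_right)
    moreover have "j div 2 \<in> {..<V * V}" using j(1) by auto
    ultimately show "j \<in> ?h ` {..<V * V}" by (rule image_eqI)
  next
    fix j assume "j \<in> ?h ` {..<V * V}"
    then obtain e where "e < V * V" "j = ?h e" by auto
    then show "j \<in> {j. j < 2 * (V * V) \<and> cover_matrix V C i j}"
      using assms by (auto simp: cover_matrix_def)
  qed
  moreover have "inj_on ?h {..<V * V}"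
    by (rule inj_on_inverseI[where g = "\<lambda>j. j div 2"]) simp
  ultimately show ?thesis using card_image[of ?h "{..<V * V}"] by (simp only: card_lessThan)
qed

text \<open>In the first \<open>2 * (V * V)\<close> columns a padding row has entries in even ones
  only, hence no more than a vertex row. The further \<open>Suc T\<close> columns tell the vertices
  with \<open>C i i\<close> from all other rows.\<close>

lemma card_row_le:
  assumes "i < p" and "q = 2 * (V * V) + Suc T"
  shows "card {j. j < q \<and> cover_matrix V C i j} \<le> V * V + Suc T"
    and "card {j. j < q \<and> cover_matrix V C i j} = V * V + Suc T \<longleftrightarrow> i < V \<and> C i i"
proof -
  let ?A = "{j. j < 2 * (V * V) \<and> cover_matrix V C i j}"
  let ?B = "if i < V \<and> C i i then {2 * (V * V)..<q} else {}"
  have "{j. j < q \<and> cover_matrix V C i j} = ?A \<union> ?B"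
    using assms(2) by (auto simp: cover_matrix_def)
  moreover have "card (?A \<union> ?B) = card ?A + card ?B"
    by (intro card_Un_disjoint) auto
  moreover have "card ?A \<le> V * V"
  proof (cases "i < V")
    case False
    then have "?A \<subseteq> (\<lambda>e. 2 * e) ` {..<V * V}"
      by (auto simp: cover_matrix_def image_iff split: if_splits)
    then show ?thesis using surj_card_le[of "{..<V * V}"] by fastforce
  qed (simp add: card_row)
  moreover have "card ?B = (if i < V \<and> C i i then Suc T else 0)" using assms(2) by auto
  ultimately show "card {j. j < q \<and> cover_matrix V C i j} \<le> V * V + Suc T"
    "card {j. j < q \<and> cover_matrix V C i j} = V * V + Suc T \<longleftrightarrow> i < V \<and> C i i"
    by (auto simp: card_row)
qed

definition edge_column :: "nat \<Rightarrow> (nat \<Rightarrow> nat \<Rightarrow> bool) \<Rightarrow> nat set \<Rightarrow> nat \<Rightarrow> bool" where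
  "edge_column V C A j \<longleftrightarrow> (\<exists>u v. u < V \<and> v < V \<and> u \<noteq> v \<and> C u v \<and> u \<in> A \<and> v \<in> A \<and> j = 2 * (u * V + v))"

text \<open>The column of an edge misses just the two ends, so its entries outside \<open>A\<close>
  number \<open>p - card (A \<union> {u, v})\<close>, which is at most \<open>p - T = Suc V\<close>,
  with equality iff both ends lie in \<open>A\<close>. Any other column lives on the
  \<open>V\<close> vertex rows; \<open>Suc T\<close> padding rows are what makes it fall
  short.\<close>

lemma card_column_le:
  assumes A: "A \<subseteq> {..<p}" "card A = T" and p: "p = V + Suc T"
  shows "card {i. i < p \<and> i \<notin> A \<and> cover_matrix V C i j} \<le> Suc V"
    and "card {i. i < p \<and> i \<notin> A \<and> cover_matrix V C i j} = Suc V \<longleftrightarrow> edge_column V C A j"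
proof -
  let ?R = "{i. i < p \<and> i \<notin> A \<and> cover_matrix V C i j}"
  let ?u = "j div 2 div V" and ?v = "j div 2 mod V"
  let ?g = "j < 2 * (V * V) \<and> j mod 2 = 0 \<and> C ?u ?v \<and> ?u \<noteq> ?v"
  have "finite A" using A finite_subset by blast
  have iff: "edge_column V C A j \<longleftrightarrow> ?g \<and> ?u \<in> A \<and> ?v \<in> A"
  proof
    assume "edge_column V C A j"
    then obtain u v where "u < V" "v < V" "u \<noteq> v" "C u v" "u \<in> A" "v \<in> A" "j = 2 * (u * V + v)"
      unfolding edge_column_def by blast
    moreover from this have "u * V + v < V * V"
      by (intro pair_code_less)
    ultimately show "?g \<and> ?u \<in> A \<and> ?v \<in> A" by auto
  next
    assume g: "?g \<and> ?u \<in> A \<and> ?v \<in> A"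
    then have "j div 2 < V * V" by auto
    then have "?u < V" "?v < V" by (auto simp: less_mult_imp_div_less intro!: mod_less_divisor gr0I)
    moreover have "j = 2 * (?u * V + ?v)" using g by auto
    ultimately show "edge_column V C A j" unfolding edge_column_def using g by blast
  qed
  have "card ?R \<le> Suc V \<and> (card ?R = Suc V \<longleftrightarrow> ?g \<and> ?u \<in> A \<and> ?v \<in> A)"
  proof (cases ?g)
    case True
    then have "j div 2 < V * V" by auto
    then have uv: "?u < V" "?v < V" by (auto simp: less_mult_imp_div_less intro!: mod_less_divisor gr0I)
    have "?R = {..<p} - (A \<union> {?u, ?v})" using True by (auto simp: cover_matrix_def)
    moreover have "?u < p" "?v < p" using uv p by linarith+
    then have "A \<union> {?u, ?v} \<subseteq> {..<p}" using A by auto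
    ultimately have R: "card ?R = p - card (A \<union> {?u, ?v})"
      using card_Diff_subset[of "A \<union> {?u, ?v}" "{..<p}"] \<open>finite A\<close> by simp
    have le: "T \<le> card (A \<union> {?u, ?v})"
      using A(2) card_mono[of "A \<union> {?u, ?v}" A] \<open>finite A\<close> by auto
    have "card (A \<union> {?u, ?v}) = T \<longleftrightarrow> ?u \<in> A \<and> ?v \<in> A"
    proof
      assume "card (A \<union> {?u, ?v}) = T"
      then have "A = A \<union> {?u, ?v}"
        using A(2) \<open>finite A\<close> by (intro card_seteq) auto
      then show "?u \<in> A \<and> ?v \<in> A" by blast
    next
      assume "?u \<in> A \<and> ?v \<in> A"
      then have "A \<union> {?u, ?v} = A" by blast
      then show "card (A \<union> {?u, ?v}) = T" using A(2) by simp
    qed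
    then show ?thesis using R le p True by auto
  next
    case False
    then have "?R \<subseteq> {..<V}" by (auto simp: cover_matrix_def split: if_splits)
    then have "card ?R \<le> V" using card_mono[of "{..<V}" ?R] by simp
    then show ?thesis using False by auto
  qed
  then show "card ?R \<le> Suc V" "card ?R = Suc V \<longleftrightarrow> edge_column V C A j" using iff by auto
qed

lemma card_off_diagonal:
  assumes "finite A"
  shows "card {(u, v). u \<in> A \<and> v \<in> A \<and> u \<noteq> v} = card A * card A - card A"
proof -
  have D: "{(u, v). u \<in> A \<and> v \<in> A \<and> u \<noteq> v} = A \<times> A - (\<lambda>u. (u, u)) ` A" by auto
  moreover have "card ((\<lambda>u. (u, u)) ` A) = card A" by (rule card_image) (auto simp: inj_on_def)
  ultimately show ?thesis
    using assms unfolding D by (subst card_Diff_subset) (auto simp: card_cartesian_product)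
qed

text \<open>The target forces every chosen row to be a self-compatible vertex and every chosen
  column to be an edge inside \<open>A\<close>. Distinct columns are distinct ordered pairs, of
  which \<open>A\<close> has only \<open>T * T - T\<close> off the diagonal, so all of them are
  edges, in both directions.\<close>

lemma partial_vertex_cover_iff_clique:
  assumes p: "p = V + Suc T" and q: "q = 2 * (V * V) + Suc T"
  shows "has_partial_vertex_cover {..<p} {p..<p + q} (biadjacency p q (cover_matrix V C)) T (T * T - T)
      (int (T * (V * V + Suc T) + (T * T - T) * Suc V)) \<longleftrightarrow>
    (\<exists>A \<subseteq> {..<V}. card A = T \<and> (\<forall>u\<in>A. \<forall>v\<in>A. C u v))" (is "?L \<longleftrightarrow> ?R")
proof -
  let ?h = "\<lambda>(u, v). 2 * (u * V + v)"
  have inj: "inj_on ?h {(u, v). u < V \<and> v < V}"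
  proof (rule inj_onI, clarify)
    fix u v u' v' assume "u < V" "v < V" "u' < V" "v' < V" "2 * (u * V + v) = 2 * (u' * V + v')"
    then have "u * V + v = u' * V + v'" by simp
    moreover have "u = (u * V + v) div V" "v = (u * V + v) mod V"
      "u' = (u' * V + v') div V" "v' = (u' * V + v') mod V"
      using \<open>v < V\<close> \<open>v' < V\<close> by simp_all
    ultimately show "u = u' \<and> v = v'" by metis
  qed
  have "?L \<longleftrightarrow> (\<exists>A B. A \<subseteq> {..<p} \<and> B \<subseteq> {..<q} \<and> card A = T \<and> card B = T * T - T \<and>
      (\<forall>i\<in>A. i < V \<and> C i i) \<and> (\<forall>j\<in>B. edge_column V C A j))"
    unfolding has_partial_vertex_cover_biadjacency
  proof (intro ex_cong1 conj_cong refl)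
    fix A B assume A: "A \<subseteq> {..<p}" and B: "B \<subseteq> {..<q}" and card: "card A = T" "card B = T * T - T"
    have "card {j. j < q \<and> cover_matrix V C i j} = V * V + Suc T \<longleftrightarrow> i < V \<and> C i i"
      "card {j. j < q \<and> cover_matrix V C i j} \<le> V * V + Suc T" if "i \<in> A" for i
      using card_row_le[of i p q V T C] that A q by auto
    moreover note card_column_le[OF A card(1) p, of C]
    moreover have "finite A" "finite B" using A B finite_subset by blast+
    ultimately show "T * (V * V + Suc T) + (T * T - T) * Suc V
        \<le> (\<Sum>i\<in>A. card {j. j < q \<and> cover_matrix V C i j}) +
          (\<Sum>j\<in>B. card {i. i < p \<and> i \<notin> A \<and> cover_matrix V C i j}) \<longleftrightarrow>
       (\<forall>i\<in>A. i < V \<and> C i i) \<and> (\<forall>j\<in>B. edge_column V C A j)"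
      using sum_bounds_iff[of A "\<lambda>i. card {j. j < q \<and> cover_matrix V C i j}" "V * V + Suc T"
        B "\<lambda>j. card {i. i < p \<and> i \<notin> A \<and> cover_matrix V C i j}" "Suc V"] card
      by simp
  qed
  also have "\<dots> \<longleftrightarrow> ?R"
  proof
    assume "\<exists>A B. A \<subseteq> {..<p} \<and> B \<subseteq> {..<q} \<and> card A = T \<and> card B = T * T - T \<and>
      (\<forall>i\<in>A. i < V \<and> C i i) \<and> (\<forall>j\<in>B. edge_column V C A j)"
    then obtain A B where "A \<subseteq> {..<p}" and A: "card A = T" "\<forall>i\<in>A. i < V \<and> C i i"
      and B: "card B = T * T - T" "\<forall>j\<in>B. edge_column V C A j"
      by blast
    have fin: "finite A" using \<open>A \<subseteq> {..<p}\<close> finite_subset by blast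
    let ?D = "{(u, v). u \<in> A \<and> v \<in> A \<and> u \<noteq> v}"
    let ?E = "{(u, v). u \<in> A \<and> v \<in> A \<and> u \<noteq> v \<and> C u v}"
    have finD: "finite ?D" by (rule finite_subset[of _ "A \<times> A"]) (use fin in auto)
    have "?E \<subseteq> ?D" by auto
    have finE: "finite ?E" using \<open>?E \<subseteq> ?D\<close> finD by (rule finite_subset)
    have "B \<subseteq> ?h ` ?E"
    proof
      fix j assume "j \<in> B"
      then obtain u v where "u \<noteq> v" "C u v" "u \<in> A" "v \<in> A" "j = ?h (u, v)"
        using B unfolding edge_column_def by auto
      then show "j \<in> ?h ` ?E" by (intro image_eqI[of _ _ "(u, v)"]) auto
    qed
    then have "card B \<le> card ?E" using finE by (meson card_image_le card_mono finite_imageI le_trans)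
    then have "card ?D \<le> card ?E" using B(1) A(1) card_off_diagonal[OF fin] by simp
    with finD \<open>?E \<subseteq> ?D\<close> have "?E = ?D" by (rule card_seteq)
    have "C u v" if "u \<in> A" "v \<in> A" for u v
    proof (cases "u = v")
      case False
      then have "(u, v) \<in> ?E" unfolding \<open>?E = ?D\<close> using that by simp
      then show ?thesis by simp
    qed (use A that in simp)
    with A show ?R by (intro exI[of _ A]) auto
  next
    assume ?R
    then obtain A where A: "A \<subseteq> {..<V}" "card A = T" "\<forall>u\<in>A. \<forall>v\<in>A. C u v" by blast
    let ?D = "{(u, v). u \<in> A \<and> v \<in> A \<and> u \<noteq> v}"
    have fin: "finite A" using A(1) finite_subset by blast
    have "?D \<subseteq> {(u, v). u < V \<and> v < V}" using A(1) by auto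
    then have "card (?h ` ?D) = T * T - T"
      using card_off_diagonal[OF fin] A(2) by (simp only: card_image[OF inj_on_subset[OF inj]])
    moreover have "?h ` ?D \<subseteq> {..<q}"
    proof
      fix j assume "j \<in> ?h ` ?D"
      then obtain u v where "u < V" "v < V" "j = 2 * (u * V + v)" using A(1) by auto
      moreover from this have "u * V + v < V * V"
        by (intro pair_code_less)
      ultimately show "j \<in> {..<q}" using q by auto
    qed
    moreover have "\<forall>j\<in>?h ` ?D. edge_column V C A j"
      unfolding edge_column_def using A by fastforce
    moreover have "A \<subseteq> {..<p}" "\<forall>i\<in>A. i < V \<and> C i i" using A p by auto
    ultimately show "\<exists>A B. A \<subseteq> {..<p} \<and> B \<subseteq> {..<q} \<and> card A = T \<and> card B = T * T - T \<and>
      (\<forall>i\<in>A. i < V \<and> C i i) \<and> (\<forall>j\<in>B. edge_column V C A j)"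
      using A(2) by blast
  qed
  finally show ?thesis .
qed

section \<open>From weighted selections to cliques\<close>

definition dig :: "nat \<Rightarrow> nat \<Rightarrow> nat \<Rightarrow> nat" where
  "dig b x j = x div b ^ j mod b"

definition undig :: "nat \<Rightarrow> nat \<Rightarrow> (nat \<Rightarrow> nat) \<Rightarrow> nat" where
  "undig b m f = (\<Sum>j<m. f j * b ^ j)"

lemma undig_less: "(\<And>j. j < m \<Longrightarrow> f j < b) \<Longrightarrow> undig b m f < b ^ m"
proof (induction m)
  case (Suc m)
  then have "undig b m f < b ^ m" "f m < b" by simp_all
  then have "undig b m f + f m * b ^ m < Suc (f m) * b ^ m" by simp
  also have "\<dots> \<le> b * b ^ m" using \<open>f m < b\<close> by (intro mult_le_mono1) simp
  finally show ?case by (simp add: undig_def)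
qed (simp add: undig_def)

lemma dig_undig: "(\<And>j. j < m \<Longrightarrow> f j < b) \<Longrightarrow> j < m \<Longrightarrow> dig b (undig b m f) j = f j"
proof (induction m)
  case (Suc m)
  have S: "undig b (Suc m) f = undig b m f + f m * b ^ m" by (simp add: undig_def)
  have b: "0 < b" using Suc.prems(1)[of m] by simp
  have less: "undig b m f < b ^ m" using Suc.prems(1) by (intro undig_less) simp
  show ?case
  proof (cases "j = m")
    case True
    then show ?thesis using less b Suc.prems(1)[of m] by (simp add: S dig_def)
  next
    case False
    then have j: "j < m" using Suc.prems(2) by simp
    then have "b ^ m = b ^ j * (b * b ^ (m - Suc j))"
      by (metis Suc_diff_Suc add_diff_inverse_nat less_imp_le_nat not_less power_Suc power_add)
    then have "undig b m f + f m * b ^ m = undig b m f + b ^ j * (b * (f m * b ^ (m - Suc j)))"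
      by (simp add: mult.left_commute)
    then have "(undig b m f + f m * b ^ m) div b ^ j = b * (f m * b ^ (m - Suc j)) + undig b m f div b ^ j"
      using b by (simp only: div_mult_self2[OF power_not_zero[OF less_imp_neq[OF b, symmetric]]])
    then have "dig b (undig b (Suc m) f) j = (undig b m f div b ^ j + b * (f m * b ^ (m - Suc j))) mod b"
      unfolding S dig_def by (simp only: add.commute)
    then have "dig b (undig b (Suc m) f) j = dig b (undig b m f) j"
      unfolding dig_def by simp
    then show ?thesis using Suc j by simp
  qed
qed simp

lemma undig_dig_mod: "undig b m (dig b x) = x mod b ^ m"
proof (induction m)
  case (Suc m)
  have "undig b (Suc m) (dig b x) = undig b m (dig b x) + dig b x m * b ^ m" by (simp add: undig_def)
  also have "\<dots> = x mod (b ^ m * b)" unfolding Suc mod_mult2_eq dig_def by simp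
  finally show ?case by (simp add: mult.commute)
qed (simp add: undig_def)

lemma undig_dig: "x < b ^ m \<Longrightarrow> undig b m (dig b x) = x"
  by (simp add: undig_dig_mod)

lemma undig_cong: "(\<And>j. j < m \<Longrightarrow> f j = g j) \<Longrightarrow> undig b m f = undig b m g"
  unfolding undig_def by (intro sum.cong) auto

lemma dig_eqI:
  assumes "x < b ^ m" and "y < b ^ m" and "\<And>j. j < m \<Longrightarrow> dig b x j = dig b y j"
  shows "x = y"
  using undig_cong[of m "dig b x" "dig b y" b, OF assms(3)] undig_dig[OF assms(1)] undig_dig[OF assms(2)] by simp

lemma dig_less: "0 < b \<Longrightarrow> dig b x j < b"
  by (simp add: dig_def)

text \<open>
  The node \<open>(\<theta> * (N + 1) ^ m + \<alpha>) * H + \<pi>\<close> assigns the tuple of elements with code \<open>\<alpha>\<close> to the tuple of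
  indices with code \<open>\<theta>\<close>, \<open>\<pi>\<close> being the shifted partial sum of the coefficients of the preceding tuples.
  The partial sums are linked cyclically, which forces the total to vanish.
\<close>

definition node_compat ::
    "nat \<Rightarrow> nat \<Rightarrow> nat \<Rightarrow> nat \<Rightarrow> (nat \<Rightarrow> nat) \<Rightarrow> (nat \<Rightarrow> nat) \<Rightarrow> nat \<Rightarrow> nat \<Rightarrow> bool" where
  "node_compat m k N H cp cn u v \<longleftrightarrow>
     (\<forall>a<m. \<forall>b<m. dig (k + 1) (u div H div (N + 1) ^ m) a = dig (k + 1) (v div H div (N + 1) ^ m) b \<longleftrightarrow>
        dig (N + 1) (u div H mod (N + 1) ^ m) a = dig (N + 1) (v div H mod (N + 1) ^ m) b) \<and>
     (\<forall>a<m. dig (k + 1) (u div H div (N + 1) ^ m) a = 0 \<longleftrightarrow> dig (N + 1) (u div H mod (N + 1) ^ m) a = 0) \<and>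
     (u div H div (N + 1) ^ m = v div H div (N + 1) ^ m \<longrightarrow> u mod H = v mod H) \<and>
     (v div H div (N + 1) ^ m = (u div H div (N + 1) ^ m + 1) mod (k + 1) ^ m \<longrightarrow>
        v mod H + cn (u div H mod (N + 1) ^ m) = u mod H + cp (u div H mod (N + 1) ^ m))"

text \<open>The action of an enumeration \<open>s\<close> on index tuples, carried over to codes:
  base \<open>k + 1\<close> becomes base \<open>N + 1\<close>.\<close>

definition reindex :: "nat \<Rightarrow> nat \<Rightarrow> nat \<Rightarrow> (nat \<Rightarrow> nat) \<Rightarrow> nat \<Rightarrow> nat" where
  "reindex m k N s \<theta> = undig (N + 1) m (\<lambda>j. s (dig (k + 1) \<theta> j))"

lemma dig_reindex:
  assumes "\<And>i. i \<le> k \<Longrightarrow> s i \<le> N" and "j < m"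
  shows "dig (N + 1) (reindex m k N s \<theta>) j = s (dig (k + 1) \<theta> j)"
  unfolding reindex_def
proof (rule dig_undig[OF _ assms(2)])
  fix j have "dig (k + 1) \<theta> j \<le> k" using dig_less[of "k + 1" \<theta> j] by simp
  then show "s (dig (k + 1) \<theta> j) < N + 1" using assms(1) by fastforce
qed

lemma reindex_less:
  assumes "\<And>i. i \<le> k \<Longrightarrow> s i \<le> N"
  shows "reindex m k N s \<theta> < (N + 1) ^ m"
  unfolding reindex_def
proof (rule undig_less)
  fix j have "dig (k + 1) \<theta> j \<le> k" using dig_less[of "k + 1" \<theta> j] by simp
  then show "s (dig (k + 1) \<theta> j) < N + 1" using assms by fastforce
qed

lemma sum_rotate: "(\<Sum>\<theta><T. f ((\<theta> + 1) mod T)) = (\<Sum>\<theta><T. f \<theta>)" for f :: "nat \<Rightarrow> nat"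
proof (cases T)
  case (Suc n)
  have "(\<Sum>\<theta><n. f ((\<theta> + 1) mod T)) = (\<Sum>\<theta><n. f (Suc \<theta>))"
    using Suc by (intro sum.cong) auto
  then show ?thesis unfolding Suc sum.lessThan_Suc_shift[of f] using Suc by simp
qed simp

text \<open>\<open>T\<close> compatible nodes have pairwise different index tuples, so each of the
  \<open>T\<close> tuples occurs once. Agreement on equal indices across nodes yields one injective
  \<open>s\<close>; adding the recurrence of the partial sums around the cycle cancels them and
  leaves equality of the two totals. Shifted by \<open>T * L\<close>, partial sums lie between 0 and
  \<open>2 * (T * L)\<close>, whence \<open>H\<close>.\<close>

lemma clique_iff_selection:
  assumes m: "0 < m" and T: "T = (k + 1) ^ m" and H: "H = 2 * (T * L) + 1"
    and cp: "\<And>\<alpha>. cp \<alpha> \<le> L" and cn: "\<And>\<alpha>. cn \<alpha> \<le> L"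
  shows "(\<exists>A \<subseteq> {..<T * (N + 1) ^ m * H}. card A = T \<and> (\<forall>u\<in>A. \<forall>v\<in>A. node_compat m k N H cp cn u v)) \<longleftrightarrow>
    (\<exists>s. s 0 = 0 \<and> inj_on s {..k} \<and> (\<forall>i\<le>k. s i \<le> N) \<and>
      (\<Sum>\<theta><T. cp (reindex m k N s \<theta>)) = (\<Sum>\<theta><T. cn (reindex m k N s \<theta>)))" (is "?L \<longleftrightarrow> ?R")
proof -
  let ?W = "(N + 1) ^ m"
  let ?\<theta> = "\<lambda>u. u div H div ?W" and ?\<alpha> = "\<lambda>u. u div H mod ?W" and ?\<pi> = "\<lambda>u. u mod H"
  let ?d = "dig (k + 1)" and ?e = "dig (N + 1)"
  have kT: "k < T"
    using T m power_increasing[of 1 m "k + 1"] by simp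
  show ?thesis
  proof
    assume ?L
    then obtain A where A: "A \<subseteq> {..<T * ?W * H}" "card A = T"
      and compat: "\<And>u v. u \<in> A \<Longrightarrow> v \<in> A \<Longrightarrow> node_compat m k N H cp cn u v" by blast
    have c1: "?d (?\<theta> u) a = ?d (?\<theta> v) b \<longleftrightarrow> ?e (?\<alpha> u) a = ?e (?\<alpha> v) b"
      if "u \<in> A" "v \<in> A" "a < m" "b < m" for u v a b
      using compat[OF that(1,2)] that(3,4) unfolding node_compat_def by blast
    have c2: "?d (?\<theta> u) a = 0 \<longleftrightarrow> ?e (?\<alpha> u) a = 0" if "u \<in> A" "a < m" for u a
      using compat[OF that(1,1)] that(2) unfolding node_compat_def by blast
    have c3: "?\<theta> u = ?\<theta> v \<Longrightarrow> ?\<pi> u = ?\<pi> v" if "u \<in> A" "v \<in> A" for u v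
      using compat[OF that] unfolding node_compat_def by blast
    have c4: "?\<theta> v = (?\<theta> u + 1) mod T \<Longrightarrow> ?\<pi> v + cn (?\<alpha> u) = ?\<pi> u + cp (?\<alpha> u)"
      if "u \<in> A" "v \<in> A" for u v
      using compat[OF that] unfolding node_compat_def T by blast
    \<comment> \<open>Equal index tuples force equal element tuples digit by digit, and equal
      partial sums, hence equal nodes.\<close>
    have "inj_on ?\<theta> A"
    proof (rule inj_onI)
      fix u v assume uv: "u \<in> A" "v \<in> A" "?\<theta> u = ?\<theta> v"
      have "?\<alpha> u = ?\<alpha> v"
      proof (rule dig_eqI)
        show "?e (?\<alpha> u) j = ?e (?\<alpha> v) j" if "j < m" for j
          using c1[OF uv(1,2) that that] uv(3) by simp
      qed simp_all
      with uv(3) have "u div H = v div H" by (metis div_mult_mod_eq)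
      with c3[OF uv] show "u = v" by (metis div_mult_mod_eq)
    qed
    have "?\<theta> ` A \<subseteq> {..<T}"
    proof
      fix x assume "x \<in> ?\<theta> ` A"
      then obtain u where "u < T * ?W * H" "x = ?\<theta> u" using A(1) by auto
      then show "x \<in> {..<T}" by (simp add: less_mult_imp_div_less)
    qed
    moreover have "card (?\<theta> ` A) = card {..<T}" using A(2) \<open>inj_on ?\<theta> A\<close> by (simp add: card_image)
    ultimately have "?\<theta> ` A = {..<T}" by (intro card_subset_eq) auto
    then have img: "\<theta> \<in> ?\<theta> ` A" if "\<theta> < T" for \<theta> using that by blast
    define node where "node \<theta> = (SOME u. u \<in> A \<and> ?\<theta> u = \<theta>)" for \<theta>
    have node: "node \<theta> \<in> A \<and> ?\<theta> (node \<theta>) = \<theta>" if "\<theta> < T" for \<theta>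
      unfolding node_def by (rule someI_ex) (use img[OF that] in blast)
    \<comment> \<open>An index \<open>i\<close> is itself the code of an index tuple with first
      entry \<open>i\<close>, so the first digit in \<open>node i\<close> is the element assigned to
      \<open>i\<close>.\<close>
    define s where "s i = ?e (?\<alpha> (node i)) 0" for i
    have d0: "?d i 0 = i" if "i \<le> k" for i using that by (simp add: dig_def)
    have s: "?e (?\<alpha> (node \<theta>)) a = s (?d \<theta> a)" if "\<theta> < T" "a < m" for \<theta> a
    proof -
      have i: "?d \<theta> a \<le> k" using dig_less[of "k + 1" \<theta> a] by simp
      then have "?d \<theta> a < T" using kT by simp
      from node[OF that(1)] node[OF this] c1[of "node \<theta>" "node (?d \<theta> a)" a 0] that m d0[OF i]
      show ?thesis by (simp add: s_def)
    qed
    have sN: "s i \<le> N" for i using dig_less[of "N + 1" "?\<alpha> (node i)" 0] by (simp add: s_def)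
    have "s 0 = 0" using c2[of "node 0" 0] node[of 0] kT m d0[of 0] by (simp add: s_def)
    moreover have "inj_on s {..k}"
    proof (rule inj_onI)
      fix i j assume ij: "i \<in> {..k}" "j \<in> {..k}" "s i = s j"
      then show "i = j" using c1[of "node i" "node j" 0 0] node[of i] node[of j] kT m d0[of i] d0[of j]
        by (simp add: s_def)
    qed
    moreover have "(\<Sum>\<theta><T. cp (reindex m k N s \<theta>)) = (\<Sum>\<theta><T. cn (reindex m k N s \<theta>))"
    proof -
      have \<alpha>: "?\<alpha> (node \<theta>) = reindex m k N s \<theta>" if "\<theta> < T" for \<theta>
      proof (rule dig_eqI[where m = m and b = "N + 1"])
        show "?e (?\<alpha> (node \<theta>)) j = ?e (reindex m k N s \<theta>) j" if "j < m" for j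
          unfolding s[OF \<open>\<theta> < T\<close> that] using sN that by (intro dig_reindex[symmetric])
        show "reindex m k N s \<theta> < ?W" using sN by (intro reindex_less)
      qed simp
      have "?\<pi> (node ((\<theta> + 1) mod T)) + cn (reindex m k N s \<theta>) = ?\<pi> (node \<theta>) + cp (reindex m k N s \<theta>)"
        if "\<theta> < T" for \<theta>
        using c4[of "node \<theta>" "node ((\<theta> + 1) mod T)"] node[OF that] node[of "(\<theta> + 1) mod T"] kT \<alpha>[OF that]
        by simp
      then have "(\<Sum>\<theta><T. ?\<pi> (node ((\<theta> + 1) mod T)) + cn (reindex m k N s \<theta>)) =
          (\<Sum>\<theta><T. ?\<pi> (node \<theta>) + cp (reindex m k N s \<theta>))" by (intro sum.cong) auto
      then show ?thesis unfolding sum.distrib sum_rotate[of "\<lambda>\<theta>. ?\<pi> (node \<theta>)"] by simp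
    qed
    ultimately show ?R using sN by blast
  next
    assume ?R
    then obtain s where s: "s 0 = 0" "inj_on s {..k}" "\<And>i. i \<le> k \<Longrightarrow> s i \<le> N"
      "(\<Sum>\<theta><T. cp (reindex m k N s \<theta>)) = (\<Sum>\<theta><T. cn (reindex m k N s \<theta>))" by blast
    let ?r = "reindex m k N s"
    define P where "P \<theta> = (\<Sum>\<eta><\<theta>. cp (?r \<eta>))" for \<theta>
    define Q where "Q \<theta> = (\<Sum>\<eta><\<theta>. cn (?r \<eta>))" for \<theta>
    have le: "P \<theta> \<le> T * L" "Q \<theta> \<le> T * L" if "\<theta> \<le> T" for \<theta>
    proof -
      have "P \<theta> \<le> \<theta> * L" "Q \<theta> \<le> \<theta> * L"
        using sum_bounded_above[of "{..<\<theta>}" "\<lambda>\<eta>. cp (?r \<eta>)" L] sum_bounded_above[of "{..<\<theta>}" "\<lambda>\<eta>. cn (?r \<eta>)" L] cp cn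
        by (auto simp: P_def Q_def)
      moreover have "\<theta> * L \<le> T * L" using that by simp
      ultimately show "P \<theta> \<le> T * L" "Q \<theta> \<le> T * L" by linarith+
    qed
    \<comment> \<open>The shift keeps the truncated subtraction exact, as \<open>Q\<close> never
      exceeds \<open>T * L\<close> up to index \<open>T\<close>.\<close>
    define pi where "pi \<theta> = T * L + P \<theta> - Q \<theta>" for \<theta>
    define node where "node \<theta> = (\<theta> * ?W + ?r \<theta>) * H + pi \<theta>" for \<theta>
    have r: "?r \<theta> < ?W" for \<theta> using s(3) by (rule reindex_less)
    have pi: "pi \<theta> < H" if "\<theta> < T" for \<theta> using le[of \<theta>] that H by (simp add: pi_def)
    have dec: "?\<theta> (node \<theta>) = \<theta>" "?\<alpha> (node \<theta>) = ?r \<theta>" "?\<pi> (node \<theta>) = pi \<theta>" if "\<theta> < T" for \<theta>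
    proof -
      have "node \<theta> div H = \<theta> * ?W + ?r \<theta>" "node \<theta> mod H = pi \<theta>"
        using pi[OF that] by (simp_all add: node_def)
      then show "?\<theta> (node \<theta>) = \<theta>" "?\<alpha> (node \<theta>) = ?r \<theta>" "?\<pi> (node \<theta>) = pi \<theta>"
        using r[of \<theta>] by simp_all
    qed
    have "inj_on node {..<T}" by (rule inj_on_inverseI[where g = ?\<theta>]) (rule dec(1), simp)
    then have "card (node ` {..<T}) = T" by (simp add: card_image)
    moreover have "node ` {..<T} \<subseteq> {..<T * ?W * H}"
    proof
      fix u assume "u \<in> node ` {..<T}"
      then obtain \<theta> where \<theta>: "\<theta> < T" "u = node \<theta>" by auto
      have "\<theta> * ?W + ?r \<theta> < T * ?W"
      proof -
        have "\<theta> * ?W + ?r \<theta> < Suc \<theta> * ?W" using r[of \<theta>] by simp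
        also have "\<dots> \<le> T * ?W" using \<theta>(1) by (intro mult_le_mono1) simp
        finally show ?thesis .
      qed
      then have "Suc (\<theta> * ?W + ?r \<theta>) * H \<le> T * ?W * H" by (intro mult_le_mono1) simp
      moreover have "u < Suc (\<theta> * ?W + ?r \<theta>) * H" using pi[OF \<theta>(1)] \<theta>(2) by (simp add: node_def)
      ultimately show "u \<in> {..<T * ?W * H}" by simp
    qed
    moreover have "node_compat m k N H cp cn u v" if uv: "u \<in> node ` {..<T}" "v \<in> node ` {..<T}" for u v
    proof -
      obtain \<theta> \<eta> where \<theta>: "\<theta> < T" "u = node \<theta>" and \<eta>: "\<eta> < T" "v = node \<eta>"
        using uv by auto
      have d: "?d x a \<in> {..k}" for x a using dig_less[of "k + 1" x a] by simp
      have e: "?e (?r x) a = s (?d x a)" if "a < m" for x a using s(3) that by (rule dig_reindex)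
      have "?d \<theta> a = ?d \<eta> b \<longleftrightarrow> ?e (?r \<theta>) a = ?e (?r \<eta>) b" if "a < m" "b < m" for a b
        unfolding e[OF that(1)] e[OF that(2)] inj_on_eq_iff[OF s(2) d d] ..
      moreover have "?d \<theta> a = 0 \<longleftrightarrow> ?e (?r \<theta>) a = 0" if "a < m" for a
        unfolding e[OF that(1)] using inj_on_eq_iff[OF s(2) d, of 0 \<theta> a] s(1) by simp
      moreover have "pi \<eta> + cn (?r \<theta>) = pi \<theta> + cp (?r \<theta>)" if "\<eta> = (\<theta> + 1) mod T"
      proof -
        have "pi (Suc \<theta>) + cn (?r \<theta>) = pi \<theta> + cp (?r \<theta>)"
        proof -
          have "P (Suc \<theta>) = P \<theta> + cp (?r \<theta>)" "Q (Suc \<theta>) = Q \<theta> + cn (?r \<theta>)" by (simp_all add: P_def Q_def)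
          then show ?thesis using le[of \<theta>] le[of "Suc \<theta>"] \<theta>(1) unfolding pi_def by simp
        qed
        \<comment> \<open>At the end of the cycle, equality of the two totals brings the partial sum
          back to its initial value.\<close>
        moreover have "pi \<eta> = pi (Suc \<theta>)"
        proof (cases "Suc \<theta> = T")
          case True
          then have "\<eta> = 0" using that by simp
          moreover have "pi T = pi 0" using s(4) by (simp add: pi_def P_def Q_def)
          ultimately show ?thesis using True by simp
        qed (use that \<theta>(1) in simp)
        ultimately show ?thesis by simp
      qed
      ultimately show ?thesis
        unfolding node_compat_def \<theta>(2) \<eta>(2) dec[OF \<theta>(1)] dec[OF \<eta>(1)] T[symmetric] by simp
    qed
    ultimately show ?L by blast
  qed
qed

section \<open>From first-order formulas to weighted selections\<close>

text \<open>
  A monomial has a sign, guards not involving the relation variable, and the arguments of its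
  occurrences of the relation variable.
\<close>

type_synonym monomial = "bool \<times> qf list \<times> nat list list"

text \<open>Multiplication of polynomials, \<open>a = b\<close> being the product of the signs. Like
  terms are not collected, so coefficients stay 1 or -1 and repetition in the list carries
  multiplicity.\<close>

definition mmult :: "monomial list \<Rightarrow> monomial list \<Rightarrow> monomial list" where
  "mmult xs ys = concat (map (\<lambda>(a, g, t). map (\<lambda>(b, h, u). (a = b, g @ h, t @ u)) ys) xs)"

definition mneg :: "monomial list \<Rightarrow> monomial list" where
  "mneg xs = (True, [], []) # map (\<lambda>(a, g, t). (\<not> a, g, t)) xs"

fun monomials :: "qf \<Rightarrow> monomial list" where
  "monomials (Rel i xs) = [(True, [Rel i xs], [])]"
| "monomials (RelVar xs) = [(True, [], [xs])]"
| "monomials (Eq x y) = [(True, [Eq x y], [])]"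
| "monomials (Neg p) = mneg (monomials p)"
| "monomials (Conj p q) = mmult (monomials p) (monomials q)"
| "monomials (Disj p q) = mneg (mmult (mneg (monomials p)) (mneg (monomials q)))"

fun mval :: "(nat \<Rightarrow> nat list set) \<Rightarrow> nat list set \<Rightarrow> (nat \<Rightarrow> nat) \<Rightarrow> monomial \<Rightarrow> int" where
  "mval R S v (a, g, t) =
     (if a then 1 else - 1) * of_bool ((\<forall>p\<in>set g. sat_qf R {} v p) \<and> (\<forall>xs\<in>set t. map v xs \<in> S))"

lemma mval_mmult:
  "(\<Sum>x\<leftarrow>mmult xs ys. mval R S v x) = (\<Sum>x\<leftarrow>xs. mval R S v x) * (\<Sum>x\<leftarrow>ys. mval R S v x)"
proof (induction xs)
  case (Cons x xs)
  obtain a g t where x: "x = (a, g, t)" by (cases x)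
  have "(\<lambda>y. mval R S v (case y of (b, h, u) \<Rightarrow> (a = b, g @ h, t @ u))) = (\<lambda>y. mval R S v x * mval R S v y)"
    by (auto simp: fun_eq_iff x)
  then have "(\<Sum>z\<leftarrow>map (\<lambda>(b, h, u). (a = b, g @ h, t @ u)) ys. mval R S v z) = (\<Sum>y\<leftarrow>ys. mval R S v x * mval R S v y)"
    by (simp add: comp_def)
  then have "(\<Sum>z\<leftarrow>map (\<lambda>(b, h, u). (a = b, g @ h, t @ u)) ys. mval R S v z) = mval R S v x * (\<Sum>y\<leftarrow>ys. mval R S v y)"
    by (simp add: sum_list_const_mult)
  then show ?case using Cons by (simp add: mmult_def x distrib_right)
qed (simp add: mmult_def)

lemma mval_mneg: "(\<Sum>x\<leftarrow>mneg xs. mval R S v x) = 1 - (\<Sum>x\<leftarrow>xs. mval R S v x)"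
proof -
  have "(\<Sum>x\<leftarrow>map (\<lambda>(a, g, t). (\<not> a, g, t)) xs. mval R S v x) = - (\<Sum>x\<leftarrow>xs. mval R S v x)"
    by (induction xs) auto
  then show ?thesis by (simp add: mneg_def)
qed

text \<open>Negation is 1 minus the value, conjunction is the product, and disjunction is reduced to
  both by De Morgan.\<close>

lemma mval_monomials: "(\<Sum>x\<leftarrow>monomials p. mval R S v x) = of_bool (sat_qf R S v p)"
  by (induction p) (auto simp: mval_mmult mval_mneg)

lemma monomials_wf:
  assumes "wf_qf ar r l p" and "(a, g, t) \<in> set (monomials p)" and "xs \<in> set t"
  shows "length xs = r \<and> (\<forall>x\<in>set xs. x < l)"
proof -
  define ok where "ok M \<longleftrightarrow> (\<forall>(a, g, t)\<in>set M. \<forall>xs\<in>set t. length xs = r \<and> (\<forall>x\<in>set xs. x < l))"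
    for M :: "monomial list"
  have mult: "ok (mmult M N)" if "ok M" "ok N" for M N
    using that unfolding ok_def mmult_def by fastforce
  have neg: "ok (mneg M)" if "ok M" for M
    using that unfolding ok_def mneg_def by fastforce
  have "ok (monomials p)"
    using assms(1) by (induction p) (auto intro!: mult neg, auto simp: ok_def)
  then show ?thesis using assms(2,3) unfolding ok_def by blast
qed

section \<open>Coefficients and their sum over a selection\<close>

definition code :: "nat \<Rightarrow> nat list \<Rightarrow> nat" where
  "code n xs = undig n (length xs) (\<lambda>j. xs ! j)"

lemma code_less: "xs \<in> tuples n r \<Longrightarrow> code n xs < n ^ r"
  by (auto simp: code_def tuples_def subset_iff intro!: undig_less)

lemma map_dig_code: "xs \<in> tuples n r \<Longrightarrow> map (dig n (code n xs)) [0..<r] = xs"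
  by (rule nth_equalityI) (auto simp: code_def tuples_def subset_iff intro!: dig_undig)

lemma map_dig_tuples: "0 < n \<Longrightarrow> map (dig n e) [0..<r] \<in> tuples n r"
  by (auto simp: tuples_def dig_less)

lemma code_map_dig: "e < n ^ r \<Longrightarrow> code n (map (dig n e) [0..<r]) = e"
  using undig_cong[of r "\<lambda>j. map (dig n e) [0..<r] ! j" "dig n e" n]
  by (simp add: code_def undig_dig)

lemma inj_on_code: "inj_on (code n) (tuples n r)"
  by (rule inj_on_inverseI[where g = "\<lambda>e. map (dig n e) [0..<r]"]) (rule map_dig_code)

lemma finite_tuples: "finite (tuples n r)"
  using finite_lists_length_eq[of "{..<n}" r] by (simp add: tuples_def conj_commute)

text \<open>
  Elements of the universe of the selection are the codes of \<open>r\<close>-tuples shifted by 1, so that 0 is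
  free to pad the tuple lists of monomials to the common length \<open>m\<close>.
\<close>

definition matches :: "nat \<Rightarrow> nat \<Rightarrow> nat \<Rightarrow> (nat \<Rightarrow> nat) \<Rightarrow> nat list list \<Rightarrow> nat \<Rightarrow> bool" where
  "matches n N m v t \<alpha> \<longleftrightarrow>
     (\<forall>j<m. dig (N + 1) \<alpha> j = (if j < length t then code n (map v (t ! j)) + 1 else 0))"

text \<open>The two signs \<open>b\<close> are collected separately because compiled functions take
  natural numbers as values; the difference of both is the coefficient belonging to the padded tuple
  \<open>\<alpha>\<close>.\<close>

definition coeff :: "bool \<Rightarrow> (nat \<Rightarrow> nat list set) \<Rightarrow> nat \<Rightarrow> nat \<Rightarrow> nat \<Rightarrow> nat \<Rightarrow> monomial list \<Rightarrow> nat \<Rightarrow> nat" where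
  "coeff b R n N m l M \<alpha> = (\<Sum>y<n ^ l. \<Sum>(a, g, t)\<leftarrow>M.
     of_bool (a = b \<and> (\<forall>p\<in>set g. sat_qf R {} (dig n y) p) \<and> matches n N m (dig n y) t \<alpha>))"

lemma sum_list_of_bool_le: "(\<Sum>x\<leftarrow>xs. of_bool (P x)) \<le> length xs"
  by (induction xs) auto

lemma coeff_le: "coeff b R n N m l M \<alpha> \<le> n ^ l * length M"
proof -
  have "(\<Sum>(a, g, t)\<leftarrow>M. of_bool (a = b \<and> (\<forall>p\<in>set g. sat_qf R {} (dig n y) p) \<and> matches n N m (dig n y) t \<alpha>)) \<le> length M"
    for y
    using sum_list_of_bool_le[of "\<lambda>(a, g, t). a = b \<and> (\<forall>p\<in>set g. sat_qf R {} (dig n y) p) \<and> matches n N m (dig n y) t \<alpha>" M]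
    by (simp add: case_prod_unfold)
  then show ?thesis
    unfolding coeff_def using sum_bounded_above[of "{..<n ^ l}" _ "length M"] by (simp add: mult.commute)
qed

lemma sum_sum_list: "(\<Sum>i\<in>A. \<Sum>x\<leftarrow>xs. f i x) = (\<Sum>x\<leftarrow>xs. \<Sum>i\<in>A. f i x)"
  by (induction xs) (simp_all add: sum.distrib)

text \<open>Injectivity leaves at most one index tuple over a given tuple \<open>z\<close>. Summing
  over all index tuples thus counts a monomial once if all its arguments are selected, and not at
  all otherwise.\<close>

lemma count_preimages:
  assumes "inj_on s {..k}"
  shows "(\<Sum>\<theta><(k + 1) ^ m. of_bool (\<forall>j<m. s (dig (k + 1) \<theta> j) = z j)) = (of_bool (\<forall>j<m. z j \<in> s ` {..k}) :: nat)"
proof -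
  let ?A = "{\<theta>. \<theta> < (k + 1) ^ m \<and> (\<forall>j<m. s (dig (k + 1) \<theta> j) = z j)}"
  have d: "dig (k + 1) \<theta> j \<in> {..k}" for \<theta> j using dig_less[of "k + 1" \<theta> j] by simp
  have "card ?A = of_bool (\<forall>j<m. z j \<in> s ` {..k})"
  proof (cases "\<forall>j<m. z j \<in> s ` {..k}")
    case True
    define f where "f j = inv_into {..k} s (z j)" for j
    have f: "f j \<in> {..k}" "s (f j) = z j" if "j < m" for j
      using True that by (auto simp: f_def inv_into_into f_inv_into_f simp del: atMost_iff)
    define \<eta> where "\<eta> = undig (k + 1) m f"
    have \<eta>: "dig (k + 1) \<eta> j = f j" if "j < m" for j
      unfolding \<eta>_def by (rule dig_undig) (use f that in \<open>auto simp: less_Suc_eq_le\<close>)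
    have "\<eta> < (k + 1) ^ m" unfolding \<eta>_def by (rule undig_less) (use f in \<open>auto simp: less_Suc_eq_le\<close>)
    then have "\<eta> \<in> ?A" using \<eta> f by simp
    moreover have "\<theta> = \<eta>" if "\<theta> \<in> ?A" for \<theta>
    proof (rule dig_eqI)
      show "\<theta> < (k + 1) ^ m" "\<eta> < (k + 1) ^ m" using that \<open>\<eta> < _\<close> by simp_all
      show "dig (k + 1) \<theta> j = dig (k + 1) \<eta> j" if "j < m" for j
        using inj_onD[OF assms _ d f(1)[OF that]] \<open>\<theta> \<in> ?A\<close> f(2)[OF that] \<eta>[OF that] that by simp
    qed
    ultimately have "?A = {\<eta>}" by blast
    then show ?thesis using True by simp
  next
    case False
    then obtain j where j: "j < m" "z j \<notin> s ` {..k}" by blast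
    have "?A = {}"
    proof (rule equals0I)
      fix \<theta> assume "\<theta> \<in> ?A"
      then have "z j = s (dig (k + 1) \<theta> j)" using j(1) by simp
      with d j(2) show False by blast
    qed
    then have "card ?A = 0" by (simp only: card.empty)
    with False show ?thesis by (simp only: of_bool_eq simp_thms)
  qed
  moreover have "{..<(k + 1) ^ m} \<inter> {\<theta>. \<forall>j<m. s (dig (k + 1) \<theta> j) = z j} = ?A" by auto
  ultimately have "card ({..<(k + 1) ^ m} \<inter> {\<theta>. \<forall>j<m. s (dig (k + 1) \<theta> j) = z j}) =
      of_bool (\<forall>j<m. z j \<in> s ` {..k})" by (simp only:)
  moreover have "(\<Sum>\<theta><(k + 1) ^ m. of_bool (\<forall>j<m. s (dig (k + 1) \<theta> j) = z j)) =
      (of_nat (card ({..<(k + 1) ^ m} \<inter> {\<theta>. \<forall>j<m. s (dig (k + 1) \<theta> j) = z j})) :: nat)"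
    by (rule sum_of_bool_eq) (rule finite_lessThan)+
  ultimately show ?thesis by (simp only: of_nat_id)
qed

text \<open>Exchanging the sums over index tuples and assignments reduces the claim to one monomial
  under one assignment, where \<open>count_preimages\<close> applies. By \<open>s 0 = 0\<close> the
  padding value is always in the range of \<open>s\<close>, so only genuine arguments impose a
  condition.\<close>

lemma coeff_diff:
  assumes n: "0 < n" and N: "N = n ^ r" and T: "T = (k + 1) ^ m"
    and s: "s 0 = 0" "inj_on s {..k}" "\<And>i. i \<le> k \<Longrightarrow> s i \<le> N"
    and S: "S = {xs \<in> tuples n r. code n xs + 1 \<in> s ` {..k}}"
    and M: "\<And>a g t. (a, g, t) \<in> set M \<Longrightarrow> length t \<le> m \<and> (\<forall>xs\<in>set t. length xs = r)"
  shows "int (\<Sum>\<theta><T. coeff True R n N m l M (reindex m k N s \<theta>)) -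
      int (\<Sum>\<theta><T. coeff False R n N m l M (reindex m k N s \<theta>)) =
    (\<Sum>y<n ^ l. \<Sum>x\<leftarrow>M. mval R S (dig n y) x)"
proof -
  let ?g = "\<lambda>y g. \<forall>p\<in>set g. sat_qf R {} (dig n y) p"
  let ?t = "\<lambda>y t. \<forall>xs\<in>set t. map (dig n y) xs \<in> S"
  have count: "(\<Sum>\<theta><T. of_bool (matches n N m (dig n y) t (reindex m k N s \<theta>))) = (of_bool (?t y t) :: nat)"
    if "(a, g, t) \<in> set M" for a g t y
  proof -
    let ?z = "\<lambda>j. if j < length t then code n (map (dig n y) (t ! j)) + 1 else 0"
    have "matches n N m (dig n y) t (reindex m k N s \<theta>) \<longleftrightarrow> (\<forall>j<m. s (dig (k + 1) \<theta> j) = ?z j)" for \<theta>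
      unfolding matches_def using dig_reindex[of k s N _ m \<theta>] s(3) by simp
    then have "(\<Sum>\<theta><T. of_bool (matches n N m (dig n y) t (reindex m k N s \<theta>))) =
        (of_bool (\<forall>j<m. ?z j \<in> s ` {..k}) :: nat)"
      using count_preimages[OF s(2), of m ?z] unfolding T by (simp only:)
    also have "(\<forall>j<m. ?z j \<in> s ` {..k}) \<longleftrightarrow> ?t y t"
    proof -
      have z: "?z j \<in> s ` {..k} \<longleftrightarrow> (j < length t \<longrightarrow> map (dig n y) (t ! j) \<in> S)" for j
      proof (cases "j < length t")
        case True
        then have "length (t ! j) = r" using M[OF that] by simp
        then have "map (dig n y) (t ! j) \<in> tuples n r" using n by (auto simp: tuples_def dig_less)
        then show ?thesis using True by (simp add: S)
      next
        case False
        have "0 \<in> s ` {..k}" using s(1) by force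
        with False show ?thesis by simp
      qed
      have "length t \<le> m" using M[OF that] by blast
      then show ?thesis unfolding z all_set_conv_all_nth by auto
    qed
    finally show ?thesis .
  qed
  have sum_coeff: "(\<Sum>\<theta><T. coeff b R n N m l M (reindex m k N s \<theta>)) =
      (\<Sum>y<n ^ l. \<Sum>(a, g, t)\<leftarrow>M. of_bool (a = b \<and> ?g y g \<and> ?t y t))" for b
  proof -
    have "(\<Sum>\<theta><T. coeff b R n N m l M (reindex m k N s \<theta>)) =
      (\<Sum>y<n ^ l. \<Sum>x\<leftarrow>M. \<Sum>\<theta><T. case x of (a, g, t) \<Rightarrow>
        of_bool (a = b \<and> ?g y g \<and> matches n N m (dig n y) t (reindex m k N s \<theta>)))"
      unfolding coeff_def sum.swap[of _ "{..<n ^ l}" "{..<T}"] sum_sum_list ..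
    also have "\<dots> = (\<Sum>y<n ^ l. \<Sum>(a, g, t)\<leftarrow>M. of_bool (a = b \<and> ?g y g \<and> ?t y t))"
    proof (intro sum.cong refl arg_cong[of _ _ sum_list] map_cong)
      fix y x assume "x \<in> set M"
      moreover obtain a g t where x: "x = (a, g, t)" by (cases x)
      ultimately have mem: "(a, g, t) \<in> set M" by simp
      show "(\<Sum>\<theta><T. case x of (a, g, t) \<Rightarrow>
          of_bool (a = b \<and> ?g y g \<and> matches n N m (dig n y) t (reindex m k N s \<theta>))) =
        (case x of (a, g, t) \<Rightarrow> (of_bool (a = b \<and> ?g y g \<and> ?t y t) :: nat))"
        by (simp only: x prod.case of_bool_conj sum_distrib_left[symmetric] count[OF mem])
    qed
    finally show ?thesis .
  qed
  have "int (\<Sum>(a, g, t)\<leftarrow>M. of_bool (a = True \<and> ?g y g \<and> ?t y t)) -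
      int (\<Sum>(a, g, t)\<leftarrow>M. of_bool (a = False \<and> ?g y g \<and> ?t y t)) = (\<Sum>x\<leftarrow>M. mval R S (dig n y) x)" for y
    by (induction M) auto
  then show ?thesis unfolding sum_coeff by (simp add: sum_subtractf[symmetric])
qed

lemma sat_qf_cong:
  assumes "wf_qf ar r l p" and "\<And>x. x < l \<Longrightarrow> v x = v' x"
  shows "sat_qf R S v p = sat_qf R S v' p"
proof -
  have m: "map v xs = map v' xs" if "\<forall>x\<in>set xs. x < l" for xs using that assms(2) by simp
  show ?thesis
    using assms(1) by (induction p) (simp_all add: assms(2) m[of "_ :: nat list"])
qed

lemma sat_qf_rel_cong:
  assumes "wf_qf ar r l p" and "\<And>x. x < l \<Longrightarrow> v x < n"
    and "\<And>i xs. i < length ar \<Longrightarrow> xs \<in> tuples n (ar ! i) \<Longrightarrow> xs \<in> R i \<longleftrightarrow> xs \<in> R' i"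
  shows "sat_qf R S v p = sat_qf R' S v p"
  using assms(1)
proof (induction p)
  case (Rel i xs)
  then have "map v xs \<in> tuples n (ar ! i)" using assms(2) by (auto simp: tuples_def)
  then show ?case using Rel assms(3) by simp
qed auto

lemma all_assignments:
  assumes "wf_qf ar r l p" and "0 < n"
  shows "(\<forall>v. (\<forall>x<l. v x < n) \<longrightarrow> sat_qf R S v p) \<longleftrightarrow> (\<forall>y<n ^ l. sat_qf R S (dig n y) p)"
proof
  assume "\<forall>v. (\<forall>x<l. v x < n) \<longrightarrow> sat_qf R S v p"
  then show "\<forall>y<n ^ l. sat_qf R S (dig n y) p" using dig_less[OF assms(2)] by blast
next
  assume *: "\<forall>y<n ^ l. sat_qf R S (dig n y) p"
  show "\<forall>v. (\<forall>x<l. v x < n) \<longrightarrow> sat_qf R S v p"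
  proof (intro allI impI)
    fix v assume v: "\<forall>x<l. v x < n"
    then have "undig n l v < n ^ l" by (intro undig_less) simp
    with * have "sat_qf R S (dig n (undig n l v)) p" by blast
    moreover have "dig n (undig n l v) x = v x" if "x < l" for x using v that by (intro dig_undig) auto
    ultimately show "sat_qf R S v p" using sat_qf_cong[OF assms(1)] by blast
  qed
qed

text \<open>The successor keeps the width positive: index tuples need a first entry even if no
  monomial mentions the relation variable.\<close>

definition width :: "monomial list \<Rightarrow> nat" where
  "width M = Suc (\<Sum>(a, g, t)\<leftarrow>M. length t)"

lemma length_le_width: "(a, g, t) \<in> set M \<Longrightarrow> length t \<le> width M"
  by (induction M) (auto simp: width_def)

text \<open>On the indices from 1 to \<open>k\<close>, \<open>s\<close> enumerates the shifted codes
  of \<open>S\<close>; together with \<open>s 0 = 0\<close>, injectivity makes them nonzero and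
  distinct, so \<open>card S = k\<close>. Using \<open>monomials (Neg p)\<close> makes the
  difference of the totals the number of violating assignments.\<close>

lemma satisfiable_iff_selection:
  assumes wf: "wf_qf ar r l p" and n: "0 < n" and N: "N = n ^ r" and M: "M = monomials (Neg p)"
    and m: "m = width M" and T: "T = (k + 1) ^ m"
  shows "(\<exists>S \<subseteq> tuples n r. card S = k \<and> (\<forall>v. (\<forall>x<l. v x < n) \<longrightarrow> sat_qf R S v p)) \<longleftrightarrow>
    (\<exists>s. s 0 = 0 \<and> inj_on s {..k} \<and> (\<forall>i\<le>k. s i \<le> N) \<and>
      (\<Sum>\<theta><T. coeff True R n N m l M (reindex m k N s \<theta>)) =
      (\<Sum>\<theta><T. coeff False R n N m l M (reindex m k N s \<theta>)))" (is "?L \<longleftrightarrow> ?R")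
proof -
  have wfM: "length t \<le> m \<and> (\<forall>xs\<in>set t. length xs = r)" if "(a, g, t) \<in> set M" for a g t
    using that length_le_width[OF that] monomials_wf[of ar r l "Neg p" a g t] wf by (auto simp: m M)
  have main: "(\<Sum>\<theta><T. coeff True R n N m l M (reindex m k N s \<theta>)) =
      (\<Sum>\<theta><T. coeff False R n N m l M (reindex m k N s \<theta>)) \<longleftrightarrow>
      (\<forall>v. (\<forall>x<l. v x < n) \<longrightarrow> sat_qf R S v p)"
    if "s 0 = 0" "inj_on s {..k}" "\<And>i. i \<le> k \<Longrightarrow> s i \<le> N"
      "S = {xs \<in> tuples n r. code n xs + 1 \<in> s ` {..k}}" for s S
  proof -
    have "int (\<Sum>\<theta><T. coeff True R n N m l M (reindex m k N s \<theta>)) -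
        int (\<Sum>\<theta><T. coeff False R n N m l M (reindex m k N s \<theta>)) =
        (\<Sum>y<n ^ l. \<Sum>x\<leftarrow>M. mval R S (dig n y) x)"
      by (rule coeff_diff[OF n N T that(1,2)]) (use that(3,4) wfM in blast)+
    also have "\<dots> = (\<Sum>y<n ^ l. of_bool (\<not> sat_qf R S (dig n y) p))"
      unfolding M mval_monomials by (simp only: sat_qf.simps)
    finally have "int (\<Sum>\<theta><T. coeff True R n N m l M (reindex m k N s \<theta>)) -
        int (\<Sum>\<theta><T. coeff False R n N m l M (reindex m k N s \<theta>)) =
        (\<Sum>y<n ^ l. of_bool (\<not> sat_qf R S (dig n y) p))" .
    then have "(\<Sum>\<theta><T. coeff True R n N m l M (reindex m k N s \<theta>)) =
      (\<Sum>\<theta><T. coeff False R n N m l M (reindex m k N s \<theta>)) \<longleftrightarrow>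
      (\<Sum>y<n ^ l. of_bool (\<not> sat_qf R S (dig n y) p)) = (0::int)" by linarith
    also have "\<dots> \<longleftrightarrow> (\<forall>y<n ^ l. sat_qf R S (dig n y) p)"
      by (subst sum_nonneg_eq_0_iff) auto
    finally show ?thesis unfolding all_assignments[OF wf n] .
  qed
  show ?thesis
  proof
    assume ?L
    then obtain S where S: "S \<subseteq> tuples n r" "card S = k" "\<forall>v. (\<forall>x<l. v x < n) \<longrightarrow> sat_qf R S v p"
      by blast
    have "finite S" using S(1) finite_tuples finite_subset by blast
    then obtain h where h: "bij_betw h {0..<k} S" using ex_bij_betw_nat_finite S(2) by blast
    define s where "s = case_nat 0 (\<lambda>i. code n (h i) + 1)"
    have hS: "h i \<in> S" if "i < k" for i using bij_betwE[OF h] that by simp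
    have "inj_on s {..k}"
    proof (rule inj_onI)
      fix i j assume ij: "i \<in> {..k}" "j \<in> {..k}" "s i = s j"
      show "i = j"
      proof (cases i)
        case 0
        then show ?thesis using ij(3) by (cases j) (auto simp: s_def)
      next
        case (Suc i')
        then obtain j' where j: "j = Suc j'" using ij(3) by (cases j) (auto simp: s_def)
        have "code n (h i') = code n (h j')" using ij(3) by (simp add: s_def Suc j)
        then have "h i' = h j'"
          using inj_onD[OF inj_on_code] hS S(1) ij(1,2) Suc j by (metis Suc_le_eq atMost_iff subsetD)
        then show ?thesis
          using inj_onD[OF bij_betw_imp_inj_on[OF h]] ij(1,2) Suc j by simp
      qed
    qed
    moreover have "s i \<le> N" if "i \<le> k" for i
    proof (cases i)
      case (Suc i')
      then have "code n (h i') < N" unfolding N using code_less hS S(1) that by (meson Suc_le_eq subsetD)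
      then show ?thesis by (simp add: s_def Suc)
    qed (simp add: s_def)
    moreover have "S = {xs \<in> tuples n r. code n xs + 1 \<in> s ` {..k}}"
    proof (intro set_eqI iffI)
      fix xs assume "xs \<in> S"
      then obtain i where "i < k" "xs = h i" using bij_betw_imp_surj_on[OF h] by auto
      then have "code n xs + 1 = s (Suc i)" "Suc i \<in> {..k}" by (simp_all add: s_def)
      then show "xs \<in> {xs \<in> tuples n r. code n xs + 1 \<in> s ` {..k}}" using \<open>xs \<in> S\<close> S(1) by blast
    next
      fix xs assume xs: "xs \<in> {xs \<in> tuples n r. code n xs + 1 \<in> s ` {..k}}"
      then obtain i where i: "i \<le> k" "code n xs + 1 = s i" by auto
      then obtain i' where i': "i = Suc i'" by (cases i) (auto simp: s_def)
      then have "code n xs = code n (h i')" "h i' \<in> S" using i hS by (auto simp: s_def)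
      then have "xs = h i'" using inj_onD[OF inj_on_code] xs S(1) by blast
      then show "xs \<in> S" using \<open>h i' \<in> S\<close> by simp
    qed
    moreover have "s 0 = 0" by (simp add: s_def)
    ultimately show ?R using main[of s S] S(3) by blast
  next
    assume ?R
    then obtain s where s: "s 0 = 0" "inj_on s {..k}" "\<And>i. i \<le> k \<Longrightarrow> s i \<le> N"
      and eq: "(\<Sum>\<theta><T. coeff True R n N m l M (reindex m k N s \<theta>)) =
      (\<Sum>\<theta><T. coeff False R n N m l M (reindex m k N s \<theta>))" by blast
    define S where "S = {xs \<in> tuples n r. code n xs + 1 \<in> s ` {..k}}"
    have sub: "S \<subseteq> tuples n r" by (auto simp: S_def)
    have "(\<lambda>xs. code n xs + 1) ` S = s ` {1..k}"
    proof (intro set_eqI iffI)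
      fix x assume "x \<in> (\<lambda>xs. code n xs + 1) ` S"
      then obtain xs where "x = code n xs + 1" "xs \<in> S" by (elim imageE)
      then have "x \<noteq> 0" "x \<in> s ` {..k}" unfolding S_def by simp_all
      then obtain i where x: "i \<le> k" "x = s i" "s i \<noteq> 0" by blast
      then have "i \<noteq> 0" using s(1) by (intro notI) simp
      then show "x \<in> s ` {1..k}" using x by auto
    next
      fix x assume "x \<in> s ` {1..k}"
      then obtain i where i: "1 \<le> i" "i \<le> k" "x = s i" by auto
      then have "x \<noteq> 0" using inj_onD[OF s(2), of i 0] s(1) by auto
      moreover have "x \<le> n ^ r" using s(3) i N by auto
      ultimately have "x - 1 < n ^ r" "x = x - 1 + 1" by simp_all
      then have "code n (map (dig n (x - 1)) [0..<r]) + 1 = x" using code_map_dig by simp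
      moreover from this have "map (dig n (x - 1)) [0..<r] \<in> S"
        using map_dig_tuples[OF n] i by (simp add: S_def)
      ultimately show "x \<in> (\<lambda>xs. code n xs + 1) ` S" by (metis image_eqI)
    qed
    moreover have "inj_on (\<lambda>xs. code n xs + 1) S"
      using inj_on_subset[OF inj_on_code sub] by (auto simp: inj_on_def)
    moreover have "card (s ` {1..k}) = k"
      using card_image[OF inj_on_subset[OF s(2), of "{1..k}"]] by auto
    ultimately have "card S = k" by (metis card_image)
    then show ?L using main[OF s S_def] eq sub by blast
  qed
qed

section \<open>Encodings\<close>

lemma map_upt_add: "map f [a..<a + n] = map (\<lambda>j. f (a + j)) [0..<n]"
  by (rule nth_equalityI) auto

lemma concat_map_upt:
  "concat (map (\<lambda>i. map (f i) [0..<q]) [0..<p]) = map (\<lambda>t. f (t div q) (t mod q)) [0..<p * q]"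
proof (induction p)
  case (Suc p)
  have "map (f p) [0..<q] = map (\<lambda>t. f (t div q) (t mod q)) [p * q..<p * q + q]"
    unfolding map_upt_add by (rule map_cong) auto
  moreover have "[0..<Suc p * q] = [0..<p * q] @ [p * q..<p * q + q]"
    using upt_add_eq_append[of 0 "p * q" q] by (simp add: add.commute)
  ultimately show ?case using Suc by simp
qed simp

text \<open>\<open>List.n_lists\<close> varies the head fastest, so the list at position
  \<open>e\<close> spells \<open>e\<close> in base \<open>n\<close>, least significant digit first.
  Codes of tuples are therefore positions in the encoding.\<close>

lemma n_lists_upt: "List.n_lists r [0..<n] = map (\<lambda>e. map (dig n e) [0..<r]) [0..<n ^ r]"
proof (induction r)
  case (Suc r)
  have "List.n_lists (Suc r) [0..<n] =
      concat (map (\<lambda>e. map (\<lambda>y. y # map (dig n e) [0..<r]) [0..<n]) [0..<n ^ r])"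
    using Suc by (simp add: comp_def)
  also have "\<dots> = map (\<lambda>t. (t mod n) # map (dig n (t div n)) [0..<r]) [0..<n ^ r * n]"
    by (rule concat_map_upt)
  also have "\<dots> = map (\<lambda>t. map (dig n t) [0..<Suc r]) [0..<n ^ Suc r]"
  proof (rule map_cong)
    fix t
    have "map (dig n t) [0..<Suc r] = dig n t 0 # map (\<lambda>j. dig n t (Suc j)) [0..<r]"
      by (simp only: upt_conv_Cons[OF zero_less_Suc] map_Suc_upt[symmetric] list.map map_map comp_def)
    then show "(t mod n) # map (dig n (t div n)) [0..<r] = map (dig n t) [0..<Suc r]"
      by (simp add: dig_def div_mult2_eq)
  qed (simp add: mult.commute)
  finally show ?case .
qed simp

lemma nth_concat_upt:
  assumes "i < q" and "e < length (f i)"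
  shows "(\<Sum>j<i. length (f j)) + e < length (concat (map f [0..<q]))"
    and "concat (map f [0..<q]) ! ((\<Sum>j<i. length (f j)) + e) = f i ! e"
proof -
  have len: "length (concat (map f [0..<q])) = (\<Sum>j<q. length (f j))" for q
    by (induction q) auto
  have "(\<Sum>j<i. length (f j)) + e < length (concat (map f [0..<q])) \<and>
    concat (map f [0..<q]) ! ((\<Sum>j<i. length (f j)) + e) = f i ! e"
    using assms(1)
  proof (induction q)
    case (Suc q)
    show ?case
    proof (cases "i = q")
      case True
      then show ?thesis using assms(2) by (simp add: len nth_append)
    next
      case False
      then show ?thesis using Suc by (simp add: nth_append)
    qed
  qed simp
  then show "(\<Sum>j<i. length (f j)) + e < length (concat (map f [0..<q]))"
    "concat (map f [0..<q]) ! ((\<Sum>j<i. length (f j)) + e) = f i ! e" by simp_all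
qed

section \<open>Reading a structure off its encoding\<close>

definition lead :: "bool list \<Rightarrow> nat" where
  "lead w = length (takeWhile id w)"

lemma lead_unary: "lead (unary n @ w) = n"
  by (simp add: lead_def unary_def takeWhile_append)

lemma unary_append_inject: "unary a @ u = unary b @ v \<longleftrightarrow> a = b \<and> u = v"
proof
  assume eq: "unary a @ u = unary b @ v"
  have "lead (unary a @ u) = lead (unary b @ v)" using eq by (simp only:)
  then have "a = b" by (simp only: lead_unary)
  with eq show "a = b \<and> u = v" by simp
qed simp

definition offset :: "nat \<Rightarrow> nat list \<Rightarrow> nat \<Rightarrow> nat" where
  "offset n ar i = (\<Sum>j<i. n ^ (ar ! j))"

definition bit_at :: "bool list \<Rightarrow> nat \<Rightarrow> bool" where
  "bit_at w i \<longleftrightarrow> i < length w \<and> w ! i"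

text \<open>Defined for arbitrary words and lists by inspecting a single bit, so that it can be
  compiled; only its values on tuples of the proper arity are meaningful.\<close>

definition rel_of :: "nat list \<Rightarrow> bool list \<Rightarrow> nat \<Rightarrow> nat list set" where
  "rel_of ar w i = {xs. bit_at w (lead w + 1 + offset (lead w) ar i + code (lead w) xs)}"

definition valid_encoding :: "nat list \<Rightarrow> bool list \<Rightarrow> bool" where
  "valid_encoding ar w \<longleftrightarrow> 1 \<le> lead w \<and> length w = lead w + 1 + offset (lead w) ar (length ar)"

lemma enc_structure_alt:
  "enc_structure ar n R = unary n @
    concat (map (\<lambda>i. map (\<lambda>e. map (dig n e) [0..<ar ! i] \<in> R i) [0..<n ^ (ar ! i)]) [0..<length ar])"
  by (simp add: enc_structure_def n_lists_upt comp_def)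

lemma length_enc_structure: "length (enc_structure ar n R) = n + 1 + offset n ar (length ar)"
proof -
  have "length (concat (map (\<lambda>i. map (\<lambda>e. map (dig n e) [0..<ar ! i] \<in> R i) [0..<n ^ (ar ! i)]) [0..<q])) =
      offset n ar q" for q
    by (induction q) (simp_all add: offset_def)
  then show ?thesis unfolding enc_structure_alt by (simp add: unary_def)
qed

lemma lead_enc_structure: "lead (enc_structure ar n R) = n"
  unfolding enc_structure_def by (rule lead_unary)

lemma nth_enc_structure:
  assumes "i < length ar" and "e < n ^ (ar ! i)"
  shows "n + 1 + offset n ar i + e < length (enc_structure ar n R)"
    and "enc_structure ar n R ! (n + 1 + offset n ar i + e) \<longleftrightarrow> map (dig n e) [0..<ar ! i] \<in> R i"
proof -
  let ?f = "\<lambda>i. map (\<lambda>e. map (dig n e) [0..<ar ! i] \<in> R i) [0..<n ^ (ar ! i)]"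
  have "offset n ar i = (\<Sum>j<i. length (?f j))" by (simp add: offset_def)
  with nth_concat_upt[of i "length ar" e ?f] assms
  have "offset n ar i + e < length (concat (map ?f [0..<length ar]))"
    "concat (map ?f [0..<length ar]) ! (offset n ar i + e) \<longleftrightarrow> map (dig n e) [0..<ar ! i] \<in> R i"
    by simp_all
  moreover have "length (unary n) = n + 1" by (simp add: unary_def)
  ultimately show "n + 1 + offset n ar i + e < length (enc_structure ar n R)"
    "enc_structure ar n R ! (n + 1 + offset n ar i + e) \<longleftrightarrow> map (dig n e) [0..<ar ! i] \<in> R i"
    unfolding enc_structure_alt by (simp_all add: nth_append add.assoc)
qed

lemma rel_of_enc_structure:
  assumes "i < length ar" and "xs \<in> tuples n (ar ! i)"
  shows "xs \<in> rel_of ar (enc_structure ar n R) i \<longleftrightarrow> xs \<in> R i"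
  using nth_enc_structure[OF assms(1) code_less[OF assms(2)], of R] map_dig_code[OF assms(2)]
  by (simp add: rel_of_def bit_at_def lead_enc_structure)

lemma offset_split:
  assumes "x < offset n ar q"
  obtains i e where "i < q" and "e < n ^ (ar ! i)" and "x = offset n ar i + e"
  using assms
proof (induction q arbitrary: thesis)
  case (Suc q)
  show ?case
  proof (cases "x < offset n ar q")
    case True
    then show ?thesis using Suc.IH Suc.prems(1) by (metis less_SucI)
  next
    case False
    then have "x - offset n ar q < n ^ (ar ! q)" "x = offset n ar q + (x - offset n ar q)"
      using Suc.prems(2) by (simp_all add: offset_def)
    then show ?thesis using Suc.prems(1) by blast
  qed
qed (simp add: offset_def)

text \<open>Any word of the right length encodes the structure read off from it, so validity is a
  matter of the length and of a nonempty universe.\<close>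

lemma enc_structure_rel_of:
  assumes "valid_encoding ar w"
  shows "w = enc_structure ar (lead w) (\<lambda>i. rel_of ar w i \<inter> tuples (lead w) (ar ! i))"
    (is "w = ?w")
proof (rule nth_equalityI)
  have len: "length w = lead w + 1 + offset (lead w) ar (length ar)"
    using assms by (simp add: valid_encoding_def)
  then show "length w = length ?w" by (simp add: length_enc_structure)
  have n: "0 < lead w" using assms by (simp add: valid_encoding_def)
  fix x assume x: "x < length w"
  show "w ! x = ?w ! x"
  proof (cases "x < lead w + 1")
    case True
    have w: "w = takeWhile id w @ dropWhile id w" by simp
    have tw: "takeWhile id w = replicate (lead w) True"
      unfolding lead_def by (rule replicate_eqI[symmetric, OF refl, THEN sym]) (auto dest: set_takeWhileD)
    \<comment> \<open>The length leaves room for a letter after the leading block, and this letter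
      can only be \<open>False\<close>.\<close>
    have "dropWhile id w \<noteq> []"
    proof
      assume "dropWhile id w = []"
      then have "length w = lead w" using w by (metis append_Nil2 lead_def)
      then show False using len by simp
    qed
    then obtain u where u: "dropWhile id w = False # u"
      by (metis (full_types) hd_dropWhile id_apply list.exhaust_sel)
    have "w = unary (lead w) @ u" using w unfolding tw u by (simp add: unary_def)
    then have "w ! x = unary (lead w) ! x"
      using True by (metis length_append length_replicate list.size(3,4) nth_append One_nat_def unary_def add_0 plus_1_eq_Suc)
    moreover have "?w ! x = unary (lead w) ! x"
      using True unfolding enc_structure_def by (simp add: nth_append unary_def)
    ultimately show ?thesis by simp
  next
    case False
    then have "x - (lead w + 1) < offset (lead w) ar (length ar)" using x len by simp
    then obtain i e where ie: "i < length ar" "e < lead w ^ (ar ! i)"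
      "x - (lead w + 1) = offset (lead w) ar i + e" by (rule offset_split)
    then have x': "x = lead w + 1 + offset (lead w) ar i + e" using False by simp
    have "?w ! x \<longleftrightarrow> map (dig (lead w) e) [0..<ar ! i] \<in> rel_of ar w i"
      unfolding x' using nth_enc_structure(2)[OF ie(1,2)] map_dig_tuples[OF n] by simp
    also have "\<dots> \<longleftrightarrow> w ! x"
      using x unfolding rel_of_def bit_at_def by (simp add: code_map_dig[OF ie(2)] x')
    finally show ?thesis by simp
  qed
qed

text \<open>On genuine tuples the structure is determined by the word, so the quantifier over
  structures disappears and only functions of \<open>w\<close> remain.\<close>

lemma weighted_definability_iff:
  assumes wf: "wf_qf ar r l p"
  shows "(w, k) \<in> weighted_definability ar r l p \<longleftrightarrow> valid_encoding ar w \<and>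
    (\<exists>S \<subseteq> tuples (lead w) r. card S = k \<and>
      (\<forall>v. (\<forall>x<l. v x < lead w) \<longrightarrow> sat_qf (rel_of ar w) S v p))" (is "?L \<longleftrightarrow> ?R")
proof
  assume ?L
  then obtain n R S where w: "w = enc_structure ar n R" and R: "is_structure ar n R"
    and S: "S \<subseteq> tuples n r" "card S = k" "\<And>v. (\<forall>x<l. v x < n) \<Longrightarrow> sat_qf R S v p"
    unfolding weighted_definability_def by blast
  have n: "lead w = n" unfolding w by (rule lead_enc_structure)
  have "valid_encoding ar w"
    using R length_enc_structure[of ar n R] by (simp add: valid_encoding_def n is_structure_def w lead_enc_structure)
  moreover have "sat_qf (rel_of ar w) S v p" if "\<forall>x<l. v x < n" for v
  proof -
    have "sat_qf (rel_of ar w) S v p = sat_qf R S v p"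
      by (rule sat_qf_rel_cong[OF wf, of v n]) (use that rel_of_enc_structure[of _ ar _ n R] in \<open>auto simp: w\<close>)
    then show ?thesis using S(3)[OF that] by simp
  qed
  ultimately show ?R using S n by blast
next
  assume ?R
  then obtain S where v: "valid_encoding ar w" and S: "S \<subseteq> tuples (lead w) r" "card S = k"
    "\<And>v. (\<forall>x<l. v x < lead w) \<Longrightarrow> sat_qf (rel_of ar w) S v p" by blast
  let ?R = "\<lambda>i. rel_of ar w i \<inter> tuples (lead w) (ar ! i)"
  have "sat_qf ?R S v p" if "\<forall>x<l. v x < lead w" for v
  proof -
    have "sat_qf ?R S v p = sat_qf (rel_of ar w) S v p"
      by (rule sat_qf_rel_cong[OF wf, of v "lead w"]) (use that in auto)
    then show ?thesis using S(3)[OF that] by simp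
  qed
  moreover have "is_structure ar (lead w) ?R" using v by (auto simp: is_structure_def valid_encoding_def)
  ultimately show ?L
    unfolding weighted_definability_def using enc_structure_rel_of[OF v] S(1,2) by blast
qed

section \<open>Reading a graph off its encoding\<close>

lemma enc_pvc_matrix:
  "concat (map (\<lambda>i. map (\<lambda>j. {i, j} \<in> E) [p..<p + q]) [0..<p]) =
    map (\<lambda>t. {t div q, p + t mod q} \<in> E) [0..<p * q]"
  unfolding map_upt_add by (rule concat_map_upt)

text \<open>Unary blocks are self-delimiting, so the numbers split off one after the other; the
  matrix then determines \<open>E\<close>, as every edge joins the two classes. This excludes that a
  word becomes a yes-instance through another instance with the same encoding.\<close>

lemma enc_pvc_inject:
  assumes "enc_pvc p q E k1 k2 x = enc_pvc p' q' E' k1' k2' x'"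
    and E: "bipartite_graph {..<p} {p..<p + q} E" and E': "bipartite_graph {..<p'} {p'..<p' + q'} E'"
  shows "p' = p \<and> q' = q \<and> E' = E \<and> k1' = k1 \<and> k2' = k2 \<and> x' = x"
proof -
  have eq: "p = p' \<and> q = q' \<and> k1 = k1' \<and> k2 = k2' \<and> (x < 0) = (x' < 0) \<and> nat \<bar>x\<bar> = nat \<bar>x'\<bar> \<and>
    map (\<lambda>t. {t div q, p + t mod q} \<in> E) [0..<p * q] = map (\<lambda>t. {t div q', p' + t mod q'} \<in> E') [0..<p' * q']"
    using assms(1) unfolding enc_pvc_def enc_pvc_matrix unary_append_inject list.inject by blast
  then have "x = x'" by (cases "x < 0") auto
  have "{i, p + j} \<in> E \<longleftrightarrow> {i, p + j} \<in> E'" if "i < p" "j < q" for i j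
  proof -
    have "i * q + j < p * q" using pair_code_less[OF that] .
    moreover have "{t div q, p + t mod q} \<in> E \<longleftrightarrow> {t div q, p + t mod q} \<in> E'" if "t < p * q" for t
    proof -
      have "\<forall>t\<in>set [0..<p * q]. ({t div q, p + t mod q} \<in> E) = ({t div q, p + t mod q} \<in> E')"
        using eq unfolding map_eq_conv[symmetric] by (elim conjE) (simp only:)
      then show ?thesis using that by simp
    qed
    ultimately have "{(i * q + j) div q, p + (i * q + j) mod q} \<in> E \<longleftrightarrow>
      {(i * q + j) div q, p + (i * q + j) mod q} \<in> E'" by blast
    then show ?thesis using that by simp
  qed
  then have "e \<in> E \<longleftrightarrow> e \<in> E'" if "e = {u, v}" "u < p" "p \<le> v" "v < p + q" for e u v
    using that by (metis add_less_cancel_left le_Suc_ex)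
  then have "E = E'" using E E' eq unfolding bipartite_graph_def by (auto 0 3)
  with eq \<open>x = x'\<close> show ?thesis by simp
qed

lemma mem_partial_vertex_cover:
  assumes "bipartite_graph {..<p} {p..<p + q} E"
  shows "(enc_pvc p q E k1 k2 x, k1 + k2) \<in> partial_vertex_cover \<longleftrightarrow>
    has_partial_vertex_cover {..<p} {p..<p + q} E k1 k2 x"
  unfolding partial_vertex_cover_def using enc_pvc_inject[OF _ assms] assms by blast

text \<open>The empty word serves as the image of all words that encode no structure.\<close>

lemma Nil_not_mem_partial_vertex_cover: "([], k) \<notin> partial_vertex_cover"
  by (auto simp: partial_vertex_cover_def enc_pvc_def unary_def)

section \<open>The reduction\<close>

text \<open>The search for the first \<open>False\<close> is replaced by counting the positions up
  to which all bits are \<open>True\<close>, which is a bounded sum.\<close>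

lemma lead_eq_sum: "lead w = (\<Sum>j<length w. of_bool (\<forall>i<j + 1. i < length w \<and> w ! i))"
proof -
  have "{..<length w} \<inter> {j. \<forall>i<j + 1. i < length w \<and> w ! i} = {..<lead w}"
  proof (intro set_eqI iffI)
    fix j assume j: "j \<in> {..<length w} \<inter> {j. \<forall>i<j + 1. i < length w \<and> w ! i}"
    show "j \<in> {..<lead w}"
    proof (rule ccontr)
      assume "j \<notin> {..<lead w}"
      then have "lead w \<le> j" by simp
      then have "lead w < length w" "w ! lead w" using j by auto
      then show False using nth_length_takeWhile[of id w] by (simp add: lead_def)
    qed
  next
    fix j assume "j \<in> {..<lead w}"
    then have j: "j < length (takeWhile id w)" by (simp add: lead_def)
    have "w ! i" if "i \<le> j" for i
      using takeWhile_nth[of i id w] nth_mem[of i "takeWhile id w"] that j by (auto dest: set_takeWhileD)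
    then show "j \<in> {..<length w} \<inter> {j. \<forall>i<j + 1. i < length w \<and> w ! i}"
      using j length_takeWhile_le[of id w] by auto
  qed
  then show ?thesis by (simp only: sum_of_bool_eq finite_lessThan card_lessThan of_nat_id)
qed

lemma polyfun_lead: "polyfun (\<lambda>w \<rho>. lead w)"
  unfolding lead_eq_sum by (intro polyfun_sum polyfun.len polyfun_of_bool polypred_ball polyfun.add polyfun.num polyfun.var polypred_bit)

lemma polyfun_offset: "polyfun (\<lambda>w \<rho>. offset (lead w) ar i)"
  unfolding offset_def by (intro polyfun_sum_const polyfun_power polyfun_lead)

lemma polyfun_dig: "polyfun b \<Longrightarrow> polyfun x \<Longrightarrow> polyfun (\<lambda>w \<rho>. dig (b w \<rho>) (x w \<rho>) j)"
  unfolding dig_def by (intro polyfun_mod polyfun_div polyfun_power)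

lemma polyfun_code:
  assumes "polyfun y"
  shows "polyfun (\<lambda>w \<rho>. code (lead w) (map (dig (lead w) (y w \<rho>)) xs))"
proof -
  have "code n (map f xs) = (\<Sum>j<length xs. f (xs ! j) * n ^ j)" for n f
    by (simp add: code_def undig_def)
  then show ?thesis
    by (simp only:) (intro polyfun_sum_const polyfun_mult polyfun_power polyfun_dig polyfun_lead assms)
qed

lemma polypred_sat_qf:
  assumes "polyfun y"
  shows "polypred (\<lambda>w \<rho>. sat_qf (rel_of ar w) {} (dig (lead w) (y w \<rho>)) g)"
proof (induction g)
  case (Rel i xs)
  show ?case
    unfolding sat_qf.simps rel_of_def mem_Collect_eq bit_at_def
    by (intro polypred_bit polyfun.add polyfun_lead polyfun.num polyfun_offset polyfun_code assms)
next
  case (Eq x y')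
  show ?case unfolding sat_qf.simps by (intro polypred_eq polyfun_dig polyfun_lead assms)
qed (simp_all add: polypred_const polypred_not polypred_conj polypred_disj)

lemma polypred_matches:
  assumes "polyfun y" and "polyfun \<alpha>"
  shows "polypred (\<lambda>w \<rho>. matches (lead w) (lead w ^ r) m (dig (lead w) (y w \<rho>)) t (\<alpha> w \<rho>))"
  unfolding matches_def
proof (rule polypred_all_const)
  fix j
  show "polypred (\<lambda>w \<rho>. dig (lead w ^ r + 1) (\<alpha> w \<rho>) j =
      (if j < length t then code (lead w) (map (dig (lead w) (y w \<rho>)) (t ! j)) + 1 else 0))"
    by (intro polypred_eq polyfun_dig polyfun_if polypred_const polyfun.add polyfun_power polyfun_lead polyfun.num polyfun_code assms)
qed

text \<open>Assignments are summed over as numbers below \<open>lead w ^ l\<close>;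
  \<open>l\<close>, \<open>m\<close> and \<open>M\<close> are fixed by the formula, so the exponents
  and the sum over monomials are constants of the program.\<close>

lemma polyfun_coeff:
  assumes "polyfun \<alpha>"
  shows "polyfun (\<lambda>w \<rho>. coeff b (rel_of ar w) (lead w) (lead w ^ r) m l M (\<alpha> w \<rho>))"
  unfolding coeff_def case_prod_unfold
  by (intro polyfun_sum polyfun_sum_list polyfun_of_bool polypred_conj polypred_const polypred_list_all polypred_sat_qf polypred_matches
      polyfun_power polyfun_lead polyfun.var polyfun_weaken[OF assms])

lemma polypred_node_compat:
  assumes "polyfun k" and "polyfun H" and "polyfun u" and "polyfun v"
  shows "polypred (\<lambda>w \<rho>. node_compat m (k w \<rho>) (lead w ^ r) (H w \<rho>)
    (coeff True (rel_of ar w) (lead w) (lead w ^ r) m l M)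
    (coeff False (rel_of ar w) (lead w) (lead w ^ r) m l M) (u w \<rho>) (v w \<rho>))"
  unfolding node_compat_def
  by (intro polypred_conj polypred_all_const polypred_iff polypred_imp polypred_eq polyfun.add polyfun_mod polyfun_div polyfun_dig polyfun_power polyfun_coeff
      polyfun_lead polyfun.num assms)

lemma polypred_cover_matrix:
  assumes "polyfun V" and "\<And>u v. polyfun u \<Longrightarrow> polyfun v \<Longrightarrow> polypred (\<lambda>w \<rho>. C w \<rho> (u w \<rho>) (v w \<rho>))" and "polyfun i" and "polyfun j"
  shows "polypred (\<lambda>w \<rho>. cover_matrix (V w \<rho>) (C w \<rho>) (i w \<rho>) (j w \<rho>))"
  unfolding cover_matrix_def
  by (intro polypred_if polypred_conj polypred_not polypred_less polypred_eq polyfun_mult polyfun_div polyfun_mod polyfun.num assms)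

lemma polypred_valid_encoding: "polypred (\<lambda>w \<rho>. valid_encoding ar w)"
  unfolding valid_encoding_def by (intro polypred_conj polypred_le polypred_eq polyfun_lead polyfun.num polyfun.len polyfun.add polyfun_offset)

lemma fpt_reducible_partial_vertex_cover:
  assumes wf: "wf_qf ar r l p" and red: "fpt_reducible P (weighted_definability ar r l p)"
  shows "fpt_reducible P partial_vertex_cover"
proof -
  define M where "M = monomials (Neg p)"
  define m where "m = width M"
  define T where "T k = (k + 1) ^ m" for k :: nat
  \<comment> \<open>Bounds both coefficient functions by \<open>coeff_le\<close>: each assignment
    contributes at most one per monomial.\<close>
  define L where "L w = lead w ^ l * length M" for w
  define H where "H w k = 2 * (T k * L w) + 1" for w k
  define V where "V w k = T k * (lead w ^ r + 1) ^ m * H w k" for w k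
  define C where "C w k = node_compat m k (lead w ^ r) (H w k)
    (coeff True (rel_of ar w) (lead w) (lead w ^ r) m l M)
    (coeff False (rel_of ar w) (lead w) (lead w ^ r) m l M)" for w k
  define rows where "rows w k = V w k + (T k + 1)" for w k
  define cols where "cols w k = 2 * (V w k * V w k) + (T k + 1)" for w k
  define target where "target w k =
    T k * (V w k * V w k + (T k + 1)) + (T k * T k - T k) * (V w k + 1)" for w k
  define E where "E w k = biadjacency (rows w k) (cols w k) (cover_matrix (V w k) (C w k))" for w k
  define F where "F w k = (if valid_encoding ar w
    then enc_pvc (rows w k) (cols w k) (E w k) (T k) (T k * T k - T k) (int (target w k)) else [])" for w k
  define K where "K w k = T k + (T k * T k - T k)" for k and w :: "bool list"

  have pfT: "polyfun (\<lambda>w \<rho>. T (\<rho> 0))" unfolding T_def by (intro polyfun_power polyfun.add polyfun.var polyfun.num)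
  have pfH: "polyfun (\<lambda>w \<rho>. H w (\<rho> 0))"
    unfolding H_def L_def by (intro polyfun.add polyfun_mult polyfun_power polyfun_lead pfT polyfun.num)
  have pfV: "polyfun (\<lambda>w \<rho>. V w (\<rho> 0))"
    unfolding V_def by (intro polyfun.add polyfun_mult polyfun_power polyfun_lead pfT pfH polyfun.num)
  have pbC: "polypred (\<lambda>w \<rho>. C w (\<rho> 0) (u w \<rho>) (v w \<rho>))" if "polyfun u" "polyfun v" for u v
    unfolding C_def by (intro polypred_node_compat polyfun.var pfH that)
  have polyfun_rows: "polyfun (\<lambda>w \<rho>. rows w (\<rho> 0))" and polyfun_cols: "polyfun (\<lambda>w \<rho>. cols w (\<rho> 0))"
    unfolding rows_def cols_def by (intro polyfun.add polyfun_mult pfV pfT polyfun.num)+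
  have polyfun_target: "polyfun (\<lambda>w \<rho>. target w (\<rho> 0))"
    unfolding target_def by (intro polyfun.add polyfun.sub polyfun_mult pfV pfT polyfun.num)

  have matrix: "map (\<lambda>t. {t div cols w k, rows w k + t mod cols w k} \<in> E w k) [0..<rows w k * cols w k] =
      map (\<lambda>t. cover_matrix (V w k) (C w k) (t div cols w k) (t mod cols w k)) [0..<rows w k * cols w k]" for w k
  proof (rule map_cong)
    fix t assume "t \<in> set [0..<rows w k * cols w k]"
    moreover have "0 < cols w k" by (simp add: cols_def)
    ultimately show "{t div cols w k, rows w k + t mod cols w k} \<in> E w k \<longleftrightarrow>
        cover_matrix (V w k) (C w k) (t div cols w k) (t mod cols w k)"
      unfolding E_def by (intro mem_biadjacency) (auto simp: less_mult_imp_div_less)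
  qed simp
  \<comment> \<open>Rewritten as a concatenation of unary blocks and one list indexed by a single
    position, the form covered by the closure rules for \<open>polyword\<close>.\<close>
  have F_alt: "F w k = (if valid_encoding ar w then unary (rows w k) @ unary (cols w k) @ unary (T k) @
      unary (T k * T k - T k) @ [False] @ unary (target w k) @
      map (\<lambda>t. cover_matrix (V w k) (C w k) (t div cols w k) (t mod cols w k)) [0..<rows w k * cols w k]
      else [])" for w k
    unfolding F_def enc_pvc_def enc_pvc_matrix matrix by simp

  show ?thesis
  proof (rule fpt_reducible_trans_polyword[OF red])
    show "polyword (\<lambda>w \<rho>. F w (\<rho> 0))"
      unfolding F_alt
      by (intro polyword_if polypred_valid_encoding polyword_append polyword_unary polyword_const polyword_map polypred_cover_matrix pbC
          polyfun_div polyfun_mod polyfun_mult polyfun.sub polyfun_rows polyfun_cols pfT polyfun_target pfV)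
    show "polyfun (\<lambda>w \<rho>. K w (\<rho> 0))"
      unfolding K_def by (intro polyfun.add polyfun.sub polyfun_mult pfT)
    \<comment> \<open>The new parameter is the square of \<open>T k\<close>, a polynomial in
      \<open>k\<close> whose degree is fixed by the formula.\<close>
    have "1 \<le> T k" for k unfolding T_def by (rule one_le_power) simp
    then have "K w k = T k * T k" for w k unfolding K_def by simp
    then show "K w k \<le> (k + 1) ^ (m + m)" for w k by (simp add: T_def power_add)
    show "(w, k) \<in> weighted_definability ar r l p \<longleftrightarrow> (F w k, K w k) \<in> partial_vertex_cover" for w k
    proof (cases "valid_encoding ar w")
      case True
      then have n: "0 < lead w" by (simp add: valid_encoding_def)
      have "(w, k) \<in> weighted_definability ar r l p \<longleftrightarrow>
          (\<exists>S \<subseteq> tuples (lead w) r. card S = k \<and>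
            (\<forall>v. (\<forall>x<l. v x < lead w) \<longrightarrow> sat_qf (rel_of ar w) S v p))"
        using weighted_definability_iff[OF wf] True by simp
      also have "\<dots> \<longleftrightarrow> (\<exists>A \<subseteq> {..<V w k}. card A = T k \<and> (\<forall>u\<in>A. \<forall>v\<in>A. C w k u v))"
        unfolding satisfiable_iff_selection[OF wf n refl M_def m_def T_def] V_def C_def
        by (rule clique_iff_selection[symmetric, OF _ T_def H_def])
          (simp_all add: m_def width_def L_def coeff_le)
      also have "\<dots> \<longleftrightarrow> has_partial_vertex_cover {..<rows w k} {rows w k..<rows w k + cols w k}
          (E w k) (T k) (T k * T k - T k) (int (target w k))"
        unfolding E_def target_def Suc_eq_plus1[symmetric]
        by (rule partial_vertex_cover_iff_clique[symmetric]) (simp_all add: rows_def cols_def)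
      also have "\<dots> \<longleftrightarrow> (F w k, K w k) \<in> partial_vertex_cover"
        unfolding F_def K_def E_def if_P[OF True]
        by (rule mem_partial_vertex_cover[OF bipartite_biadjacency, symmetric])
      finally show ?thesis .
    next
      case False
      then show ?thesis
        using weighted_definability_iff[OF wf] Nil_not_mem_partial_vertex_cover by (simp add: F_def)
    qed
  qed
qed

theorem theorem8: "W1_hard partial_vertex_cover"
  unfolding W1_hard_def W1_def using fpt_reducible_partial_vertex_cover by blast

end
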